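(* Let $\gamma\ge 0.1684$. Then the function $F(z)=z^{\gamma}\widetilde H(z)$ is monotonically increasing for $z>0$. Moreover, for $T=[t_{\min},t_{\max}]$ with $0\le t_{\min}\le t_{\max}$, $t_{\max}>0$, and the weight function $w(t)=t^\gamma$, $$\lim_{n\to+\infty}\Big(\operatorname*{arg\,min}_{q>0}E^{w}_{n,T}(q)\Big)=\frac{1}{\sqrt{2}\,t_{\max}}.$$
   Context: For $q>0$ and $n\in\mathbb{N}^+$, let $\mathcal{R}^n_q=\{p_n(z)/(z+nq)^n : p_n\in\mathcal{P}_n\}$, where $\mathcal{P}_n$ is the set of real polynomials of degree at most $n$ (so these are the real rational functions of degree $n$ with all poles concentrated at $-nq$). For each time point $t$ let $$\rho^t_n(q)=\inf\Big\{\sup_{z\ge 0}|r(z)-\exp(-tz)| : r\in\mathcal{R}^n_q\Big\}.$$ The time-weighted uniform error associated with the concentrated pole $-nq$ is $$E^w_{n,T}(q)=\max_{t\in T}\big(w(t)^n\,\rho^t_n(q)\big).$$ For $z>0$ define $$\widetilde H(z)=\exp\left(\log\left|\frac{\widetilde z-1}{\widetilde z+1}\right|+z\,\Re(\widetilde z^{\,2})\right),$$ where $\widetilde z=\widetilde z(z)$ is the root, in the closed upper half plane $\Im(\zeta)\ge 0$, of the equation $z(\zeta^3-\zeta)+1=0$ that has the smallest positive real part. Here $\operatorname{arg\,min}_{q>0}$ denotes the minimizing value of $q$. *)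

theory Defs
  imports "HOL-Analysis.Analysis" "HOL-Computational_Algebra.Polynomial"
begin

text \<open>
  Rational functions are represented by the real functions they induce. Only their values on
  \<open>[0, \<infinity>)\<close> are used below, where the denominator does not vanish for \<open>q > 0\<close> and \<open>n \<ge> 1\<close>.
\<close>

definition conc_rat :: "nat \<Rightarrow> real \<Rightarrow> (real \<Rightarrow> real) set" where
  "conc_rat n q = {(\<lambda>z. poly p z / (z + real n * q) ^ n) | p. degree p \<le> n}"

text \<open>
  For \<open>q > 0\<close>, \<open>n \<ge> 1\<close> and \<open>t \<ge> 0\<close> the functions below the supremum are bounded on \<open>[0, \<infinity>)\<close>, and
  the infimum is over a nonempty set of nonnegative reals, so both are meaningful as real numbers.
\<close>

definition best_err :: "real \<Rightarrow> nat \<Rightarrow> real \<Rightarrow> real" where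
  "best_err t n q = (INF r\<in>conc_rat n q. SUP z\<in>{0..}. \<bar>r z - exp (- t * z)\<bar>)"

text \<open>
  \<open>Max\<close> is only meaningful on finite sets, so the maximum over the time set is taken with
  \<open>GREATEST\<close>: the largest element of the set of values.
\<close>

definition weighted_err :: "(real \<Rightarrow> real) \<Rightarrow> real set \<Rightarrow> nat \<Rightarrow> real \<Rightarrow> real" where
  "weighted_err w T n q = (GREATEST e. e \<in> (\<lambda>t. w t ^ n * best_err t n q) ` T)"

text \<open>
  For \<open>z > 0\<close> the cubic has a negative real root and either two further real roots, which are
  positive (and coincide for \<open>z = 3 * sqrt 3 / 2\<close>), or a pair of conjugate roots with positive real
  part. Hence exactly one root in the closed upper half plane has the smallest positive real part.
\<close>

definition crit_root :: "real \<Rightarrow> complex" where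
  "crit_root z = (THE \<zeta>. is_arg_min Re
     (\<lambda>\<zeta>. of_real z * (\<zeta> ^ 3 - \<zeta>) + 1 = 0 \<and> Im \<zeta> \<ge> 0 \<and> Re \<zeta> > 0) \<zeta>)"

definition H_tilde :: "real \<Rightarrow> real" where
  "H_tilde z = exp (ln (cmod ((crit_root z - 1) / (crit_root z + 1))) + z * Re ((crit_root z)\<^sup>2))"

end

theory Submission
  imports Defs "HOL-Real_Asymp.Real_Asymp" "HOL-Probability.Probability"
    "HOL-Complex_Analysis.Complex_Analysis"
begin

text \<open>
  The error depends on \<open>t q\<close> only. After the substitution \<open>z = n q s\<^sup>2\<close>, the rational functions times
  \<open>((s + \<i>) / (s - \<i>))\<^sup>n\<close> are bounded and holomorphic in the lower half plane, and \<open>exp (- z)\<close> times the same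
  factor is the \<open>n\<close>-th power of \<open>cw q s = exp (- q s\<^sup>2) (s + \<i>) / (s - \<i>)\<close>. Cauchy's formula on a line
  \<open>Im s = - \<eta>\<close> gives an approximant whose error is of the order of the \<open>n\<close>-th power of the maximum of
  \<open>\<bar>cw q\<bar>\<close> on that line. Conversely, orthogonality to the rational functions and the three lines theorem
  bound the error from below at the same rate if the line passes through the saddle points of \<open>cw q\<close>. With
  \<open>\<eta> = u\<close> on that line, \<open>q = 1 / (2 u (4 u\<^sup>2 - 1))\<close>, the derivative of the logarithm of the rate with
  respect to \<open>q\<close> is \<open>1 - 2 u\<^sup>2\<close>, so the rate has a strict minimum \<open>sqrt 2 - 1\<close> at \<open>q = u = 1 / sqrt 2\<close>. Multiplied
  by \<open>q\<^sup>\<gamma>\<close> it is increasing when \<open>\<gamma> \<ge> (2 u\<^sup>2 - 1) q\<close> for all \<open>u\<close>; then at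
  \<open>q = 1 / (sqrt 2 t\<^sub>m\<^sub>a\<^sub>x)\<close> the time \<open>t\<^sub>m\<^sub>a\<^sub>x\<close> dominates all the others.
\<close>

section \<open>Cauchy integrals along horizontal lines\<close>

text \<open>An oscillating integral of \<open>cw q ^ n\<close> admits no direct lower bound. What
  can be recovered from it is a point value of \<open>cw q ^ n\<close>: the residue between two
  lines, where one integral is small because \<open>cw q\<close> is smaller on its line, and the
  other because it continues analytically a function of size \<open>E\<close>. Both effects need
  lines on which the maximum of the modulus strictly increases, so three nearby lines in geometric
  progression \<open>1 + e\<close> are used, and the loss vanishes with \<open>e\<close>. Away from
  the optimal pole the lower bound only has to beat \<open>sqrt 2 - 1\<close>, uniformly in
  \<open>q\<close>. The saddle points serve \<open>q <= 1.85\<close>; further out they move onto the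
  imaginary axis, and a fixed line or points of the axis suffice. Compactness joins the local
  bounds, while \<open>q\<close> near 0 and \<open>q >= 3.3\<close> need uniform witnesses.
  Existence of a minimizer for fixed \<open>n\<close> is a separate matter: the error is below 1/2
  for every pole but tends to 1/2 as the pole tends to 0 or to infinity.\<close>

lemma has_contour_integral_linepath_same_Im_iff:
  fixes f :: "complex \<Rightarrow> complex"
  assumes "a < b"
  shows "(f has_contour_integral I) (linepath (Complex a y) (Complex b y)) \<longleftrightarrow>
         ((\<lambda>x. f (Complex x y)) has_integral I) {a..b}"
proof -
  have eq: "Complex x y = of_real x + \<i> * of_real y" for x
    by (simp add: complex_eq_iff)
  have lp: "linepath (Complex a y) (Complex b y) t = linepath (of_real a) (of_real b) t + \<i> * of_real y" for t
    unfolding linepath_def eq by (simp add: algebra_simps scaleR_conv_of_real)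
  have "(f has_contour_integral I) (linepath (Complex a y) (Complex b y)) \<longleftrightarrow>
        ((\<lambda>z. f (z + \<i> * of_real y)) has_contour_integral I) (linepath (of_real a) (of_real b))"
    unfolding has_contour_integral_linepath lp by (simp add: eq)
  also have "\<dots> \<longleftrightarrow> ((\<lambda>x. f (Complex x y)) has_integral I) {a..b}"
    using assms by (subst has_contour_integral_linepath_Reals_iff) (auto simp: eq)
  finally show ?thesis .
qed

lemma has_bochner_integral_inverse_quadratic:
  assumes "d > (0::real)"
  shows "has_bochner_integral lborel (\<lambda>x. 1 / ((x - a)\<^sup>2 + d\<^sup>2)) (pi / d)"
proof -
  have "set_integrable lborel UNIV (\<lambda>x::real. inverse (1 + x\<^sup>2))"
    using integrable_inverse_1_plus_square by simp
  moreover have "(LBINT x. inverse (1 + x\<^sup>2)) = pi"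
    using LBINT_inverse_1_plus_square
    by (simp add: interval_lebesgue_integral_def set_lebesgue_integral_def)
  ultimately have "has_bochner_integral lborel (\<lambda>x::real. inverse (1 + x\<^sup>2)) pi"
    by (simp add: has_bochner_integral_iff set_integrable_def)
  then have "has_bochner_integral lborel (\<lambda>x::real. inverse (1 + (-a/d + (1/d) * x)\<^sup>2)) (pi /\<^sub>R \<bar>1/d\<bar>)"
    using assms by (subst lborel_has_bochner_integral_real_affine_iff[symmetric]) auto
  then have "has_bochner_integral lborel (\<lambda>x::real. (1/d\<^sup>2) * inverse (1 + (-a/d + (1/d) * x)\<^sup>2)) ((1/d\<^sup>2) * (pi /\<^sub>R \<bar>1/d\<bar>))"
    by (rule has_bochner_integral_mult_right)
  moreover have "(1/d\<^sup>2) * inverse (1 + (-a/d + (1/d) * x)\<^sup>2) = 1 / ((x - a)\<^sup>2 + d\<^sup>2)" for x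
  proof -
    have "(-a/d + (1/d) * x) = (x - a)/d" by (simp add: diff_divide_distrib)
    then have "d\<^sup>2 * (1 + (-a/d + (1/d) * x)\<^sup>2) = (x - a)\<^sup>2 + d\<^sup>2"
      using assms by (simp add: power_divide field_simps)
    then show ?thesis by (metis inverse_eq_divide mult.commute nonzero_inverse_mult_distrib divide_inverse
        inverse_mult_distrib mult_1)
  qed
  moreover have "(1/d\<^sup>2) * (pi /\<^sub>R \<bar>1/d\<bar>) = pi / d"
    using assms by (simp add: field_simps power2_eq_square)
  ultimately show ?thesis by simp
qed

lemma norm_Complex_diff_ge:
  "\<bar>x - Re v\<bar> \<le> cmod (Complex x y - v)" "\<bar>y - Im v\<bar> \<le> cmod (Complex x y - v)"
  using abs_Re_le_cmod[of "Complex x y - v"] abs_Im_le_cmod[of "Complex x y - v"] by auto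

text \<open>Two simple poles give decay like 1/x^2, so boundedness of \<open>g\<close> suffices;
  this is why a second pole \<open>u\<close> accompanies \<open>v\<close> in the kernels of the
  lower bound. The inequality 1/(p r) <= (1/p^2 + 1/r^2)/2 splits the product into two Poisson
  integrals.\<close>

lemma cauchy_kernel_bound:
  fixes g :: "real \<Rightarrow> complex"
  assumes [measurable]: "g \<in> borel_measurable borel" and M: "\<And>x. cmod (g x) \<le> M"
    and d: "\<bar>y - Im v\<bar> \<ge> d1" "d1 > 0" "\<bar>y - Im u\<bar> \<ge> d2" "d2 > 0"
  shows "integrable lborel (\<lambda>x. g x / ((Complex x y - v) * (Complex x y - u)))"
    and "cmod (LBINT x. g x / ((Complex x y - v) * (Complex x y - u))) \<le> M * (pi / 2) * (1 / d1 + 1 / d2)"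
proof -
  let ?h = "\<lambda>x. M * ((1 / 2) * (1 / ((x - Re v)\<^sup>2 + d1\<^sup>2) + 1 / ((x - Re u)\<^sup>2 + d2\<^sup>2)))"
  have M0: "M \<ge> 0" using M[of 0] norm_ge_zero order_trans by blast
  have hb: "has_bochner_integral lborel ?h (M * ((1/2) * (pi / d1 + pi / d2)))"
    by (intro has_bochner_integral_mult_right has_bochner_integral_add
        has_bochner_integral_inverse_quadratic d)
  have hbi: "integrable lborel ?h" using hb by (rule integrable.intros)
  have aux: "(x - Re w)\<^sup>2 + e\<^sup>2 \<le> (cmod (Complex x y - w))\<^sup>2" if "\<bar>y - Im w\<bar> \<ge> e" "e > 0" for x w e
  proof -
    have "e\<^sup>2 \<le> (y - Im w)\<^sup>2" using that by (metis abs_le_square_iff abs_of_pos)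
    then show ?thesis by (simp add: cmod_power2)
  qed
  have am: "1 / (p * r) \<le> (1/2) * (1 / A + 1 / B)" if "A > 0" "B > 0" "A \<le> p\<^sup>2" "B \<le> r\<^sup>2" "p \<ge> 0" "r \<ge> 0" for p r A B :: real
  proof -
    have p: "p > 0" "r > 0" using that by (auto simp: less_le)
    have "1 / (p * r) \<le> (1/2) * (1 / p\<^sup>2 + 1 / r\<^sup>2)"
      using sum_squares_bound[of "1/p" "1/r"] by (simp add: power_divide)
    also have "\<dots> \<le> (1/2) * (1 / A + 1 / B)"
      using that p by (intro mult_left_mono add_mono divide_left_mono) auto
    finally show ?thesis .
  qed
  have bd: "norm (g x / ((Complex x y - v) * (Complex x y - u))) \<le> ?h x" for x
  proof -
    have "1 / (cmod (Complex x y - v) * cmod (Complex x y - u)) \<le>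
        (1 / 2) * (1 / ((x - Re v)\<^sup>2 + d1\<^sup>2) + 1 / ((x - Re u)\<^sup>2 + d2\<^sup>2))"
      by (rule am) (use d aux in \<open>auto intro!: add_nonneg_pos\<close>)
    then have "cmod (g x) * (1 / (cmod (Complex x y - v) * cmod (Complex x y - u))) \<le> ?h x"
      by (intro mult_mono M) (use M0 in auto)
    then show ?thesis by (simp add: norm_divide norm_mult)
  qed
  have [measurable]: "(\<lambda>x. g x / ((Complex x y - v) * (Complex x y - u))) \<in> borel_measurable borel"
  proof -
    have "Complex x y = of_real x + \<i> * of_real y" for x by (simp add: complex_eq_iff)
    then show ?thesis by simp
  qed
  show int: "integrable lborel (\<lambda>x. g x / ((Complex x y - v) * (Complex x y - u)))"
    by (rule Bochner_Integration.integrable_bound[OF hbi])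
      (use bd order_trans[OF _ abs_ge_self] in auto)
  have "cmod (LBINT x. g x / ((Complex x y - v) * (Complex x y - u))) \<le> (LBINT x. ?h x)"
    by (rule Bochner_Integration.integral_norm_bound_integral[OF int hbi]) (rule bd)
  also have "\<dots> = M * (pi / 2) * (1 / d1 + 1 / d2)"
    using has_bochner_integral_integral_eq[OF hb] by (simp add: field_simps)
  finally show "cmod (LBINT x. g x / ((Complex x y - v) * (Complex x y - u))) \<le> M * (pi / 2) * (1 / d1 + 1 / d2)" .
qed

text \<open>On the vertical sides |s - v| >= X - |Re v|, so each side contributes at most M / (X -
  |Re v|) times its length. For \<open>v\<close> outside the strip the winding number is 0.\<close>

lemma cauchy_rectangle:
  fixes h :: "complex \<Rightarrow> complex"
  assumes S: "open S" "convex S" and holo: "h holomorphic_on S"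
    and strip: "\<And>s. a \<le> Im s \<Longrightarrow> Im s \<le> b \<Longrightarrow> s \<in> S"
    and ab: "a < b" and v: "v \<in> S" "Im v \<noteq> a" "Im v \<noteq> b" and X: "\<bar>Re v\<bar> < X"
    and M: "\<And>x y. \<bar>x\<bar> = X \<Longrightarrow> a \<le> y \<Longrightarrow> y \<le> b \<Longrightarrow> cmod (h (Complex x y)) \<le> M"
  shows "cmod (integral {-X..X} (\<lambda>x. h (Complex x a) / (Complex x a - v))
             - integral {-X..X} (\<lambda>x. h (Complex x b) / (Complex x b - v))
             - (if a < Im v \<and> Im v < b then 2 * pi * \<i> * h v else 0)) \<le> 2 * (M / (X - \<bar>Re v\<bar>)) * (b - a)"
proof -
  have X0: "X > 0" using X by linarith
  define A1 A2 A3 A4 where "A1 = Complex (-X) a" and "A2 = Complex X a" and "A3 = Complex X b" and "A4 = Complex (-X) b"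
  note Adefs = A1_def A2_def A3_def A4_def
  let ?f = "\<lambda>s. h s / (s - v)"
  let ?I = "if a < Im v \<and> Im v < b then 2 * pi * \<i> * h v else 0"
  have rp: "rectpath A1 A3 = linepath A1 A2 +++ linepath A2 A3 +++ linepath A3 A4 +++ linepath A4 A1"
    by (simp add: rectpath_def Adefs Let_def)
  have pim: "path_image (rectpath A1 A3) \<subseteq> S - {v}"
  proof -
    have "path_image (rectpath A1 A3) \<subseteq> {z. Re z \<in> {-X, X} \<and> Im z \<in> {a..b}} \<union> {z. Im z \<in> {a, b}}"
      using X0 ab by (subst path_image_rectpath) (auto simp: Adefs)
    also have "\<dots> \<subseteq> S - {v}" using strip v X ab by auto
    finally show ?thesis .
  qed
  have win: "2 * pi * \<i> * winding_number (rectpath A1 A3) v * h v = ?I"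
  proof (cases "a < Im v \<and> Im v < b")
    case True
    then have "winding_number (rectpath A1 A3) v = 1"
      using X by (intro winding_number_rectpath) (auto simp: in_box_complex_iff Adefs)
    then show ?thesis using True by simp
  next
    case False
    then have "winding_number (rectpath A1 A3) v = 0"
      using X0 ab v by (intro winding_number_rectpath_outside) (auto simp: in_cbox_complex_iff Adefs)
    then show ?thesis using False by auto
  qed
  have hc: "(?f has_contour_integral ?I) (rectpath A1 A3)"
    unfolding win[symmetric]
    by (rule Cauchy_integral_formula_convex_simple[OF S(2) holo])
      (use S v pim in \<open>auto simp: interior_open\<close>)
  have cont: "?f contour_integrable_on (linepath p q)" if "closed_segment p q \<subseteq> S - {v}" for p q
  proof (rule contour_integrable_continuous_linepath)
    have "continuous_on S h" by (rule holomorphic_on_imp_continuous_on[OF holo])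
    then show "continuous_on (closed_segment p q) ?f"
      using that by (intro continuous_intros) (auto intro: continuous_on_subset)
  qed
  have pim': "closed_segment A1 A2 \<subseteq> S - {v}" "closed_segment A2 A3 \<subseteq> S - {v}"
    "closed_segment A3 A4 \<subseteq> S - {v}" "closed_segment A4 A1 \<subseteq> S - {v}"
    using pim unfolding rp by (auto simp: path_image_join)
  note ci = pim'[THEN cont]
  have "contour_integral (rectpath A1 A3) ?f = contour_integral (linepath A1 A2) ?f + contour_integral (linepath A2 A3) ?f +
     contour_integral (linepath A3 A4) ?f + contour_integral (linepath A4 A1) ?f"
    unfolding rp using ci by (subst contour_integral_join; simp add: contour_integrable_join)+
  then have e1: "?I = contour_integral (linepath A1 A2) ?f + contour_integral (linepath A2 A3) ?f +
     contour_integral (linepath A3 A4) ?f + contour_integral (linepath A4 A1) ?f"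
    using contour_integral_unique[OF hc] by simp
  have hline: "contour_integral (linepath (Complex (-X) y) (Complex X y)) ?f = integral {-X..X} (\<lambda>x. ?f (Complex x y))"
    if "?f contour_integrable_on linepath (Complex (-X) y) (Complex X y)" for y
  proof -
    have "(?f has_contour_integral contour_integral (linepath (Complex (-X) y) (Complex X y)) ?f) (linepath (Complex (-X) y) (Complex X y))"
      by (rule has_contour_integral_integral[OF that])
    then have "((\<lambda>x. ?f (Complex x y)) has_integral contour_integral (linepath (Complex (-X) y) (Complex X y)) ?f) {-X..X}"
      by (rule has_contour_integral_linepath_same_Im_iff[THEN iffD1, rotated]) (use X0 in simp)
    then show ?thesis by (rule integral_unique[symmetric])
  qed
  have h1: "contour_integral (linepath A1 A2) ?f = integral {-X..X} (\<lambda>x. ?f (Complex x a))"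
    using hline ci(1) unfolding Adefs .
  have c43: "?f contour_integrable_on (linepath A4 A3)"
    using pim'(3) by (intro cont) (simp add: closed_segment_commute)
  have "contour_integral (linepath A3 A4) ?f = - contour_integral (linepath A4 A3) ?f"
    using contour_integral_reversepath[of "linepath A4 A3" ?f] by simp
  also have "contour_integral (linepath A4 A3) ?f = integral {-X..X} (\<lambda>x. ?f (Complex x b))"
    using hline c43 unfolding Adefs .
  finally have h2: "contour_integral (linepath A3 A4) ?f = - integral {-X..X} (\<lambda>x. ?f (Complex x b))" .
  have vb: "cmod (contour_integral (linepath (Complex c p) (Complex c q)) ?f) \<le> (M / (X - \<bar>Re v\<bar>)) * (b - a)"
    if "\<bar>c\<bar> = X" "p = a \<and> q = b \<or> p = b \<and> q = a" "?f contour_integrable_on linepath (Complex c p) (Complex c q)" for c p q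
  proof -
    have M0: "M \<ge> 0" using M[of c a] that ab norm_ge_zero order_trans by (metis less_eq_real_def)
    have "cmod (contour_integral (linepath (Complex c p) (Complex c q)) ?f) \<le> (M / (X - \<bar>Re v\<bar>)) * cmod (Complex c q - Complex c p)"
    proof (rule has_contour_integral_bound_linepath[OF has_contour_integral_integral[OF that(3)]])
      show "0 \<le> M / (X - \<bar>Re v\<bar>)" using M0 X by simp
      fix s assume "s \<in> closed_segment (Complex c p) (Complex c q)"
      then have s: "Re s = c" "Im s \<in> {a..b}"
        using that(2) ab by (auto simp: closed_segment_same_Re closed_segment_eq_real_ivl split: if_splits)
      have "cmod (h s) \<le> M" using M[of "Re s" "Im s"] s that by auto
      moreover have "X - \<bar>Re v\<bar> \<le> cmod (s - v)"
        using abs_Re_le_cmod[of "s - v"] s that by auto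
      ultimately show "cmod (h s / (s - v)) \<le> M / (X - \<bar>Re v\<bar>)"
        unfolding norm_divide using X by (intro frac_le) (auto intro: order_trans[OF norm_ge_zero])
    qed
    also have "cmod (Complex c q - Complex c p) = b - a"
      using that(2) ab by (auto simp: cmod_def)
    finally show ?thesis .
  qed
  have "cmod (contour_integral (linepath A2 A3) ?f) \<le> (M / (X - \<bar>Re v\<bar>)) * (b - a)"
    using vb[of X a b] X0 ci(2) by (simp add: Adefs)
  moreover have "cmod (contour_integral (linepath A4 A1) ?f) \<le> (M / (X - \<bar>Re v\<bar>)) * (b - a)"
    using vb[of "-X" b a] X0 ci(4) by (simp add: Adefs)
  ultimately have "cmod (contour_integral (linepath A2 A3) ?f + contour_integral (linepath A4 A1) ?f) \<le> 2 * (M / (X - \<bar>Re v\<bar>)) * (b - a)"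
    using norm_triangle_ineq[of "contour_integral (linepath A2 A3) ?f" "contour_integral (linepath A4 A1) ?f"] by linarith
  moreover have "integral {-X..X} (\<lambda>x. ?f (Complex x a)) - integral {-X..X} (\<lambda>x. ?f (Complex x b)) - ?I
     = - (contour_integral (linepath A2 A3) ?f + contour_integral (linepath A4 A1) ?f)"
    using e1 h1 h2 by (simp add: algebra_simps)
  ultimately show ?thesis by (simp only: norm_minus_cancel)
qed

lemma tendsto_integral_symmetric:
  fixes g :: "real \<Rightarrow> complex"
  assumes "integrable lborel g"
  shows "(\<lambda>n. integral {- real n .. real n} g) \<longlonglongrightarrow> (LBINT x. g x)"
proof -
  have eq: "integral {- real n .. real n} g = (LBINT x. indicator {- real n .. real n} x *\<^sub>R g x)" for n
  proof -
    have "set_integrable lborel {- real n .. real n} g"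
      unfolding set_integrable_def using assms by (intro integrable_mult_indicator) auto
    then show ?thesis using set_borel_integral_eq_integral(2)[of "{- real n .. real n}" g]
      by (simp add: set_lebesgue_integral_def)
  qed
  have [measurable]: "g \<in> borel_measurable borel" using assms by auto
  show ?thesis unfolding eq
  proof (rule integral_dominated_convergence[where w="\<lambda>x. norm (g x)"])
    show "AE x in lborel. (\<lambda>i. indicat_real {- real i..real i} x *\<^sub>R g x) \<longlonglongrightarrow> g x"
    proof (intro AE_I2 tendsto_eventually)
      fix x :: real
      obtain N where N: "\<bar>x\<bar> \<le> real N" using real_arch_simple by blast
      show "\<forall>\<^sub>F i in sequentially. indicat_real {- real i..real i} x *\<^sub>R g x = g x"
        using eventually_ge_at_top[of N]
      proof eventually_elim
        case (elim i)
        then have "real N \<le> real i" by simp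
        then have "x \<in> {- real i..real i}" using N by auto
        then show ?case by simp
      qed
    qed
  qed (use assms in \<open>auto simp: indicator_def\<close>)
qed

text \<open>For a bounded \<open>h\<close> the quotient by \<open>s - v\<close> need not be
  integrable over a line, hence the assumption \<open>int\<close>; it turns the integrals over
  [-n, n] of \<open>cauchy_rectangle\<close> into integrals over the whole line.\<close>

lemma cauchy_strip:
  fixes h :: "complex \<Rightarrow> complex"
  assumes S: "open S" "convex S" and holo: "h holomorphic_on S"
    and strip: "\<And>s. a \<le> Im s \<Longrightarrow> Im s \<le> b \<Longrightarrow> s \<in> S"
    and ab: "a < b" and v: "v \<in> S" "Im v \<noteq> a" "Im v \<noteq> b"
    and M: "\<And>s. a \<le> Im s \<Longrightarrow> Im s \<le> b \<Longrightarrow> cmod (h s) \<le> M"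
    and int: "integrable lborel (\<lambda>x. h (Complex x a) / (Complex x a - v))"
       "integrable lborel (\<lambda>x. h (Complex x b) / (Complex x b - v))"
  shows "(LBINT x. h (Complex x a) / (Complex x a - v)) - (LBINT x. h (Complex x b) / (Complex x b - v))
             = (if a < Im v \<and> Im v < b then 2 * pi * \<i> * h v else 0)"
proof -
  let ?c = "if a < Im v \<and> Im v < b then 2 * pi * \<i> * h v else 0"
  let ?D = "\<lambda>n. integral {- real n..real n} (\<lambda>x. h (Complex x a) / (Complex x a - v))
             - integral {- real n..real n} (\<lambda>x. h (Complex x b) / (Complex x b - v)) - ?c"
  have "?D \<longlonglongrightarrow> (LBINT x. h (Complex x a) / (Complex x a - v)) - (LBINT x. h (Complex x b) / (Complex x b - v)) - ?c"
    by (intro tendsto_diff tendsto_integral_symmetric int tendsto_const)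
  moreover have "?D \<longlonglongrightarrow> 0"
  proof (rule Lim_null_comparison)
    show "\<forall>\<^sub>F n in sequentially. norm (?D n) \<le> 2 * (M / (real n - \<bar>Re v\<bar>)) * (b - a)"
    proof -
      obtain N where N: "\<bar>Re v\<bar> < real N" using reals_Archimedean2 by blast
      show ?thesis using eventually_ge_at_top[of N]
      proof eventually_elim
        case (elim n)
        then have "real N \<le> real n" by simp
        then show ?case
          using cauchy_rectangle[OF S holo strip ab v, of "real n" M] M N by force
      qed
    qed
    show "(\<lambda>n. 2 * (M / (real n - \<bar>Re v\<bar>)) * (b - a)) \<longlonglongrightarrow> 0"
      by real_asymp
  qed
  ultimately have "(LBINT x. h (Complex x a) / (Complex x a - v)) - (LBINT x. h (Complex x b) / (Complex x b - v)) - ?c = 0"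
    using LIMSEQ_unique by blast
  then show ?thesis by (simp add: algebra_simps)
qed

text \<open>Multiplying \<open>K\<close> by the exponential of a linear function normalizes the
  bounds on both edges to 1. The further factor exp(- e s^2) forces decay at infinity, so that the
  maximum principle applies on a long rectangle; finally \<open>e\<close> tends to 0.\<close>

lemma three_lines:
  fixes K :: "complex \<Rightarrow> complex"
  assumes S: "open S" and holo: "K holomorphic_on S"
    and strip: "\<And>s. p \<le> Im s \<Longrightarrow> Im s \<le> q \<Longrightarrow> s \<in> S"
    and bdd: "\<And>s. p \<le> Im s \<Longrightarrow> Im s \<le> q \<Longrightarrow> cmod (K s) \<le> M"
    and A: "A > 0" "\<And>x. cmod (K (Complex x q)) \<le> A"
    and B: "B > 0" "\<And>x. cmod (K (Complex x p)) \<le> B"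
    and v: "p < Im v" "Im v < q" and \<theta>: "\<theta> = (q - Im v) / (q - p)"
  shows "cmod (K v) \<le> A powr (1 - \<theta>) * B powr \<theta>"
proof -
  \<comment> \<open>With these values exp(\<alpha> + \<beta> Im s) equals 1/B on Im s = p and 1/A on
    Im s = q.\<close>
  define \<beta> where "\<beta> = (ln B - ln A) / (q - p)"
  define \<alpha> where "\<alpha> = - ln B - \<beta> * p"
  define Y where "Y = max \<bar>p\<bar> \<bar>q\<bar>"
  define G where "G = (\<lambda>e s. K s * exp (of_real \<alpha> - \<i> * of_real \<beta> * s) * exp (- of_real e * s\<^sup>2))"
  have pq: "p < q" using v by linarith
  have \<beta>: "\<beta> * (q - p) = ln B - ln A" using pq by (simp add: \<beta>_def)
  have nG: "cmod (G e s) = cmod (K s) * exp (\<alpha> + \<beta> * Im s) * exp (e * ((Im s)\<^sup>2 - (Re s)\<^sup>2))" for e s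
    by (simp add: G_def norm_mult algebra_simps Re_power2)
  have M0: "M \<ge> 0" using bdd[of v] v norm_ge_zero order_trans by (meson less_imp_le)
  have key: "cmod (G e v) \<le> exp (e * Y\<^sup>2)" if e: "e > 0" for e
  proof -
    define M' where "M' = M * exp (\<alpha> + \<bar>\<beta>\<bar> * Y)"
    obtain X where X: "X > \<bar>Re v\<bar>" "M' * exp (- e * X\<^sup>2) \<le> 1"
    proof -
      have "((\<lambda>X. M' * exp (- e * X\<^sup>2)) \<longlongrightarrow> 0) at_top" using e by real_asymp
      then have "\<forall>\<^sub>F X in at_top. M' * exp (- e * X\<^sup>2) < 1" by (rule order_tendstoD) simp
      moreover have "\<forall>\<^sub>F X in at_top. X > \<bar>Re v\<bar>" by (rule eventually_gt_at_top)
      ultimately have "\<forall>\<^sub>F X in at_top. X > \<bar>Re v\<bar> \<and> M' * exp (- e * X\<^sup>2) \<le> 1"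
        by eventually_elim auto
      from eventually_happens[OF this] show ?thesis using that by auto
    qed
    let ?R = "cbox (Complex (-X) p) (Complex X q)"
    have R: "?R = {s. -X \<le> Re s \<and> Re s \<le> X \<and> p \<le> Im s \<and> Im s \<le> q}"
      by (auto simp: in_cbox_complex_iff)
    have RS: "?R \<subseteq> S" using strip by (auto simp: R)
    have holG: "G e holomorphic_on S"
      unfolding G_def using holo by (intro holomorphic_intros)
    show ?thesis
    proof (rule maximum_modulus_frontier[of "G e" ?R])
      show "G e holomorphic_on interior ?R"
        by (rule holomorphic_on_subset[OF holG order_trans[OF interior_subset RS]])
      show "continuous_on (closure ?R) (G e)"
        using continuous_on_subset[OF holomorphic_on_imp_continuous_on[OF holG] RS] by (simp add: closure_closed)
      show "bounded ?R" by simp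
      show "v \<in> ?R" using v X by (auto simp: R)
      fix s assume "s \<in> frontier ?R"
      then have "s \<in> ?R - box (Complex (-X) p) (Complex X q)"
        by (simp add: frontier_def interior_cbox closure_closed)
      then have s: "-X \<le> Re s" "Re s \<le> X" "p \<le> Im s" "Im s \<le> q"
        and bd: "Re s = X \<or> Re s = -X \<or> Im s = p \<or> Im s = q"
        by (auto simp: in_cbox_complex_iff in_box_complex_iff)
      have imY: "\<bar>Im s\<bar> \<le> Y" using s unfolding Y_def by linarith
      then have imY2: "(Im s)\<^sup>2 \<le> Y\<^sup>2" by (simp add: abs_le_square_iff[symmetric])
      have ex: "exp (e * ((Im s)\<^sup>2 - (Re s)\<^sup>2)) \<le> exp (e * Y\<^sup>2)"
      proof -
        have "(Im s)\<^sup>2 - (Re s)\<^sup>2 \<le> Y\<^sup>2" using imY2 zero_le_power2[of "Re s"] by linarith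
        then show ?thesis using e by simp
      qed
      show "cmod (G e s) \<le> exp (e * Y\<^sup>2)"
      proof (cases "Im s = p \<or> Im s = q")
        case True
        have "cmod (K s) * exp (\<alpha> + \<beta> * Im s) \<le> 1"
        proof (cases "Im s = p")
          case True
          then have "cmod (K s) \<le> B" using B(2)[of "Re s"] by (metis complex_surj)
          then have "cmod (K s) * exp (\<alpha> + \<beta> * Im s) \<le> B * exp (- ln B)"
            using True by (intro mult_mono) (auto simp: \<alpha>_def B(1) less_imp_le)
          then show ?thesis using B(1) by (simp add: exp_minus)
        next
          case False
          then have q: "Im s = q" using True by blast
          then have "cmod (K s) \<le> A" using A(2)[of "Re s"] by (metis complex_surj)
          moreover have "\<alpha> + \<beta> * q = - ln A" using \<beta> by (simp add: \<alpha>_def algebra_simps)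
          ultimately have "cmod (K s) * exp (\<alpha> + \<beta> * Im s) \<le> A * exp (- ln A)"
            using q A(1) by (intro mult_mono) auto
          then show ?thesis using A(1) by (simp add: exp_minus)
        qed
        then have "cmod (G e s) \<le> 1 * exp (e * Y\<^sup>2)"
          unfolding nG using ex by (intro mult_mono) auto
        then show ?thesis by simp
      next
        case False
        then have "(Re s)\<^sup>2 = X\<^sup>2" using bd by auto
        then have e1: "exp (e * ((Im s)\<^sup>2 - (Re s)\<^sup>2)) \<le> exp (- e * X\<^sup>2) * exp (e * Y\<^sup>2)"
          using imY2 e by (simp add: exp_add[symmetric] algebra_simps)
        have "\<beta> * Im s \<le> \<bar>\<beta>\<bar> * Y"
          using mult_left_mono[OF imY, of "\<bar>\<beta>\<bar>"] by (simp add: abs_mult[symmetric])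
        then have "cmod (K s) * exp (\<alpha> + \<beta> * Im s) \<le> M'"
          unfolding M'_def using bdd s M0 by (intro mult_mono) auto
        then have "cmod (G e s) \<le> M' * (exp (- e * X\<^sup>2) * exp (e * Y\<^sup>2))"
          unfolding nG using e1 M0 by (intro mult_mono) (auto simp: M'_def)
        also have "\<dots> \<le> 1 * exp (e * Y\<^sup>2)"
          unfolding mult.assoc[symmetric] using X by (intro mult_right_mono) auto
        finally show ?thesis by simp
      qed
    qed
  qed
  have "cmod (K v) * exp (\<alpha> + \<beta> * Im v) \<le> 1"
  proof (rule tendsto_le[of "at_right (0::real)"])
    show "((\<lambda>e. exp (e * Y\<^sup>2)) \<longlongrightarrow> 1) (at_right 0)" by real_asymp
    have "((\<lambda>e. cmod (K v) * exp (\<alpha> + \<beta> * Im v) * exp (e * ((Im v)\<^sup>2 - (Re v)\<^sup>2))) \<longlongrightarrow> cmod (K v) * exp (\<alpha> + \<beta> * Im v) * exp (0 * ((Im v)\<^sup>2 - (Re v)\<^sup>2))) (at_right 0)"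
      by (intro tendsto_intros)
    then show "((\<lambda>e. cmod (G e v)) \<longlongrightarrow> cmod (K v) * exp (\<alpha> + \<beta> * Im v)) (at_right 0)"
      by (simp add: nG)
    show "\<forall>\<^sub>F e in at_right 0. cmod (G e v) \<le> exp (e * Y\<^sup>2)"
      using eventually_at_right_less by (rule eventually_mono) (use key in auto)
  qed simp
  moreover have "\<alpha> + \<beta> * Im v = - ((1 - \<theta>) * ln A + \<theta> * ln B)"
  proof -
    have v': "Im v = q - \<theta> * (q - p)" using pq by (simp add: \<theta>)
    have "\<alpha> + \<beta> * Im v = - ln B + (1 - \<theta>) * (\<beta> * (q - p))"
      unfolding v' \<alpha>_def by (simp add: algebra_simps)
    then show ?thesis unfolding \<beta> by (simp add: algebra_simps)
  qed
  moreover have "A powr (1 - \<theta>) * B powr \<theta> = exp ((1 - \<theta>) * ln A + \<theta> * ln B)"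
    using A B by (simp add: powr_def exp_add)
  ultimately show ?thesis by (simp only: exp_minus) (simp add: divide_inverse[symmetric])
qed

section \<open>Holomorphy of Cauchy transforms\<close>

lemma integrable_mult_bounded:
  fixes \<phi> k :: "real \<Rightarrow> complex"
  assumes "integrable lborel \<phi>" "k \<in> borel_measurable borel" "\<And>x. cmod (k x) \<le> c"
  shows "integrable lborel (\<lambda>x. \<phi> x * k x)"
proof (rule Bochner_Integration.integrable_bound[of _ "\<lambda>x. c * norm (\<phi> x)"])
  show "AE x in lborel. cmod (\<phi> x * k x) \<le> norm (c * cmod (\<phi> x))"
  proof (rule AE_I2)
    fix x
    have "cmod (k x) * cmod (\<phi> x) \<le> c * cmod (\<phi> x)" using assms(3) by (intro mult_right_mono) auto
    then show "cmod (\<phi> x * k x) \<le> norm (c * cmod (\<phi> x))" by (simp add: norm_mult mult.commute)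
  qed
qed (use assms in auto)

text \<open>The difference quotient minus the candidate derivative is an integral with the factor
  \<open>v - v0\<close> in front. Taking \<delta> as half the distance of \<open>v0\<close> from the
  line keeps all denominators at least \<delta> in modulus, which leaves the bound N / \<delta>^3
  for the rest.\<close>

lemma cauchy_transform_holomorphic:
  fixes \<phi> :: "real \<Rightarrow> complex"
  assumes int: "integrable lborel \<phi>"
  shows "(\<lambda>v. LBINT x. \<phi> x / (Complex x y - v)) holomorphic_on {v. y < Im v}"
proof (rule holomorphic_onI)
  fix v0 assume "v0 \<in> {v. y < Im v}"
  then have v0: "y < Im v0" by simp
  have [measurable]: "\<phi> \<in> borel_measurable borel" using int by auto
  have C: "Complex x y = of_real x + \<i> * of_real y" for x by (simp add: complex_eq_iff)
  have ge: "Im v - y \<le> cmod (Complex x y - v)" for v x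
    using norm_Complex_diff_ge(2)[of y v x] by linarith
  have ne: "Complex x y - v \<noteq> 0" if "y < Im v" for v x using that by (auto simp: complex_eq_iff)
  define \<delta> where "\<delta> = (Im v0 - y) / 2"
  have \<delta>2: "Im v0 - y = 2 * \<delta>" by (simp add: \<delta>_def)
  have \<delta>: "\<delta> > 0" using v0 by (simp add: \<delta>_def)
  note bnd = integrable_mult_bounded[OF int]
  let ?F = "\<lambda>v. LBINT x. \<phi> x / (Complex x y - v)"
  let ?D = "LBINT x. \<phi> x / (Complex x y - v0)\<^sup>2"
  have i1: "integrable lborel (\<lambda>x. \<phi> x / (Complex x y - v))" if "y < Im v" for v
    unfolding divide_inverse
    by (rule bnd[where c="1 / (Im v - y)"])
      (use that ge[of v] in \<open>auto simp: C norm_inverse inverse_eq_divide norm_divide intro!: frac_le\<close>)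
  have i2: "integrable lborel (\<lambda>x. \<phi> x / (Complex x y - v0)\<^sup>2)"
    unfolding divide_inverse
    by (rule bnd[where c="1 / (Im v0 - y)^2"])
      (use v0 ge[of v0] in \<open>auto simp: C norm_divide norm_power inverse_eq_divide intro!: divide_left_mono power_mono mult_pos_pos zero_less_power\<close>)
  define N where "N = (LBINT x. cmod (\<phi> x))"
  have est: "cmod ((?F v - ?F v0) / (v - v0) - ?D) \<le> cmod (v - v0) * (N / \<delta>^3)" if v: "cmod (v - v0) < \<delta>" "v \<noteq> v0" for v
  proof -
    have "\<bar>Im (v - v0)\<bar> < \<delta>" using v abs_Im_le_cmod[of "v - v0"] by linarith
    then have imv: "Im v - y > \<delta>" "Im v0 - y > \<delta>" "y < Im v" using \<delta> \<delta>2 by auto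
    have eq: "(\<phi> x / (Complex x y - v) - \<phi> x / (Complex x y - v0)) / (v - v0) - \<phi> x / (Complex x y - v0)\<^sup>2
         = \<phi> x * ((v - v0) / ((Complex x y - v) * (Complex x y - v0)\<^sup>2))" for x
    proof -
      define a b where "a = Complex x y - v" and "b = Complex x y - v0"
      have ab: "a \<noteq> 0" "b \<noteq> 0" "v - v0 = b - a" "b - a \<noteq> 0"
        using ne[OF imv(3)] ne[OF v0] v(2) by (auto simp: a_def b_def)
      then have "(\<phi> x / a - \<phi> x / b) / (b - a) = \<phi> x / (a * b)" by (simp add: field_simps)
      moreover have "\<phi> x / (a * b) - \<phi> x / b\<^sup>2 = \<phi> x * ((b - a) / (a * b\<^sup>2))"
        using ab(1,2) by (simp add: field_simps power2_eq_square)
      ultimately show ?thesis unfolding a_def[symmetric] b_def[symmetric] ab(3) by simp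
    qed
    have "(?F v - ?F v0) / (v - v0) - ?D = (LBINT x. \<phi> x * ((v - v0) / ((Complex x y - v) * (Complex x y - v0)\<^sup>2)))"
      unfolding eq[symmetric] using i1[OF imv(3)] i1[OF v0] i2 by simp
    also have "cmod \<dots> \<le> (LBINT x. cmod (\<phi> x) * (cmod (v - v0) / \<delta>^3))"
    proof (rule Bochner_Integration.integral_norm_bound_integral)
      show "integrable lborel (\<lambda>x. \<phi> x * ((v - v0) / ((Complex x y - v) * (Complex x y - v0)\<^sup>2)))"
        unfolding eq[symmetric] using i1[OF imv(3)] i1[OF v0] i2 by simp
      show "integrable lborel (\<lambda>x. cmod (\<phi> x) * (cmod (v - v0) / \<delta> ^ 3))" using int by simp
      fix x
      have "\<delta> * \<delta>^2 \<le> cmod (Complex x y - v) * (cmod (Complex x y - v0))\<^sup>2"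
        using imv \<delta> ge[of v x] ge[of v0 x] by (intro mult_mono power_mono) auto
      then have "cmod ((v - v0) / ((Complex x y - v) * (Complex x y - v0)\<^sup>2)) \<le> cmod (v - v0) / \<delta>^3"
        unfolding norm_divide norm_mult norm_power using \<delta>
        using ne[OF imv(3), of x] ne[OF v0, of x]
        by (intro divide_left_mono mult_pos_pos zero_less_power)
          (auto simp: power3_eq_cube power2_eq_square mult.assoc intro: order_trans)
      then show "cmod (\<phi> x * ((v - v0) / ((Complex x y - v) * (Complex x y - v0)\<^sup>2))) \<le> cmod (\<phi> x) * (cmod (v - v0) / \<delta> ^ 3)"
        unfolding norm_mult[of "\<phi> x"] by (intro mult_left_mono) auto
    qed
    also have "\<dots> = cmod (v - v0) * (N / \<delta>^3)" by (simp add: N_def)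
    finally show ?thesis .
  qed
  have "(?F has_field_derivative ?D) (at v0)"
    unfolding has_field_derivative_iff
  proof (rule LIM_zero_cancel, rule Lim_null_comparison)
    show "\<forall>\<^sub>F v in at v0. cmod ((?F v - ?F v0) / (v - v0) - ?D) \<le> cmod (v - v0) * (N / \<delta>^3)"
      unfolding eventually_at using est \<delta> by (auto simp: dist_norm intro!: exI[of _ \<delta>])
    have "((\<lambda>v. cmod (v - v0) * (N / \<delta>^3)) \<longlongrightarrow> cmod (v0 - v0) * (N / \<delta>^3)) (at v0)"
      by (intro tendsto_intros)
    then show "((\<lambda>v. cmod (v - v0) * (N / \<delta>^3)) \<longlongrightarrow> 0) (at v0)" by simp
  qed
  then show "?F field_differentiable at v0 within {v. y < Im v}"
    using field_differentiable_at_within field_differentiable_def by blast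
qed

section \<open>Orthogonality to the rational functions\<close>

lemma has_bochner_integral_gaussian:
  assumes "c > (0::real)"
  shows "has_bochner_integral lborel (\<lambda>x. exp (- c * x\<^sup>2)) (sqrt (pi / c))"
proof -
  define \<sigma> where "\<sigma> = sqrt (1 / (2 * c))"
  have s2: "\<sigma>\<^sup>2 = 1 / (2 * c)" using assms by (simp add: \<sigma>_def)
  have \<sigma>: "\<sigma> > 0" using assms by (simp add: \<sigma>_def)
  have eq: "sqrt (pi / c) * normal_density 0 \<sigma> x = exp (- c * x\<^sup>2)" for x
  proof -
    have "2 * pi * \<sigma>\<^sup>2 = pi / c" using assms by (simp add: s2)
    then have "sqrt (pi / c) * normal_density 0 \<sigma> x = exp (- (x - 0)\<^sup>2 / (2 * \<sigma>\<^sup>2))"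
      using assms by (simp add: normal_density_def)
    also have "- (x - 0)\<^sup>2 / (2 * \<sigma>\<^sup>2) = - c * x\<^sup>2" using assms by (simp add: s2)
    finally show ?thesis .
  qed
  have "has_bochner_integral lborel (\<lambda>x. sqrt (pi / c) * normal_density 0 \<sigma> x) (sqrt (pi / c) * 1)"
    using \<sigma> by (intro has_bochner_integral_mult_right) (auto simp: has_bochner_integral_iff)
  then show ?thesis by (simp add: eq)
qed

lemma borel_measurable_line:
  fixes k :: "complex \<Rightarrow> complex"
  assumes "continuous_on {s. Im s < \<delta>} k" "y < \<delta>"
  shows "(\<lambda>x. k (Complex x y)) \<in> borel_measurable borel"
proof (rule borel_measurable_continuous_onI)
  have "Complex x y = of_real x + \<i> * of_real y" for x by (simp add: complex_eq_iff)
  then have "continuous_on UNIV (\<lambda>x. Complex x y)" by (auto intro!: continuous_intros)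
  then show "continuous_on UNIV (\<lambda>x. k (Complex x y))"
    by (rule continuous_on_compose2[OF assms(1)]) (use assms(2) in auto)
qed

lemma open_convex_lower: "open {s. Im s < \<delta>}" "convex {s. Im s < \<delta>}"
  using open_halfspace_Im_lt convex_halfspace_Im_lt by auto

lemma kernel_line_shift:
  fixes k :: "complex \<Rightarrow> complex"
  assumes holo: "k holomorphic_on {s. Im s < \<delta>}" and ab: "a < b" "b < \<delta>"
    and M: "\<And>s. a \<le> Im s \<Longrightarrow> Im s \<le> b \<Longrightarrow> cmod (k s) \<le> M"
    and v: "\<delta> \<le> Im v" and u: "\<delta> \<le> Im u"
  shows "(LBINT x. k (Complex x a) / ((Complex x a - v) * (Complex x a - u))) =
         (LBINT x. k (Complex x b) / ((Complex x b - v) * (Complex x b - u)))"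
proof -
  \<comment> \<open>\<open>cauchy_strip\<close> wants one distinguished pole, but the integrand has
    none below height \<delta>. The dummy point \<open>v'\<close>, above the strip, is multiplied in
    and divided out again and contributes no residue.\<close>
  define v' where "v' = Complex 0 ((b + \<delta>) / 2)"
  define g where "g s = k s / ((s - v) * (s - u))" for s
  define h where "h s = g s * (s - v')" for s
  have v': "b < Im v'" "Im v' < \<delta>" using ab by (auto simp: v'_def)
  have M0: "M \<ge> 0" by (rule order_trans[OF norm_ge_zero M[of "Complex 0 a"]]) (use ab in auto)
  have ge: "\<delta> - Im s \<le> cmod (s - w)" if "\<delta> \<le> Im w" for s w
    using that abs_Im_le_cmod[of "s - w"] by simp
  have holh: "h holomorphic_on {s. Im s < \<delta>}"
    unfolding h_def g_def using u v by (intro holomorphic_intros holo) auto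
  have hb: "cmod (h s) \<le> M * (1 + cmod (v - v') / (\<delta> - b)) * (1 / (\<delta> - b))" if "a \<le> Im s" "Im s \<le> b" for s
  proof -
    have sv: "\<delta> - b \<le> cmod (s - v)" "\<delta> - b \<le> cmod (s - u)" using ge[OF v, of s] ge[OF u, of s] that by auto
    have sv0: "s - v \<noteq> 0" "s - u \<noteq> 0" using sv ab by auto
    have "(s - v') / (s - v) = 1 + (v - v') / (s - v)" using sv0 by (simp add: field_simps)
    then have "cmod ((s - v') / (s - v)) \<le> 1 + cmod ((v - v') / (s - v))"
      by (metis norm_one norm_triangle_ineq)
    also have "\<dots> \<le> 1 + cmod (v - v') / (\<delta> - b)"
      unfolding norm_divide using sv ab by (intro add_left_mono divide_left_mono mult_pos_pos) auto
    finally have 1: "cmod ((s - v') / (s - v)) \<le> 1 + cmod (v - v') / (\<delta> - b)" .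
    have 2: "cmod (1 / (s - u)) \<le> 1 / (\<delta> - b)"
      unfolding norm_divide using sv ab by (auto intro: frac_le)
    have hs: "h s = k s * ((s - v') / (s - v)) * (1 / (s - u))" by (simp add: h_def g_def)
    show ?thesis unfolding hs norm_mult[of _ "1 / _"] norm_mult[of "k s"]
      using ab M0 by (intro mult_mono 1 2 M that mult_nonneg_nonneg add_nonneg_nonneg divide_nonneg_pos norm_ge_zero) auto
  qed
  have hg: "h s / (s - v') = g s" if "a = Im s \<or> b = Im s" for s
  proof -
    have "s - v' \<noteq> 0" using that v' ab by auto
    then show ?thesis by (simp add: h_def)
  qed
  have int: "integrable lborel (\<lambda>x. g (Complex x y))" if "a \<le> y" "y \<le> b" for y
    unfolding g_def
  proof (rule cauchy_kernel_bound(1)[where M = M and ?d1.0 = "\<delta> - b" and ?d2.0 = "\<delta> - b"])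
    show "(\<lambda>x. k (Complex x y)) \<in> borel_measurable borel"
      using that ab by (intro borel_measurable_line[OF holomorphic_on_imp_continuous_on[OF holo]]) auto
  qed (use that ab u v M in auto)
  have "(LBINT x. h (Complex x a) / (Complex x a - v')) - (LBINT x. h (Complex x b) / (Complex x b - v'))
      = (if a < Im v' \<and> Im v' < b then 2 * pi * \<i> * h v' else 0)"
    using int[of a] int[of b] ab v'
    by (intro cauchy_strip[OF open_convex_lower holh, where M="M * (1 + cmod (v - v') / (\<delta> - b)) * (1 / (\<delta> - b))"] hb)
      (auto simp: hg)
  then show ?thesis using v' by (simp add: hg) (simp add: g_def)
qed

lemma kernel_residue:
  fixes k :: "complex \<Rightarrow> complex"
  assumes holo: "k holomorphic_on {s. Im s < \<delta>}" and ab: "b < \<delta>"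
    and M: "\<And>s. a \<le> Im s \<Longrightarrow> Im s \<le> b \<Longrightarrow> cmod (k s) \<le> M"
    and v: "a < Im v" "Im v < b" and u: "\<delta> \<le> Im u"
  shows "(LBINT x. k (Complex x a) / ((Complex x a - v) * (Complex x a - u))) -
         (LBINT x. k (Complex x b) / ((Complex x b - v) * (Complex x b - u))) = 2 * pi * \<i> * (k v / (v - u))"
proof -
  define h where "h s = k s / (s - u)" for s
  have holh: "h holomorphic_on {s. Im s < \<delta>}"
    unfolding h_def using u by (intro holomorphic_intros holo) auto
  have M0: "M \<ge> 0" by (rule order_trans[OF norm_ge_zero M[of v]]) (use v in auto)
  have hb: "cmod (h s) \<le> M / (\<delta> - b)" if "a \<le> Im s" "Im s \<le> b" for s
  proof -
    have "\<delta> - b \<le> cmod (s - u)" using u that abs_Im_le_cmod[of "s - u"] by simp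
    then show ?thesis unfolding h_def norm_divide using ab M[OF that] M0 by (intro frac_le) auto
  qed
  have eq: "h s / (s - v) = k s / ((s - v) * (s - u))" for s by (simp add: h_def mult.commute)
  define d where "d = min (\<delta> - b) (min (Im v - a) (b - Im v))"
  have int: "integrable lborel (\<lambda>x. h (Complex x y) / (Complex x y - v))" if "y = a \<or> y = b" for y
    unfolding eq
  proof (rule cauchy_kernel_bound(1)[where M = M and ?d1.0 = d and ?d2.0 = d])
    show "(\<lambda>x. k (Complex x y)) \<in> borel_measurable borel"
      using that ab v by (intro borel_measurable_line[OF holomorphic_on_imp_continuous_on[OF holo]]) auto
  qed (use that ab u v M in \<open>auto simp: d_def\<close>)
  have "(LBINT x. h (Complex x a) / (Complex x a - v)) - (LBINT x. h (Complex x b) / (Complex x b - v))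
      = (if a < Im v \<and> Im v < b then 2 * pi * \<i> * h v else 0)"
    using int[of a] int[of b] ab v
    by (intro cauchy_strip[OF open_convex_lower holh, where M="M / (\<delta> - b)"] hb) auto
  then show ?thesis using v by (simp add: eq) (simp add: h_def)
qed

text \<open>
  Substituting \<open>z = n q s\<^sup>2\<close> moves the pole \<open>- n q\<close> to \<open>s = \<plusminus> \<i>\<close> and turns \<open>exp (- z)\<close> into the \<open>n\<close>-th power of
  \<open>exp (- q s\<^sup>2)\<close>.
\<close>

definition cw :: "real \<Rightarrow> complex \<Rightarrow> complex" where
  "cw q s = exp (- of_real q * s\<^sup>2) * ((s + \<i>) / (s - \<i>))"

lemma holomorphic_cw: "(\<lambda>s. cw q s ^ n) holomorphic_on {s. Im s < 1}"
  unfolding cw_def by (intro holomorphic_intros) auto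

lemma norm_moebius_le: "Im s \<le> 0 \<Longrightarrow> cmod ((s + \<i>) / (s - \<i>)) \<le> 1"
proof -
  assume s: "Im s \<le> 0"
  have "(cmod (s + \<i>))\<^sup>2 \<le> (cmod (s - \<i>))\<^sup>2"
    using s unfolding cmod_power2 by (simp add: power2_eq_square algebra_simps)
  then have "cmod (s + \<i>) \<le> cmod (s - \<i>)" by (simp add: power2_le_iff_abs_le)
  then show ?thesis by (simp add: norm_divide divide_le_eq_1)
qed

lemma norm_moebius_real: "cmod ((of_real x + \<i>) / (of_real x - \<i>)) = 1"
proof -
  have "cmod (of_real x + \<i>) = cmod (of_real x - \<i>)" by (simp add: cmod_def)
  moreover have "of_real x - \<i> \<noteq> 0" by (simp add: complex_eq_iff)
  ultimately show ?thesis by (simp add: norm_divide)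
qed

lemma norm_cw_le: "Im s \<le> 0 \<Longrightarrow> cmod (cw q s) \<le> exp (- q * ((Re s)\<^sup>2 - (Im s)\<^sup>2))"
  unfolding cw_def norm_mult using norm_moebius_le[of s]
  by (auto simp: Re_power2 intro: mult_left_le)

lemma norm_cw_le_strip:
  assumes "q \<ge> 0" "- L \<le> Im s" "Im s \<le> 0"
  shows "cmod (cw q s ^ n) \<le> exp (q * L\<^sup>2) ^ n"
proof -
  have "(Im s)\<^sup>2 \<le> L\<^sup>2" using assms by (intro abs_le_square_iff[THEN iffD1]) auto
  then have "- ((Re s)\<^sup>2 - (Im s)\<^sup>2) \<le> L\<^sup>2" using zero_le_power2[of "Re s"] by linarith
  then have "q * - ((Re s)\<^sup>2 - (Im s)\<^sup>2) \<le> q * L\<^sup>2" by (rule mult_left_mono) (rule assms)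
  then have "exp (- q * ((Re s)\<^sup>2 - (Im s)\<^sup>2)) \<le> exp (q * L\<^sup>2)" by (simp add: algebra_simps)
  then have "cmod (cw q s) \<le> exp (q * L\<^sup>2)" using norm_cw_le[OF assms(3), of q] by linarith
  then show ?thesis unfolding norm_power by (intro power_mono) auto
qed

lemma integrable_cw_power:
  assumes "q > 0" "n \<ge> 1" "y \<ge> 0"
  shows "integrable lborel (\<lambda>x. cw q (Complex x (- y)) ^ n)"
proof (rule Bochner_Integration.integrable_bound)
  have "n * q > 0" using assms by simp
  from has_bochner_integral_gaussian[OF this]
  have "integrable lborel (\<lambda>x. exp (- (n * q) * x\<^sup>2))" by (rule integrable.intros)
  then show "integrable lborel (\<lambda>x. exp (n * q * y\<^sup>2) * exp (- (n * q) * x\<^sup>2))"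
    by (rule integrable_mult_right)
  show "(\<lambda>x. cw q (Complex x (- y)) ^ n) \<in> borel_measurable lborel"
    using borel_measurable_line[OF holomorphic_on_imp_continuous_on[OF holomorphic_cw[of q n]], of "-y"] assms by simp
  show "AE x in lborel. cmod (cw q (Complex x (- y)) ^ n) \<le> norm (exp (n * q * y\<^sup>2) * exp (- (n * q) * x\<^sup>2))"
  proof (rule AE_I2)
    fix x
    have "cmod (cw q (Complex x (- y)) ^ n) \<le> exp (- q * (x\<^sup>2 - y\<^sup>2)) ^ n"
      unfolding norm_power using norm_cw_le[of "Complex x (- y)" q] assms by (intro power_mono) auto
    also have "\<dots> = exp (n * q * y\<^sup>2) * exp (- (n * q) * x\<^sup>2)"
      by (simp add: exp_of_nat_mult[symmetric] exp_add[symmetric] algebra_simps)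
    finally show "cmod (cw q (Complex x (- y)) ^ n) \<le> norm (exp (n * q * y\<^sup>2) * exp (- (n * q) * x\<^sup>2))" by simp
  qed
qed

text \<open>
  On the real axis \<open>moebius_poly p n\<close> is the rational function \<open>p(s\<^sup>2) / (1 + s\<^sup>2)\<^sup>n\<close> times the
  unimodular factor \<open>((s + \<i>) / (s - \<i>))\<^sup>n\<close>, which moves all poles to the upper half plane.
\<close>

definition moebius_poly :: "real poly \<Rightarrow> nat \<Rightarrow> complex \<Rightarrow> complex" where
  "moebius_poly p n s = (\<Sum>k\<le>n. of_real (coeff p k) * s ^ (2 * k)) / (s - \<i>) ^ (2 * n)"

lemma poly_eq_sum_le:
  fixes p :: "'a::comm_ring_1 poly"
  assumes "degree p \<le> n"
  shows "poly p x = (\<Sum>k\<le>n. coeff p k * x ^ k)"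
  unfolding poly_altdef using assms by (intro sum.mono_neutral_left) (auto simp: coeff_eq_0)

lemma moebius_poly_real:
  assumes "degree p \<le> n"
  shows "moebius_poly p n (of_real x) =
    of_real (poly p (x\<^sup>2) / (1 + x\<^sup>2) ^ n) * ((of_real x + \<i>) / (of_real x - \<i>)) ^ n"
proof -
  have p: "(\<Sum>k\<le>n. of_real (coeff p k) * (of_real x :: complex) ^ (2 * k)) = of_real (poly p (x\<^sup>2))"
    by (simp add: poly_eq_sum_le[OF assms] power_mult)
  have nz: "(of_real x - \<i>) \<noteq> 0" "(of_real x + \<i>) \<noteq> 0" by (auto simp: complex_eq_iff)
  have e: "(1 + (of_real x)\<^sup>2 :: complex) = (of_real x + \<i>) * (of_real x - \<i>)"
    by (simp add: algebra_simps power2_eq_square)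
  have "of_real (poly p (x\<^sup>2) / (1 + x\<^sup>2) ^ n) * ((of_real x + \<i>) / (of_real x - \<i>)) ^ n =
    of_real (poly p (x\<^sup>2)) / ((of_real x + \<i>) * (of_real x - \<i>)) ^ n * ((of_real x + \<i>) / (of_real x - \<i>)) ^ n"
    by (simp add: e)
  also have "\<dots> = of_real (poly p (x\<^sup>2)) / (of_real x - \<i>) ^ (2 * n)"
    using nz by (simp add: power_mult_distrib power_divide mult_2 power_add)
  finally show ?thesis unfolding moebius_poly_def p by simp
qed

text \<open>In the lower half plane |s| <= |s - \<i>| and |s - \<i>| >= 1, so the denominator
  dominates every power of \<open>s\<close> up to 2 n.\<close>

lemma norm_moebius_poly_le:
  assumes "Im s \<le> 0"
  shows "cmod (moebius_poly p n s) \<le> (\<Sum>k\<le>n. \<bar>coeff p k\<bar>)"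
proof -
  have s1: "cmod (s - \<i>) \<ge> 1" using assms abs_Im_le_cmod[of "s - \<i>"] by auto
  have "(cmod s)\<^sup>2 \<le> (cmod (s - \<i>))\<^sup>2"
    using assms unfolding cmod_power2 by (simp add: power2_eq_square algebra_simps)
  then have s2: "cmod s \<le> cmod (s - \<i>)" by (simp add: power2_le_iff_abs_le)
  have "cmod (of_real (coeff p k) * s ^ (2 * k)) \<le> \<bar>coeff p k\<bar> * cmod (s - \<i>) ^ (2 * n)" if "k \<le> n" for k
  proof -
    have "cmod s ^ (2 * k) \<le> cmod (s - \<i>) ^ (2 * k)" using s2 by (intro power_mono) auto
    also have "\<dots> \<le> cmod (s - \<i>) ^ (2 * n)" using s1 that by (intro power_increasing) auto
    finally show ?thesis by (simp add: norm_mult norm_power mult_left_mono)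
  qed
  then have "cmod (\<Sum>k\<le>n. of_real (coeff p k) * s ^ (2 * k)) \<le> (\<Sum>k\<le>n. \<bar>coeff p k\<bar> * cmod (s - \<i>) ^ (2 * n))"
    by (intro sum_norm_le) auto
  then have "cmod (\<Sum>k\<le>n. of_real (coeff p k) * s ^ (2 * k)) \<le> (\<Sum>k\<le>n. \<bar>coeff p k\<bar>) * cmod (s - \<i>) ^ (2 * n)"
    by (simp add: sum_distrib_right)
  moreover have "cmod (s - \<i>) ^ (2 * n) > 0" using s1 by (intro zero_less_power) linarith
  ultimately show ?thesis by (simp add: moebius_poly_def norm_divide norm_power divide_le_eq)
qed

lemma holomorphic_moebius_poly: "moebius_poly p n holomorphic_on {s. Im s < 1}"
  unfolding moebius_poly_def by (intro holomorphic_intros) auto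

text \<open>All poles lie in the upper half plane, so the line can be pushed down to Im s = - (m +
  1), where the kernel integral is O(1/m).\<close>

lemma moebius_poly_orthogonal:
  assumes v: "Im v > 0" and u: "Im u > 0"
  shows "(LBINT x. moebius_poly p n (Complex x 0) / ((Complex x 0 - v) * (Complex x 0 - u))) = 0"
    (is "?I = 0")
proof -
  define \<delta> where "\<delta> = min 1 (min (Im v) (Im u))"
  define M where "M = (\<Sum>k\<le>n. \<bar>coeff p k\<bar>)"
  have hol: "moebius_poly p n holomorphic_on {s. Im s < \<delta>}"
    by (rule holomorphic_on_subset[OF holomorphic_moebius_poly]) (auto simp: \<delta>_def)
  have "cmod ?I \<le> M * (pi / 2) * (1 / real (Suc m) + 1 / real (Suc m))" for m
  proof -
    have "?I = (LBINT x. moebius_poly p n (Complex x (- real (Suc m))) /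
         ((Complex x (- real (Suc m)) - v) * (Complex x (- real (Suc m)) - u)))"
      using v u by (intro kernel_line_shift[OF hol, symmetric, where M=M])
        (auto simp: \<delta>_def M_def intro!: norm_moebius_poly_le)
    also have "cmod \<dots> \<le> M * (pi / 2) * (1 / real (Suc m) + 1 / real (Suc m))"
    proof (rule cauchy_kernel_bound(2))
      show "(\<lambda>x. moebius_poly p n (Complex x (- real (Suc m)))) \<in> borel_measurable borel"
        using v u by (intro borel_measurable_line[OF holomorphic_on_imp_continuous_on[OF hol]]) (auto simp: \<delta>_def)
    qed (use v u in \<open>auto simp: M_def intro!: norm_moebius_poly_le\<close>)
    finally show ?thesis .
  qed
  moreover have "(\<lambda>m. M * (pi / 2) * (1 / real (Suc m) + 1 / real (Suc m))) \<longlonglongrightarrow> 0" by real_asymp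
  ultimately have "cmod ?I \<le> 0" by (intro LIMSEQ_le_const) auto
  then show ?thesis by simp
qed

section \<open>The contour estimate\<close>

text \<open>With both poles above the real axis the path can be raised to that axis. There
  \<open>moebius_poly p n\<close> may be subtracted at no cost by orthogonality, and the difference
  has exactly the modulus of the approximation error, since the Moebius factor is
  unimodular.\<close>

lemma kernel_top_bound:
  assumes q: "q > 0" and n: "n \<ge> 1" and deg: "degree p \<le> n"
    and err: "\<And>u. u \<ge> 0 \<Longrightarrow> \<bar>poly p u / (1 + u) ^ n - exp (- (n * q) * u)\<bar> \<le> E"
    and \<alpha>: "\<alpha> > 0" and v: "Im v \<ge> d1" "d1 > 0" and u: "Im u \<ge> d2" "d2 > 0"
  shows "cmod (LBINT x. cw q (Complex x (- \<alpha>)) ^ n / ((Complex x (- \<alpha>) - v) * (Complex x (- \<alpha>) - u)))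
     \<le> E * (pi / 2) * (1 / d1 + 1 / d2)"
proof -
  define \<delta> where "\<delta> = min 1 (min d1 d2)"
  have \<delta>: "\<delta> > 0" "\<delta> \<le> 1" "\<delta> \<le> Im v" "\<delta> \<le> Im u" using v u by (auto simp: \<delta>_def)
  have hol: "(\<lambda>s. cw q s ^ n) holomorphic_on {s. Im s < \<delta>}"
    by (rule holomorphic_on_subset[OF holomorphic_cw]) (use \<delta> in auto)
  have hol2: "moebius_poly p n holomorphic_on {s. Im s < \<delta>}"
    by (rule holomorphic_on_subset[OF holomorphic_moebius_poly]) (use \<delta> in auto)
  note meas = borel_measurable_line[OF holomorphic_on_imp_continuous_on[OF hol] \<delta>(1)]
    borel_measurable_line[OF holomorphic_on_imp_continuous_on[OF hol2] \<delta>(1)]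
  let ?den = "\<lambda>x. (Complex x 0 - v) * (Complex x 0 - u)"
  let ?P = "\<lambda>x. moebius_poly p n (Complex x 0)" and ?k = "\<lambda>x. cw q (Complex x 0) ^ n"
  have shift: "(LBINT x. cw q (Complex x (- \<alpha>)) ^ n / ((Complex x (- \<alpha>) - v) * (Complex x (- \<alpha>) - u)))
     = (LBINT x. ?k x / ?den x)"
    by (rule kernel_line_shift[OF hol, where M="exp (q * \<alpha>\<^sup>2) ^ n"])
      (use \<alpha> \<delta> q norm_cw_le_strip in auto)
  have ik: "integrable lborel (\<lambda>x. ?k x / ?den x)"
    by (rule cauchy_kernel_bound(1)[OF meas(1), where M="exp (q * 0\<^sup>2) ^ n" and ?d1.0=d1 and ?d2.0=d2])
      (use norm_cw_le_strip[of q 0] q v u in auto)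
  have iP: "integrable lborel (\<lambda>x. ?P x / ?den x)"
    by (rule cauchy_kernel_bound(1)[OF meas(2) norm_moebius_poly_le, where ?d1.0=d1 and ?d2.0=d2]) (use v u in auto)
  have "(LBINT x. ?P x / ?den x) = 0"
    using v u by (intro moebius_poly_orthogonal) auto
  then have eq: "(LBINT x. ?k x / ?den x) = (LBINT x. (?k x - ?P x) / ?den x)"
    using ik iP by (simp add: diff_divide_distrib)
  have bd: "cmod (?k x - ?P x) \<le> E" for x
  proof -
    have C: "Complex x 0 = of_real x" by (simp add: complex_eq_iff)
    have "cw q (of_real x) ^ n = of_real (exp (- (n * q) * x\<^sup>2)) * ((of_real x + \<i>) / (of_real x - \<i>)) ^ n"
    proof -
      have "- of_real q * (of_real x)\<^sup>2 = (of_real (- q * x\<^sup>2) :: complex)" by simp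
      then have "cw q (of_real x) = of_real (exp (- q * x\<^sup>2)) * ((of_real x + \<i>) / (of_real x - \<i>))"
        by (simp only: cw_def exp_of_real)
      moreover have "exp (- q * x\<^sup>2) ^ n = exp (- (n * q) * x\<^sup>2)"
        by (simp add: exp_of_nat_mult[symmetric])
      ultimately show ?thesis by (metis of_real_power power_mult_distrib)
    qed
    then have "?k x - ?P x = of_real (exp (- (n * q) * x\<^sup>2) - poly p (x\<^sup>2) / (1 + x\<^sup>2) ^ n) * ((of_real x + \<i>) / (of_real x - \<i>)) ^ n"
      unfolding C moebius_poly_real[OF deg] by (simp add: algebra_simps)
    then have "cmod (?k x - ?P x) = \<bar>poly p (x\<^sup>2) / (1 + x\<^sup>2) ^ n - exp (- (n * q) * x\<^sup>2)\<bar>"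
      by (simp add: norm_mult norm_power norm_moebius_real abs_minus_commute del: of_real_diff)
    then show ?thesis using err[of "x\<^sup>2"] by simp
  qed
  have "(\<lambda>x. ?k x - ?P x) \<in> borel_measurable borel" using meas by measurable
  then show ?thesis unfolding shift eq
    by (rule cauchy_kernel_bound(2)) (use bd v u in auto)
qed

text \<open>
  The Cauchy transform \<open>K\<close> of \<open>cw q ^ n\<close> over \<open>Im s = - h (1 + e)\<^sup>2\<close> is of size \<open>E\<close> on \<open>Im v = h e\<close> by
  orthogonality, and of size \<open>B2 ^ n\<close> on \<open>Im v = - h (1 + 2 e)\<close>; interpolate between these lines. Moving the
  path of integration up to \<open>Im s = - h\<close> picks up the value of \<open>cw q ^ n\<close> on \<open>Im v = - h (1 + e)\<close>.
\<close>

theorem contour_estimate: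
  fixes p :: "real poly"
  assumes q: "q > 0" and n: "n \<ge> 1" and deg: "degree p \<le> n" and E: "E > 0"
    and err: "\<And>u. u \<ge> 0 \<Longrightarrow> \<bar>poly p u / (1 + u) ^ n - exp (- (n * q) * u)\<bar> \<le> E"
    and h: "h > 0" and e: "e > 0"
    and B1: "\<And>x. cmod (cw q (Complex x (- h))) \<le> B1"
    and B2: "\<And>x. cmod (cw q (Complex x (- (h * (1 + e)\<^sup>2)))) \<le> B2"
    and x0: "\<bar>x0\<bar> \<le> 2 * h * (1 + e)" and \<theta>: "\<theta> = (1 + 2 * e) / (1 + 3 * e)"
  shows "cmod (cw q (Complex x0 (- (h * (1 + e))))) ^ n \<le>
    (4 + 3 * e) * (1 + 1 / e + 1 / e\<^sup>2) * (B1 ^ n + E powr (1 - \<theta>) * (B2 ^ n) powr \<theta>)"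
proof -
  define \<alpha> where "\<alpha> = h * (1 + e)\<^sup>2"
  \<comment> \<open>The auxiliary pole is placed at height \<open>h\<close> so that every estimate
    scales with \<open>h\<close>; the factor 1/h then cancels against |v - u| at the end.\<close>
  define u where "u = Complex 0 h"
  define v where "v = Complex x0 (- (h * (1 + e)))"
  define k where "k s = cw q s ^ n" for s
  define c where "c = 1 + 1 / e + 1 / e\<^sup>2"
  define K where "K w = (LBINT x. k (Complex x (- \<alpha>)) / ((Complex x (- \<alpha>) - w) * (Complex x (- \<alpha>) - u)))" for w
  define J where "J = (LBINT x. k (Complex x (- h)) / ((Complex x (- h) - v) * (Complex x (- h) - u)))"
  have \<alpha>: "\<alpha> = h + 2 * (h * e) + h * e\<^sup>2" by (simp add: \<alpha>_def power2_eq_square algebra_simps)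
  have he: "h * e > 0" "h * e\<^sup>2 > 0" using h e by auto
  have \<alpha>0: "\<alpha> > 0" unfolding \<alpha> using h he by linarith
  have B0: "B1 \<ge> 0" by (rule order_trans[OF norm_ge_zero B1])
  \<comment> \<open>\<open>cw q\<close> vanishes at - \<i>, which may lie on the line. A point with
    real part 1 is never a zero, so B2 > 0, as the real powers require.\<close>
  have nz: "cw q (Complex 1 y) \<noteq> 0" if "y \<le> 0" for y
  proof -
    have "Complex 1 y + \<i> \<noteq> 0" "Complex 1 y - \<i> \<noteq> 0" by (auto simp: complex_eq_iff)
    then show ?thesis by (simp add: cw_def)
  qed
  have B20: "B2 > 0" using nz[of "- \<alpha>"] B2[of 1] \<alpha>0 unfolding \<alpha>_def[symmetric]
    by (smt (verit) zero_less_norm_iff)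
  have c0: "c > 0" using e by (simp add: c_def add_pos_pos)
  have c1: "1 / e + 1 \<le> c" "1 / e\<^sup>2 + 1 \<le> c" using e by (auto simp: c_def)
  have "continuous_on {s. Im s < 1} (\<lambda>s. cw q s ^ n)"
    by (rule holomorphic_on_imp_continuous_on[OF holomorphic_cw])
  then have meas: "(\<lambda>x. k (Complex x y)) \<in> borel_measurable borel" if "y \<le> 0" for y
    unfolding k_def using that by (intro borel_measurable_line) auto
  have kB1: "cmod (k (Complex x (- h))) \<le> B1 ^ n" for x
    unfolding k_def norm_power by (intro power_mono B1) auto
  have kB2: "cmod (k (Complex x (- \<alpha>))) \<le> B2 ^ n" for x
    unfolding k_def norm_power \<alpha>_def by (intro power_mono B2) auto

  have Kbd: "cmod (K w) \<le> B2 ^ n * (pi / 2) * (1 / (h * e\<^sup>2) + 1 / h)" if "Im w \<ge> - (h * (1 + 2 * e))" for w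
    unfolding K_def
  proof (rule cauchy_kernel_bound(2)[OF meas kB2])
    have "h * e\<^sup>2 \<le> Im w + \<alpha>" using that by (simp add: \<alpha> algebra_simps)
    then show "h * e\<^sup>2 \<le> \<bar>- \<alpha> - Im w\<bar>" by linarith
    have "\<bar>- \<alpha> - Im u\<bar> = \<alpha> + h" using h \<alpha>0 by (simp add: u_def)
    then show "h \<le> \<bar>- \<alpha> - Im u\<bar>" using \<alpha>0 by linarith
  qed (use h he \<alpha>0 in auto)
  have Ktop: "cmod (K w) \<le> E * (pi / 2) * (1 / (h * e) + 1 / h)" if "Im w \<ge> h * e" for w
    unfolding K_def k_def using h he that
    by (intro kernel_top_bound[OF q n deg err \<alpha>0]) (auto simp: u_def)
  have Kholo: "K holomorphic_on {w. - \<alpha> < Im w}"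
  proof -
    have "integrable lborel (\<lambda>x. k (Complex x (- \<alpha>)) / (Complex x (- \<alpha>) - u))"
    proof (rule Bochner_Integration.integrable_bound)
      show "integrable lborel (\<lambda>x. (1 / h) * cmod (k (Complex x (- \<alpha>))))"
        using integrable_cw_power[OF q n, of \<alpha>] \<alpha>0 by (simp add: k_def)
      have "Complex x (- \<alpha>) = of_real x - \<i> * of_real \<alpha>" for x by (simp add: complex_eq_iff)
      then show "(\<lambda>x. k (Complex x (- \<alpha>)) / (Complex x (- \<alpha>) - u)) \<in> borel_measurable lborel"
        using meas[of "- \<alpha>"] \<alpha>0 by simp
      show "AE x in lborel. cmod (k (Complex x (- \<alpha>)) / (Complex x (- \<alpha>) - u)) \<le> norm ((1 / h) * cmod (k (Complex x (- \<alpha>))))"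
      proof (rule AE_I2)
        fix x
        have "h \<le> cmod (Complex x (- \<alpha>) - u)"
          using norm_Complex_diff_ge(2)[of "- \<alpha>" u x] h \<alpha>0 by (simp add: u_def)
        then have "cmod (k (Complex x (- \<alpha>)) / (Complex x (- \<alpha>) - u)) \<le> cmod (k (Complex x (- \<alpha>))) / h"
          unfolding norm_divide using h by (intro divide_left_mono mult_pos_pos) auto
        then show "cmod (k (Complex x (- \<alpha>)) / (Complex x (- \<alpha>) - u)) \<le> norm ((1 / h) * cmod (k (Complex x (- \<alpha>))))"
          using h by simp
      qed
    qed
    from cauchy_transform_holomorphic[OF this] show ?thesis
      unfolding K_def by (simp add: mult.commute)
  qed

  have Im_v: "Im v = - (h * (1 + e))" by (simp add: v_def)
  \<comment> \<open>The point \<open>v\<close> lies h (1 + 2 e) below the upper line, and the two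
    lines are h (1 + 3 e) apart; this is the origin of \<theta>.\<close>
  have "cmod (K v) \<le> (E * (pi / 2) * (c / h)) powr (1 - \<theta>) * (B2 ^ n * (pi / 2) * (c / h)) powr \<theta>"
  proof (rule three_lines[OF _ Kholo, where p="- (h * (1 + 2 * e))" and q="h * e"])
    show "open {w. - \<alpha> < Im w}" by (rule open_halfspace_Im_gt)
    show "s \<in> {w. - \<alpha> < Im w}" if "- (h * (1 + 2 * e)) \<le> Im s" for s
      using that he by (auto simp: \<alpha> algebra_simps)
    show "cmod (K s) \<le> B2 ^ n * (pi / 2) * (1 / (h * e\<^sup>2) + 1 / h)" if "- (h * (1 + 2 * e)) \<le> Im s" for s
      using Kbd that by simp
    show "E * (pi / 2) * (c / h) > 0" "B2 ^ n * (pi / 2) * (c / h) > 0"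
      using E h c0 B20 by auto
    fix x
    have "E * (pi / 2) * (1 / (h * e) + 1 / h) \<le> E * (pi / 2) * (c / h)"
    proof -
      have "1 / (h * e) + 1 / h = (1 / e + 1) / h" by (simp add: add_divide_distrib)
      then show ?thesis using c1 h E by (auto intro!: mult_left_mono divide_right_mono)
    qed
    then show "cmod (K (Complex x (h * e))) \<le> E * (pi / 2) * (c / h)"
      by (rule order_trans[OF Ktop, rotated]) simp
    have "B2 ^ n * (pi / 2) * (1 / (h * e\<^sup>2) + 1 / h) \<le> B2 ^ n * (pi / 2) * (c / h)"
    proof -
      have "1 / (h * e\<^sup>2) + 1 / h = (1 / e\<^sup>2 + 1) / h" by (simp add: add_divide_distrib)
      then show ?thesis using c1 h B20 by (auto intro!: mult_left_mono divide_right_mono)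
    qed
    then show "cmod (K (Complex x (- (h * (1 + 2 * e))))) \<le> B2 ^ n * (pi / 2) * (c / h)"
      by (rule order_trans[OF Kbd, rotated]) simp
  next
    show "- (h * (1 + 2 * e)) < Im v" "Im v < h * e" using he h by (auto simp: Im_v algebra_simps)
    have "h * e - Im v = h * (1 + 2 * e)" "h * e - - (h * (1 + 2 * e)) = h * (1 + 3 * e)"
      by (auto simp: Im_v algebra_simps)
    then show "\<theta> = (h * e - Im v) / (h * e - - (h * (1 + 2 * e)))" using h by (simp add: \<theta>)
  qed
  also have "\<dots> = (pi / 2) * (c / h) * (E powr (1 - \<theta>) * (B2 ^ n) powr \<theta>)"
  proof -
    have "E * (pi / 2) * (c / h) = E * ((pi / 2) * (c / h))" "B2 ^ n * (pi / 2) * (c / h) = B2 ^ n * ((pi / 2) * (c / h))" by simp_all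
    then have "(E * (pi / 2) * (c / h)) powr (1 - \<theta>) * (B2 ^ n * (pi / 2) * (c / h)) powr \<theta>
      = (E powr (1 - \<theta>) * (B2 ^ n) powr \<theta>) * (((pi / 2) * (c / h)) powr (1 - \<theta>) * ((pi / 2) * (c / h)) powr \<theta>)"
      using E B20 c0 h by (simp only: powr_mult) (simp add: mult_ac)
    also have "((pi / 2) * (c / h)) powr (1 - \<theta>) * ((pi / 2) * (c / h)) powr \<theta> = (pi / 2) * (c / h)"
      using c0 h by (simp add: powr_add[symmetric])
    finally show ?thesis by (simp only: mult_ac)
  qed
  finally have Kv: "cmod (K v) \<le> (pi / 2) * (c / h) * (E powr (1 - \<theta>) * (B2 ^ n) powr \<theta>)" .

  have "cmod J \<le> B1 ^ n * (pi / 2) * (1 / (h * e) + 1 / h)"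
    unfolding J_def
  proof (rule cauchy_kernel_bound(2)[OF meas kB1])
    show "h * e \<le> \<bar>- h - Im v\<bar>" using he by (simp add: Im_v algebra_simps)
    show "h \<le> \<bar>- h - Im u\<bar>" using h by (simp add: u_def)
  qed (use h he in auto)
  also have "\<dots> \<le> B1 ^ n * (pi / 2) * (c / h)"
  proof -
    have "1 / (h * e) + 1 / h = (1 / e + 1) / h" by (simp add: add_divide_distrib)
    then show ?thesis using c1 h B0 by (auto intro!: mult_left_mono divide_right_mono)
  qed
  finally have Jb: "cmod J \<le> (pi / 2) * (c / h) * B1 ^ n" by (simp add: mult_ac)

  have "K v - J = 2 * pi * \<i> * (k v / (v - u))"
    unfolding K_def J_def
  proof (rule kernel_residue[where \<delta>="min 1 h" and M="exp (q * \<alpha>\<^sup>2) ^ n"])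
    show "k holomorphic_on {s. Im s < min 1 h}"
      unfolding k_def[abs_def] by (rule holomorphic_on_subset[OF holomorphic_cw]) auto
    show "cmod (k s) \<le> exp (q * \<alpha>\<^sup>2) ^ n" if "- \<alpha> \<le> Im s" "Im s \<le> - h" for s
      unfolding k_def using that h q by (intro norm_cw_le_strip) auto
    show "- \<alpha> < Im v" "Im v < - h" using he by (auto simp: Im_v \<alpha> algebra_simps)
  qed (use h in \<open>auto simp: u_def\<close>)
  then have "2 * pi * (cmod (k v) / cmod (v - u)) = cmod (K v - J)"
    by (simp add: norm_mult norm_divide)
  also have "\<dots> \<le> cmod (K v) + cmod J" by (rule norm_triangle_ineq4)
  also have "\<dots> \<le> (pi / 2) * (c / h) * (B1 ^ n + E powr (1 - \<theta>) * (B2 ^ n) powr \<theta>)"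
    using Kv Jb by (simp add: algebra_simps)
  finally have main: "2 * pi * (cmod (k v) / cmod (v - u)) \<le> (pi / 2) * (c / h) * (B1 ^ n + E powr (1 - \<theta>) * (B2 ^ n) powr \<theta>)" .
  \<comment> \<open>The bound on \<open>x0\<close> is what makes |v - u| a multiple of
    \<open>h\<close> by a factor depending on \<open>e\<close> alone.\<close>
  have vu: "0 < cmod (v - u)" "cmod (v - u) \<le> h * (4 + 3 * e)"
  proof -
    have "cmod (v - u) \<le> \<bar>Re (v - u)\<bar> + \<bar>Im (v - u)\<bar>" by (rule cmod_le)
    also have "\<dots> \<le> 2 * h * (1 + e) + (h * (1 + e) + h)"
      using x0 h he by (simp add: v_def u_def algebra_simps)
    also have "\<dots> = h * (4 + 3 * e)" by (simp add: algebra_simps)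
    finally show "cmod (v - u) \<le> h * (4 + 3 * e)" .
    have "0 < h * (1 + e) + h" using h he by (simp add: algebra_simps)
    also have "\<dots> = \<bar>Im (v - u)\<bar>" using h he by (simp add: v_def u_def algebra_simps)
    also have "\<dots> \<le> cmod (v - u)" by (rule abs_Im_le_cmod)
    finally show "0 < cmod (v - u)" .
  qed
  define Z where "Z = B1 ^ n + E powr (1 - \<theta>) * (B2 ^ n) powr \<theta>"
  have Z0: "Z \<ge> 0" using B0 by (auto simp: Z_def)
  have "cmod (k v) = (2 * pi * (cmod (k v) / cmod (v - u))) * (cmod (v - u) / (2 * pi))"
    using vu by simp
  also have "\<dots> \<le> ((pi / 2) * (c / h) * Z) * (h * (4 + 3 * e) / (2 * pi))"
  proof (rule mult_mono)
    show "2 * pi * (cmod (k v) / cmod (v - u)) \<le> (pi / 2) * (c / h) * Z" using main by (simp only: Z_def)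
    show "cmod (v - u) / (2 * pi) \<le> h * (4 + 3 * e) / (2 * pi)" using vu by (intro divide_right_mono) auto
  qed (use Z0 c0 h in auto)
  also have "\<dots> = (4 + 3 * e) * c * Z / 4" using h by (simp add: field_simps)
  also have "\<dots> \<le> (4 + 3 * e) * c * Z"
    using Z0 c0 e by simp
  finally show ?thesis by (simp add: k_def v_def norm_power c_def Z_def)
qed

section \<open>The error of best approximation\<close>

definition exp_dev :: "nat \<Rightarrow> real \<Rightarrow> real poly \<Rightarrow> real \<Rightarrow> real" where
  "exp_dev n c p u = \<bar>poly p u / (1 + u) ^ n - exp (- c * u)\<bar>"

definition exp_err :: "nat \<Rightarrow> real \<Rightarrow> real" where
  "exp_err n c = (INF p\<in>{p. degree p \<le> n}. SUP u\<in>{0..}. exp_dev n c p u)"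

text \<open>Rescaling the variable by a = n q moves the pole to -1. The matching rescaling \<sigma>
  of the numerators permutes the polynomials of degree at most \<open>n\<close>, so both infima run
  over the same values.\<close>

lemma best_err_eq_exp_err:
  assumes "n \<ge> 1" "q > 0"
  shows "best_err t n q = exp_err n (n * t * q)"
proof -
  define a where "a = n * q"
  have a: "a > 0" using assms by (simp add: a_def)
  define \<sigma> where "\<sigma> p = smult (a ^ n) (pcompose p [:0, 1 / a:])" for p :: "real poly"
  have \<sigma>: "poly (\<sigma> p) (a * u) / (a * u + a) ^ n = poly p u / (1 + u) ^ n" for p u
  proof -
    have "(a * u + a) ^ n = a ^ n * (1 + u) ^ n" by (simp add: power_mult_distrib[symmetric] algebra_simps)
    then show ?thesis using a by (simp add: \<sigma>_def poly_pcompose)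
  qed
  have \<sigma>img: "\<sigma> ` {p. degree p \<le> n} = {p. degree p \<le> n}"
  proof (intro equalityI subsetI)
    fix p assume "p \<in> \<sigma> ` {p. degree p \<le> n}"
    then show "p \<in> {p. degree p \<le> n}" using a by (auto simp: \<sigma>_def degree_pcompose)
  next
    fix p :: "real poly" assume p: "p \<in> {p. degree p \<le> n}"
    define p' where "p' = smult (1 / a ^ n) (pcompose p [:0, a:])"
    have "\<sigma> p' = p"
      using a by (simp add: \<sigma>_def p'_def pcompose_smult pcompose_assoc[symmetric] pcompose_pCons)
    moreover have "degree p' \<le> n" using p by (simp add: p'_def degree_pcompose)
    ultimately show "p \<in> \<sigma> ` {p. degree p \<le> n}" by (auto intro!: image_eqI[of _ _ p'])
  qed
  have img: "{0..} = (\<lambda>u. a * u) ` {0..}"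
  proof (intro equalityI subsetI)
    fix z :: real assume "z \<in> {0..}"
    then show "z \<in> (\<lambda>u. a * u) ` {0..}" using a by (intro image_eqI[of _ _ "z / a"]) auto
  qed (use a in auto)
  have cr: "conc_rat n q = (\<lambda>p z. poly (\<sigma> p) z / (z + a) ^ n) ` {p. degree p \<le> n}"
  proof -
    have "conc_rat n q = (\<lambda>p z. poly p z / (z + a) ^ n) ` {p. degree p \<le> n}"
      unfolding conc_rat_def a_def[symmetric] by auto
    also have "\<dots> = (\<lambda>p z. poly p z / (z + a) ^ n) ` (\<sigma> ` {p. degree p \<le> n})" by (simp only: \<sigma>img)
    finally show ?thesis by (simp only: image_image)
  qed
  have "best_err t n q = (INF p\<in>{p. degree p \<le> n}. SUP z\<in>{0..}. \<bar>poly (\<sigma> p) z / (z + a) ^ n - exp (- t * z)\<bar>)"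
    unfolding best_err_def cr image_image ..
  also have "\<dots> = (INF p\<in>{p. degree p \<le> n}. SUP u\<in>{0..}. exp_dev n (n * t * q) p u)"
  proof -
    have "\<bar>poly (\<sigma> p) (a * u) / (a * u + a) ^ n - exp (- t * (a * u))\<bar> = exp_dev n (n * t * q) p u" for p u
      unfolding \<sigma> exp_dev_def by (simp add: a_def mult_ac)
    then show ?thesis by (subst img) (simp only: image_image)
  qed
  finally show ?thesis by (simp add: exp_err_def)
qed

lemma norm_rational_le:
  assumes "degree p \<le> n" "u \<ge> (0::real)"
  shows "\<bar>poly p u / (1 + u) ^ n\<bar> \<le> (\<Sum>k\<le>n. \<bar>coeff p k\<bar>)"
proof -
  have "\<bar>poly p u\<bar> \<le> (\<Sum>k\<le>n. \<bar>coeff p k * u ^ k\<bar>)"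
    unfolding poly_eq_sum_le[OF assms(1)] by (rule sum_abs)
  also have "\<dots> \<le> (\<Sum>k\<le>n. \<bar>coeff p k\<bar> * (1 + u) ^ n)"
  proof (rule sum_mono)
    fix k assume "k \<in> {..n}"
    then have "u ^ k \<le> (1 + u) ^ n"
      using assms by (intro order_trans[OF power_mono[of u "1 + u" k] power_increasing]) auto
    then show "\<bar>coeff p k * u ^ k\<bar> \<le> \<bar>coeff p k\<bar> * (1 + u) ^ n"
      using assms by (simp add: abs_mult mult_left_mono)
  qed
  finally have "\<bar>poly p u\<bar> \<le> (\<Sum>k\<le>n. \<bar>coeff p k\<bar>) * (1 + u) ^ n" by (simp add: sum_distrib_right)
  then show ?thesis using assms by (simp add: abs_divide divide_le_eq)
qed

lemma bdd_above_exp_dev: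
  assumes "degree p \<le> n" "c \<ge> 0"
  shows "bdd_above (exp_dev n c p ` {0..})"
proof (rule bdd_aboveI2)
  fix u :: real assume u: "u \<in> {0..}"
  have "exp (- c * u) \<le> 1" using assms u by simp
  then show "exp_dev n c p u \<le> (\<Sum>k\<le>n. \<bar>coeff p k\<bar>) + 1"
    unfolding exp_dev_def using norm_rational_le[OF assms(1), of u] u exp_ge_zero[of "- c * u"]
    unfolding atLeast_iff by linarith
qed

lemma exp_dev_sup_nonneg:
  assumes "degree p \<le> n" "c \<ge> 0"
  shows "0 \<le> (SUP u\<in>{0..}. exp_dev n c p u)"
  by (rule cSUP_upper2[OF bdd_above_exp_dev[OF assms], of 0]) (auto simp: exp_dev_def)

lemma exp_err_le:
  assumes "degree p \<le> n" "c \<ge> 0" "\<And>u. u \<ge> 0 \<Longrightarrow> exp_dev n c p u \<le> E"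
  shows "exp_err n c \<le> E"
proof -
  have "exp_err n c \<le> (SUP u\<in>{0..}. exp_dev n c p u)"
    unfolding exp_err_def using assms(1,2)
    by (intro cINF_lower bdd_belowI2[of _ 0] exp_dev_sup_nonneg) auto
  also have "\<dots> \<le> E" using assms(3) by (intro cSUP_least) auto
  finally show ?thesis .
qed

lemma exp_err_obtain:
  assumes "c \<ge> 0" "exp_err n c < E"
  obtains p where "degree p \<le> n" "\<And>u. u \<ge> 0 \<Longrightarrow> exp_dev n c p u \<le> E"
proof -
  have ne: "{p::real poly. degree p \<le> n} \<noteq> {}" by (auto intro: exI[of _ 0])
  obtain p where p: "degree p \<le> n" "(SUP u\<in>{0..}. exp_dev n c p u) < E"
    using assms(2) unfolding exp_err_def
    by (subst (asm) cINF_less_iff[OF ne])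
      (use assms(1) in \<open>auto intro!: bdd_belowI2[of _ 0] exp_dev_sup_nonneg\<close>)
  show ?thesis
  proof (rule that[OF p(1)])
    fix u :: real assume "u \<ge> 0"
    then have "exp_dev n c p u \<le> (SUP u\<in>{0..}. exp_dev n c p u)"
      by (intro cSUP_upper bdd_above_exp_dev p assms) auto
    then show "exp_dev n c p u \<le> E" using p(2) by linarith
  qed
qed

text \<open>The infimum is approached from strictly above, which allows E > 0 in the second
  assumption; \<open>contour_estimate\<close> raises \<open>E\<close> to a real power.\<close>

lemma exp_err_ge:
  assumes "c \<ge> 0"
    and "\<And>p E. degree p \<le> n \<Longrightarrow> E > 0 \<Longrightarrow> (\<And>u. u \<ge> 0 \<Longrightarrow> exp_dev n c p u \<le> E) \<Longrightarrow> L \<le> E"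
  shows "L \<le> exp_err n c"
proof (rule field_le_epsilon)
  fix e :: real assume e: "e > 0"
  have nonneg: "exp_err n c \<ge> 0"
    unfolding exp_err_def using assms(1)
    by (intro cINF_greatest exp_dev_sup_nonneg) (auto intro: exI[of _ 0])
  obtain p where "degree p \<le> n" "\<And>u. u \<ge> 0 \<Longrightarrow> exp_dev n c p u \<le> exp_err n c + e"
    using exp_err_obtain[OF assms(1), of n "exp_err n c + e"] e by auto
  then show "L \<le> exp_err n c + e" using assms(2) nonneg e by (meson add_nonneg_pos)
qed

lemma exp_err_nonneg: "c \<ge> 0 \<Longrightarrow> exp_err n c \<ge> 0"
  by (rule exp_err_ge) auto

text \<open>From 1 - exp(- (b - a) u) <= (b - a) u and a u exp(- a u) <= 1. The bound is uniform in
  \<open>u\<close> and depends only on the ratio of \<open>a\<close> and \<open>b\<close>.\<close>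

lemma exp_dev_change:
  assumes "0 < a" "0 < b" "u \<ge> 0"
  shows "exp_dev n b p u \<le> exp_dev n a p u + \<bar>b - a\<bar> / min a b"
proof -
  have aux: "exp (- a * u) - exp (- b * u) \<le> (b - a) / a" "0 \<le> exp (- a * u) - exp (- b * u)"
    if "0 < a" "a \<le> b" for a b
  proof -
    have "1 - exp (- (b - a) * u) \<le> (b - a) * u" using exp_ge_add_one_self[of "- (b - a) * u"] by linarith
    moreover have "a * u * exp (- a * u) \<le> 1"
    proof -
      have "a * u \<le> exp (a * u)" using exp_ge_add_one_self[of "a * u"] by linarith
      then show ?thesis by (simp add: exp_minus divide_le_eq divide_inverse[symmetric])
    qed
    ultimately have 1: "exp (- a * u) * (1 - exp (- (b - a) * u)) \<le> exp (- a * u) * ((b - a) * u)"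
      and 2: "(b - a) / a * (a * u * exp (- a * u)) \<le> (b - a) / a * 1"
      using that by (intro mult_left_mono; simp)+
    have "exp (- a * u) - exp (- b * u) = exp (- a * u) * (1 - exp (- (b - a) * u))"
      by (simp add: algebra_simps exp_add[symmetric])
    also note 1
    also have "exp (- a * u) * ((b - a) * u) = (b - a) / a * (a * u * exp (- a * u))" using that by simp
    also note 2
    finally show "exp (- a * u) - exp (- b * u) \<le> (b - a) / a" by simp
    show "0 \<le> exp (- a * u) - exp (- b * u)" using that assms by (simp add: mult_right_mono)
  qed
  have "\<bar>exp (- a * u) - exp (- b * u)\<bar> \<le> \<bar>b - a\<bar> / min a b"
    using aux[of a b] aux[of b a] assms by (cases "a \<le> b") (auto simp: min_def)
  then show ?thesis unfolding exp_dev_def by linarith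
qed

lemma exp_err_change:
  assumes "0 < a" "0 < b"
  shows "exp_err n b \<le> exp_err n a + \<bar>b - a\<bar> / min a b"
proof (rule field_le_epsilon)
  fix e :: real assume "e > 0"
  then obtain p where p: "degree p \<le> n" "\<And>u. u \<ge> 0 \<Longrightarrow> exp_dev n a p u \<le> exp_err n a + e"
    using exp_err_obtain[of a n "exp_err n a + e"] assms by auto
  show "exp_err n b \<le> exp_err n a + \<bar>b - a\<bar> / min a b + e"
  proof (rule exp_err_le[OF p(1)])
    fix u :: real assume "u \<ge> 0"
    then show "exp_dev n b p u \<le> exp_err n a + \<bar>b - a\<bar> / min a b + e"
      using exp_dev_change[OF assms, of u n p] p(2)[of u] by linarith
  qed (use assms in simp)
qed

lemma continuous_on_log_Lipschitz:
  fixes f :: "real \<Rightarrow> real"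
  assumes f: "\<And>a b. 0 < a \<Longrightarrow> 0 < b \<Longrightarrow> f b \<le> f a + K * (\<bar>b - a\<bar> / min a b)"
  shows "continuous_on {0<..} f"
proof -
  have "(f \<longlongrightarrow> f a) (at a within {0<..})" if a: "a > 0" for a
  proof (rule LIM_zero_cancel, rule Lim_null_comparison)
    have "((\<lambda>b. K * (\<bar>b - a\<bar> / min a b)) \<longlongrightarrow> K * (\<bar>a - a\<bar> / min a a)) (at a within {0<..})"
      using a by (intro tendsto_intros) auto
    then show "((\<lambda>b. K * (\<bar>b - a\<bar> / min a b)) \<longlongrightarrow> 0) (at a within {0<..})" by simp
    show "\<forall>\<^sub>F b in at a within {0<..}. norm (f b - f a) \<le> K * (\<bar>b - a\<bar> / min a b)"
      unfolding eventually_at_filter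
    proof (rule always_eventually, intro allI impI)
      fix b :: real assume "b \<in> {0<..}"
      then have b: "b > 0" by simp
      have "\<bar>b - a\<bar> = \<bar>a - b\<bar>" "min b a = min a b" by auto
      then show "norm (f b - f a) \<le> K * (\<bar>b - a\<bar> / min a b)"
        using f[OF a b] f[OF b a] unfolding real_norm_def abs_le_iff by (simp add: algebra_simps)
    qed
  qed
  then show ?thesis by (auto simp: continuous_on_def)
qed

lemma continuous_on_exp_err: "continuous_on {0<..} (exp_err n)"
  by (rule continuous_on_log_Lipschitz[where K=1]) (use exp_err_change in simp)

section \<open>Comparison with the constant 1/2\<close>

lemma poly_1_X_power: "poly ([:1, 1:] ^ n) u = (1 + u :: real) ^ n"
  by (simp add: poly_power)

lemma exp_err_le_half: "c \<ge> 0 \<Longrightarrow> exp_err n c \<le> 1 / 2"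
proof (rule exp_err_le[of "smult (1/2) ([:1, 1:] ^ n)"])
  show "degree (smult (1/2) ([:1, 1:] ^ n :: real poly)) \<le> n"
    using degree_power_le[of "[:1, 1:] :: real poly" n] by simp
  fix u :: real assume "c \<ge> 0" "u \<ge> 0"
  then have "exp (- c * u) \<le> 1" "exp (- c * u) \<ge> 0" by auto
  moreover have "poly (smult (1/2) ([:1, 1:] ^ n)) u / (1 + u) ^ n = 1 / 2"
    using \<open>u \<ge> 0\<close> by (simp add: poly_1_X_power)
  ultimately show "exp_dev n c (smult (1/2) ([:1, 1:] ^ n)) u \<le> 1 / 2"
    unfolding exp_dev_def by linarith
qed

text \<open>The constant 1/2 has error 1/2 only at u = 0 and in the limit u to infinity, with
  opposite signs. Adding \<epsilon> (a - u) / (1 + u) improves both ends; its zero \<open>a\<close>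
  is the point where the exponential equals 1/2.\<close>

lemma exp_err_less_half:
  assumes "c > 0" "n \<ge> 1"
  shows "exp_err n c < 1 / 2"
proof -
  define a where "a = ln 2 / c"
  define \<epsilon> where "\<epsilon> = (1 / 4) / (1 + a)"
  have a: "a > 0" using assms by (simp add: a_def)
  have ca: "exp (- c * a) = 1 / 2" using assms by (simp add: a_def exp_minus)
  have \<epsilon>: "\<epsilon> > 0" "\<epsilon> * a \<le> 1 / 4" "\<epsilon> \<le> 1 / 4" using a by (auto simp: \<epsilon>_def field_simps)
  define p where "p = smult (1/2) ([:1, 1:] ^ n) + smult \<epsilon> ([:a, -1:] * [:1, 1:] ^ (n - 1))"
  have deg: "degree p \<le> n"
  proof -
    have "degree ([:a, -1:] * [:1, 1:] ^ (n - 1)) \<le> 1 + (n - 1)"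
      using degree_mult_le[of "[:a, -1:]" "[:1, 1:] ^ (n - 1)"] degree_power_le[of "[:1, 1:] :: real poly" "n - 1"] by simp
    moreover have "degree ([:1, 1:] ^ n :: real poly) \<le> n"
      using degree_power_le[of "[:1, 1:] :: real poly" n] by simp
    ultimately show ?thesis unfolding p_def using assms \<epsilon> by (intro degree_add_le) auto
  qed
  have val: "poly p u / (1 + u) ^ n = 1 / 2 + \<epsilon> * ((a - u) / (1 + u))" if "u \<ge> 0" for u
  proof -
    define P where "P = (1 + u) ^ (n - 1)"
    have P: "(1 + u) ^ n = P * (1 + u)" "P > 0"
      using assms that by (auto simp: P_def power_Suc2[symmetric] simp del: power_Suc2 power_Suc)
    have "poly p u = 1 / 2 * (P * (1 + u)) + \<epsilon> * (a - u) * P"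
      unfolding p_def by (simp add: poly_1_X_power P(1)) (simp add: P_def algebra_simps)
    also have "\<epsilon> * (a - u) * P = \<epsilon> * ((a - u) / (1 + u)) * (P * (1 + u))" using that by simp
    finally have "poly p u = (1 / 2 + \<epsilon> * ((a - u) / (1 + u))) * (P * (1 + u))" by (simp only: distrib_right)
    then show ?thesis using P that by simp
  qed
  define d where "d = exp (- c * (a / 2))"
  have d: "d < 1" "exp (- c * (2 * a)) = 1 / 4"
  proof -
    show "d < 1" using assms a by (simp add: d_def)
    have "exp (- c * (2 * a)) = exp (- c * a) * exp (- c * a)" by (simp add: exp_add[symmetric])
    then show "exp (- c * (2 * a)) = 1 / 4" by (simp only: ca)
  qed
  \<comment> \<open>The entries after 1/4 control u in (a/2, a], u <= a/2 and u >= 2 a in this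
    order; 1/4 covers (a, 2 a) and the deviations of the other sign.\<close>
  define \<mu> where "\<mu> = max (1/4) (max (d - 1/2) (max (1/2 - \<epsilon> * (a / 2 / (1 + a))) (1/2 - \<epsilon> * (a / (1 + 2 * a)))))"
  have "exp_err n c \<le> \<mu>"
  proof (rule exp_err_le[OF deg])
    fix u :: real assume u: "u \<ge> 0"
    define x where "x = exp (- c * u)"
    define y where "y = \<epsilon> * ((a - u) / (1 + u))"
    have x: "0 < x" "x \<le> 1" using u assms by (auto simp: x_def)
    have y: "- \<epsilon> \<le> y" "y \<le> \<epsilon> * a"
    proof -
      have "0 \<le> a * u" using u a by simp
      then have "(a - u) / (1 + u) \<ge> -1" "(a - u) / (1 + u) \<le> a"
        using u a by (auto simp: divide_simps algebra_simps)
      from this[THEN mult_left_mono, of \<epsilon>] show "- \<epsilon> \<le> y" "y \<le> \<epsilon> * a"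
        using \<epsilon> unfolding y_def by auto
    qed
    have "\<bar>1 / 2 + y - x\<bar> \<le> \<mu>"
    proof (cases "u \<le> a")
      case True
      then have xg: "x \<ge> 1 / 2" unfolding ca[symmetric] x_def using assms by simp
      have y0: "y \<ge> 0" unfolding y_def using True u \<epsilon> by simp
      show ?thesis
      proof (cases "u \<le> a / 2")
        case True
        then have "a / 2 / (1 + a) \<le> (a - u) / (1 + u)" using a u by (intro frac_le) auto
        then have "\<epsilon> * (a / 2 / (1 + a)) \<le> y" unfolding y_def using \<epsilon> by (intro mult_left_mono) auto
        then show ?thesis using y xg x \<epsilon> unfolding \<mu>_def by linarith
      next
        case False
        then have "x \<le> d" unfolding x_def d_def using assms by simp
        then show ?thesis using y y0 xg \<epsilon> unfolding \<mu>_def by linarith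
      qed
    next
      case False
      then have xl: "x \<le> 1 / 2" unfolding ca[symmetric] x_def using assms by simp
      have y0: "y \<le> 0" unfolding y_def using False u \<epsilon> by (intro mult_nonneg_nonpos divide_nonpos_pos) auto
      show ?thesis
      proof (cases "u \<ge> 2 * a")
        case True
        have "a / (1 + 2 * a) \<le> (u - a) / (1 + u)"
        proof -
          have "a * (1 + u) \<le> (u - a) * (1 + 2 * a)"
          proof -
            have "0 \<le> (u - 2 * a) * (1 + a)" using True a by (intro mult_nonneg_nonneg) auto
            then show ?thesis by (simp add: algebra_simps)
          qed
          then show ?thesis using u a by (simp add: divide_simps)
        qed
        then have "\<epsilon> * (a / (1 + 2 * a)) \<le> \<epsilon> * ((u - a) / (1 + u))" using \<epsilon> by (intro mult_left_mono) auto
        moreover have "\<epsilon> * ((u - a) / (1 + u)) = - y" by (simp add: y_def right_diff_distrib diff_divide_distrib)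
        ultimately show ?thesis using y y0 xl x \<epsilon> unfolding \<mu>_def by linarith
      next
        case False
        then have "x \<ge> 1 / 4" unfolding d(2)[symmetric] x_def using assms by simp
        then show ?thesis using y y0 xl \<epsilon> unfolding \<mu>_def by linarith
      qed
    qed
    then show "exp_dev n c p u \<le> \<mu>" unfolding exp_dev_def val[OF u] x_def y_def .
  qed (use assms in simp)
  also have "\<mu> < 1 / 2"
  proof -
    have "\<epsilon> * (a / 2 / (1 + a)) > 0" "\<epsilon> * (a / (1 + 2 * a)) > 0" using \<epsilon> a by (auto intro!: mult_pos_pos divide_pos_pos)
    then show ?thesis using d(1) unfolding \<mu>_def max_less_iff_conj by linarith
  qed
  finally show ?thesis .
qed

section \<open>The error for very large and very small scale\<close>

lemma lagrange_interpolation: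
  fixes p :: "real poly"
  assumes "finite A" "degree p < card A"
  shows "poly p x = (\<Sum>a\<in>A. poly p a * (\<Prod>b\<in>A - {a}. (x - b) / (a - b)))"
proof -
  define q where "q = (\<Sum>a\<in>A. smult (poly p a) (\<Prod>b\<in>A - {a}. smult (1 / (a - b)) [:- b, 1:]))"
  have val: "poly q x = (\<Sum>a\<in>A. poly p a * (\<Prod>b\<in>A - {a}. (x - b) / (a - b)))" for x
    by (simp add: q_def poly_sum poly_prod diff_divide_distrib)
  have "p = q"
  proof (rule poly_eqI_degree)
    fix x assume x: "x \<in> A"
    have "(\<Prod>b\<in>A - {a}. (x - b) / (a - b)) = (if a = x then 1 else 0)" if "a \<in> A" for a
    proof (cases "a = x")
      case True
      then show ?thesis by (auto intro!: prod.neutral)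
    next
      case False
      then show ?thesis using assms x by (auto intro!: prod_zero)
    qed
    then have "poly q x = (\<Sum>a\<in>A. if a = x then poly p a else 0)" unfolding val by (intro sum.cong) auto
    then show "poly p x = poly q x" using assms x by simp
  next
    show "degree p < card A" by fact
    have "degree (smult (poly p a) (\<Prod>b\<in>A - {a}. smult (1 / (a - b)) [:- b, 1:])) \<le> card A - 1" if "a \<in> A" for a
    proof -
      have "degree (\<Prod>b\<in>A - {a}. smult (1 / (a - b)) [:- b, 1:]) \<le> (\<Sum>b\<in>A - {a}. degree (smult (1 / (a - b)) [:- b, 1:]))"
        using degree_prod_sum_le[of "A - {a}" "\<lambda>b. smult (1 / (a - b)) [:- b, 1:]"] assms by (simp add: o_def)
      also have "\<dots> \<le> (\<Sum>b\<in>A - {a}. 1)" by (intro sum_mono) auto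
      also have "\<dots> = card A - 1" using assms that by simp
      finally show ?thesis using degree_smult_le order_trans by blast
    qed
    then have "degree q \<le> card A - 1" unfolding q_def using assms by (intro degree_sum_le) auto
    then show "degree q < card A" using assms by linarith
  qed
  then have "poly p x = poly q x" by simp
  then show ?thesis unfolding val .
qed

text \<open>
  Interpolation at \<open>1, \<dots>, n + 1\<close> gives a modulus of continuity at \<open>0\<close> which is common to all
  bounded rational functions of the family.
\<close>

lemma equicontinuous_at_0:
  obtains \<omega> where "(\<omega> \<longlongrightarrow> 0) (at_right (0::real))"
    "\<And>p x. degree p \<le> n \<Longrightarrow> (\<And>u. u > 0 \<Longrightarrow> \<bar>poly p u\<bar> \<le> 2 * (1 + u) ^ n) \<Longrightarrow> \<bar>poly p x - poly p 0\<bar> \<le> \<omega> x"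
proof -
  define A where "A = real ` {1..n + 1}"
  have A: "finite A" "card A = n + 1" "\<And>a. a \<in> A \<Longrightarrow> a > 0" by (auto simp: A_def card_image)
  define l where "l a x = (\<Prod>b\<in>A - {a}. (x - b) / (a - b))" for a x :: real
  define \<omega> where "\<omega> x = (\<Sum>a\<in>A. 2 * (1 + a) ^ n * \<bar>l a x - l a 0\<bar>)" for x
  show ?thesis
  proof
    have "(\<omega> \<longlongrightarrow> (\<Sum>a\<in>A. 2 * (1 + a) ^ n * \<bar>l a 0 - l a 0\<bar>)) (at_right 0)"
      unfolding \<omega>_def[abs_def] l_def
      by (intro tendsto_intros)
        (auto simp: divide_inverse intro!: tendsto_intros)
    then show "(\<omega> \<longlongrightarrow> 0) (at_right 0)" by simp
    fix p :: "real poly" and x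
    assume p: "degree p \<le> n" "\<And>u. u > 0 \<Longrightarrow> \<bar>poly p u\<bar> \<le> 2 * (1 + u) ^ n"
    have dl: "degree p < card A" using p A by simp
    have "poly p x - poly p 0 = (\<Sum>a\<in>A. poly p a * (l a x - l a 0))"
      using lagrange_interpolation[OF A(1) dl, of x] lagrange_interpolation[OF A(1) dl, of 0]
      by (simp only: l_def[symmetric] sum_subtractf[symmetric] right_diff_distrib)
    then have "\<bar>poly p x - poly p 0\<bar> \<le> (\<Sum>a\<in>A. \<bar>poly p a * (l a x - l a 0)\<bar>)" by simp
    also have "\<dots> \<le> \<omega> x" unfolding \<omega>_def abs_mult using p(2) A(3)
      by (intro sum_mono mult_right_mono) auto
    finally show "\<bar>poly p x - poly p 0\<bar> \<le> \<omega> x" .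
  qed
qed

lemma choose_small_radius:
  assumes "(\<omega> \<longlongrightarrow> 0) (at_right (0::real))" "\<epsilon> > 0"
  obtains x where "x > 0" "\<omega> x < \<epsilon>" "(1 + x) ^ n < 1 + \<epsilon>"
proof -
  have "((\<lambda>x. (1 + x) ^ n) \<longlongrightarrow> (1 + 0) ^ n) (at_right (0::real))" by (intro tendsto_intros)
  then have "\<forall>\<^sub>F x in at_right 0. (1 + x) ^ n < 1 + \<epsilon>" using assms by (intro order_tendstoD) auto
  moreover have "\<forall>\<^sub>F x in at_right 0. \<omega> x < \<epsilon>" using assms by (intro order_tendstoD) auto
  moreover have "\<forall>\<^sub>F x in at_right 0. (0::real) < x" by (rule eventually_at_right_less)
  ultimately have "\<forall>\<^sub>F x in at_right 0. 0 < x \<and> \<omega> x < \<epsilon> \<and> (1 + x) ^ n < 1 + \<epsilon>"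
    by eventually_elim auto
  from eventually_happens[OF this] show ?thesis using that by auto
qed

text \<open>For large \<open>c\<close> the exponential falls from 1 to almost 0 within an
  arbitrarily short interval at 0, which a bounded family that is equicontinuous at 0 cannot follow.
  For small \<open>c\<close> the same happens at infinity, and u -> 1/u reduces it to 0.\<close>

lemma exp_err_extreme:
  assumes m: "m < 1 / 2"
  shows "\<forall>\<^sub>F c in at_top. m < exp_err n c" "\<forall>\<^sub>F c in at_right 0. m < exp_err n c"
proof -
  define E where "E = (m + 1 / 2) / 2"
  define \<epsilon> where "\<epsilon> = min 1 ((1 - 2 * E) / 4)"
  have E: "m < E" "E < 1 / 2" using m by (auto simp: E_def)
  have \<epsilon>: "\<epsilon> > 0" "\<epsilon> \<le> 1" "4 * \<epsilon> \<le> 1 - 2 * E" using E by (auto simp: \<epsilon>_def min_def)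
  obtain \<omega> where \<omega>: "(\<omega> \<longlongrightarrow> 0) (at_right (0::real))"
    "\<And>p x. degree p \<le> n \<Longrightarrow> (\<And>u. u > 0 \<Longrightarrow> \<bar>poly p u\<bar> \<le> 2 * (1 + u) ^ n) \<Longrightarrow> \<bar>poly p x - poly p 0\<bar> \<le> \<omega> x"
    using equicontinuous_at_0[of n] by blast
  obtain x where x: "x > 0" "\<omega> x < \<epsilon>" "(1 + x) ^ n < 1 + \<epsilon>"
    using choose_small_radius[OF \<omega>(1) \<epsilon>(1)] by blast
  have x1: "(1 + x) ^ n \<ge> 1" using x by simp
  \<comment> \<open>The target changes by at least 1 - \<epsilon> between 0 and \<open>x\<close>,
    while the numerator changes by less than \<epsilon> and the error is at most E < 1/2 at either
    end. Both halves of the proof end in this contradiction.\<close>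
  have fin: False if "E \<ge> 0" "1 - \<epsilon> \<le> E * (1 + (1 + x) ^ n) + \<epsilon> * (1 + x) ^ n + \<omega> x"
  proof -
    have "E * (1 + x) ^ n \<le> E * (1 + \<epsilon>)" "\<epsilon> * (1 + x) ^ n \<le> \<epsilon> * (1 + \<epsilon>)"
      using x that \<epsilon> by (auto intro!: mult_left_mono)
    moreover have "E * \<epsilon> \<le> 1 / 2 * \<epsilon>" "\<epsilon> * \<epsilon> \<le> 1 / 4 * \<epsilon>" using E \<epsilon> that by (auto intro!: mult_right_mono)
    moreover have "1 - \<epsilon> \<le> E + E * (1 + x) ^ n + \<epsilon> * (1 + x) ^ n + \<omega> x"
      using that(2) by (simp only: distrib_left mult_1_right)
    moreover have "E * (1 + \<epsilon>) = E + E * \<epsilon>" "\<epsilon> * (1 + \<epsilon>) = \<epsilon> + \<epsilon> * \<epsilon>"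
      by (simp_all only: distrib_left mult_1_right)
    ultimately show False using x \<epsilon> by linarith
  qed
  have rat: "\<bar>poly p u / (1 + u) ^ n\<bar> \<le> 2" if "c > 0" "u \<ge> 0" "exp_dev n c p u \<le> E" for c p u
  proof -
    have "exp (- c * u) \<le> 1" using that by simp
    then show ?thesis using that E exp_ge_zero[of "- c * u"] unfolding exp_dev_def by linarith
  qed
  have "\<forall>\<^sub>F c in at_top. exp (- c * x) < \<epsilon>"
  proof -
    have "((\<lambda>c. exp (- c * x)) \<longlongrightarrow> 0) at_top" using x by real_asymp
    then show ?thesis by (rule order_tendstoD) (rule \<epsilon>)
  qed
  then show "\<forall>\<^sub>F c in at_top. m < exp_err n c"
    using eventually_gt_at_top[of 0]
  proof eventually_elim
    case (elim c)
    show ?case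
    proof (rule ccontr)
      assume "\<not> m < exp_err n c"
      then have "exp_err n c < E" using E by linarith
      then obtain p where p: "degree p \<le> n" "\<And>u. u \<ge> 0 \<Longrightarrow> exp_dev n c p u \<le> E"
        using exp_err_obtain[of c n E] elim by auto
      have "\<bar>poly p u\<bar> \<le> 2 * (1 + u) ^ n" if "u > 0" for u
        using rat[of c u p] p that elim by (simp add: abs_divide divide_le_eq)
      then have w: "\<bar>poly p x - poly p 0\<bar> \<le> \<omega> x" using \<omega>(2) p by blast
      have 1: "\<bar>poly p 0 - 1\<bar> \<le> E" using p(2)[of 0] by (simp add: exp_dev_def)
      have "poly p x / (1 + x) ^ n \<le> E + \<epsilon>" using p(2)[of x] x elim by (simp add: exp_dev_def)
      then have "poly p x \<le> (E + \<epsilon>) * (1 + x) ^ n" using x1 by (simp add: divide_le_eq)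
      then show False using 1 w by (intro fin) (use \<epsilon> in \<open>auto simp: algebra_simps\<close>)
    qed
  qed
  have "\<forall>\<^sub>F c in at_right 0. exp (- c / x) > 1 - \<epsilon>"
  proof -
    have "((\<lambda>c. exp (- c / x)) \<longlongrightarrow> exp (- 0 / x)) (at_right 0)" using x by (intro tendsto_intros) auto
    then show ?thesis by (rule order_tendstoD) (use \<epsilon> in simp)
  qed
  then show "\<forall>\<^sub>F c in at_right 0. m < exp_err n c"
    using eventually_at_right_less[of 0]
  proof eventually_elim
    case (elim c)
    show ?case
    proof (rule ccontr)
      assume "\<not> m < exp_err n c"
      then have "exp_err n c < E" using E by linarith
      then obtain p where p: "degree p \<le> n" "\<And>u. u \<ge> 0 \<Longrightarrow> exp_dev n c p u \<le> E"
        using exp_err_obtain[of c n E] elim by auto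
      \<comment> \<open>The reversed polynomial: r(u) = u^n p(1/u).\<close>
      define r where "r = (\<Sum>k\<le>n. monom (coeff p (n - k)) k)"
      have r: "poly r u / (1 + u) ^ n = poly p (1 / u) / (1 + 1 / u) ^ n" if "u > 0" for u
      proof -
        have "poly p (1 / u) = (\<Sum>k\<le>n. coeff p k * (1 / u) ^ k)" by (rule poly_eq_sum_le[OF p(1)])
        also have "u ^ n * \<dots> = (\<Sum>k\<le>n. coeff p k * u ^ (n - k))"
          unfolding sum_distrib_left using that
          by (intro sum.cong) (auto simp: power_diff power_one_over field_simps)
        also have "\<dots> = poly r u"
          unfolding r_def poly_sum poly_monom atMost_atLeast0
          by (subst sum.atLeastAtMost_rev) simp
        finally have "poly r u = u ^ n * poly p (1 / u)" by simp
        moreover have "(1 + u) ^ n = u ^ n * (1 + 1 / u) ^ n"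
          using that by (simp add: power_mult_distrib[symmetric] algebra_simps)
        ultimately show ?thesis using that by simp
      qed
      have degr: "degree r \<le> n" unfolding r_def
        by (intro degree_sum_le) (auto intro: order_trans[OF degree_monom_le])
      have dev: "\<bar>poly r u / (1 + u) ^ n - exp (- c / u)\<bar> \<le> E" if "u > 0" for u
        using p(2)[of "1 / u"] that unfolding r[OF that] by (simp add: exp_dev_def)
      have "\<bar>poly r u\<bar> \<le> 2 * (1 + u) ^ n" if "u > 0" for u
        using rat[of c "1 / u" p] p(2)[of "1 / u"] that elim unfolding r[OF that, symmetric]
        by (simp add: abs_divide divide_le_eq)
      then have w: "\<bar>poly r x - poly r 0\<bar> \<le> \<omega> x" using \<omega>(2) degr by blast
      \<comment> \<open>At u = 0 the convention for division by zero would make exp(- c / u) equal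
        to 1, whereas the limit is 0. The bound at 0 is therefore obtained as a limit from the
        right.\<close>
      have r0: "\<bar>poly r 0\<bar> \<le> E"
      proof (rule tendsto_upperbound)
        have l: "((\<lambda>u. exp (- c / u)) \<longlongrightarrow> 0) (at_right 0)" using elim by real_asymp
        have "((\<lambda>u. \<bar>poly r u / (1 + u) ^ n - exp (- c / u)\<bar>) \<longlongrightarrow> \<bar>poly r 0 / (1 + 0) ^ n - 0\<bar>) (at_right 0)"
          by (intro tendsto_intros l) auto
        then show "((\<lambda>u. \<bar>poly r u / (1 + u) ^ n - exp (- c / u)\<bar>) \<longlongrightarrow> \<bar>poly r 0\<bar>) (at_right 0)" by simp
        show "\<forall>\<^sub>F u in at_right 0. \<bar>poly r u / (1 + u) ^ n - exp (- c / u)\<bar> \<le> E"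
          using eventually_at_right_less[of 0] by eventually_elim (rule dev)
      qed simp
      have "poly r x / (1 + x) ^ n \<ge> (1 - \<epsilon>) - E" using dev[OF x(1)] elim by linarith
      then have "(1 - \<epsilon> - E) * (1 + x) ^ n \<le> poly r x" using x1 by (simp add: le_divide_eq)
      moreover have "(1 - \<epsilon>) * (1 + x) ^ n \<ge> (1 - \<epsilon>) * 1" using \<epsilon> x1 by (intro mult_left_mono) auto
      moreover have "\<epsilon> * (1 + x) ^ n \<ge> 0" using \<epsilon> x by simp
      ultimately show False using r0 w by (intro fin) (auto simp: algebra_simps)
    qed
  qed
qed

section \<open>The upper bound\<close>

text \<open>Symmetrization keeps the even powers and the real part makes their coefficients real.
  This turns a complex numerator in \<open>s\<close> into an admissible real one in s^2.\<close>

lemma even_part_poly: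
  fixes Q :: "complex poly"
  assumes "degree Q \<le> Suc (2 * n)"
  obtains p :: "real poly" where "degree p \<le> n"
    "\<And>x. Re (poly Q (of_real x) + poly Q (- of_real x)) = poly p (x\<^sup>2)"
proof
  define p where "p = (\<Sum>k\<le>n. monom (2 * Re (coeff Q (2 * k))) k)"
  show "degree p \<le> n" unfolding p_def
    by (intro degree_sum_le) (auto intro: order_trans[OF degree_monom_le])
  fix x :: real
  note Q = poly_eq_sum_le[OF assms]
  have "poly Q (of_real x) + poly Q (- of_real x) = (\<Sum>k\<le>n. 2 * coeff Q (2 * k) * of_real ((x\<^sup>2) ^ k))"
    unfolding Q sum.distrib[symmetric] sum.in_pairs_0
    by (intro sum.cong) (auto simp: power_mult)
  then have "Re (poly Q (of_real x) + poly Q (- of_real x)) = (\<Sum>k\<le>n. 2 * Re (coeff Q (2 * k)) * (x\<^sup>2) ^ k)"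
    by (simp del: of_real_power)
  then show "Re (poly Q (of_real x) + poly Q (- of_real x)) = poly p (x\<^sup>2)"
    by (simp add: p_def poly_sum poly_monom)
qed

text \<open>A finite geometric series in the quotient \<open>a\<close> of the Moebius factors at
  \<open>s\<close> and \<open>s0\<close>: the factor \<open>s - s0\<close> of 1 - a cancels, and in
  the resulting sum the variables are separated, with poles in \<open>s0\<close> at - \<i>
  only.\<close>

lemma moebius_telescope:
  assumes "s \<noteq> \<i>" "s0 \<noteq> \<i>" "s0 \<noteq> - \<i>" "s \<noteq> s0"
  shows "1 / (s - s0) = ((s + \<i>) / (s - \<i>)) ^ n / (((s0 + \<i>) / (s0 - \<i>)) ^ n * (s - s0)) +
    (\<Sum>j<n. ((s + \<i>) / (s - \<i>)) ^ j * (2 * \<i> / (s - \<i>)) * ((s0 - \<i>) ^ j / (s0 + \<i>) ^ Suc j))"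
proof -
  define m where "m = (s + \<i>) / (s - \<i>)"
  define m0 where "m0 = (s0 + \<i>) / (s0 - \<i>)"
  have nz: "s - \<i> \<noteq> 0" "s0 - \<i> \<noteq> 0" "s0 + \<i> \<noteq> 0" "s - s0 \<noteq> 0" "m0 \<noteq> 0"
    using assms by (auto simp: m0_def add_eq_0_iff2)
  define a where "a = m / m0"
  have 1: "1 - a = (s - s0) * (2 * \<i> / ((s - \<i>) * (s0 + \<i>)))"
    using nz by (simp add: a_def m_def m0_def divide_simps) (simp add: algebra_simps)
  have "1 - a ^ n = (1 - a) * (\<Sum>j<n. a ^ j)" by (rule one_diff_power_eq)
  then have "(1 - a ^ n) / (s - s0) = (2 * \<i> / ((s - \<i>) * (s0 + \<i>))) * (\<Sum>j<n. a ^ j)"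
    using nz unfolding 1 by simp
  also have "\<dots> = (\<Sum>j<n. m ^ j * (2 * \<i> / (s - \<i>)) * ((s0 - \<i>) ^ j / (s0 + \<i>) ^ Suc j))"
  proof -
    have "a ^ j = m ^ j * ((s0 - \<i>) ^ j / (s0 + \<i>) ^ j)" for j
      by (simp add: a_def m0_def power_divide power_mult_distrib)
    then show ?thesis unfolding sum_distrib_left by (intro sum.cong refl) (simp add: mult_ac)
  qed
  finally have "1 / (s - s0) - a ^ n / (s - s0) = (\<Sum>j<n. m ^ j * (2 * \<i> / (s - \<i>)) * ((s0 - \<i>) ^ j / (s0 + \<i>) ^ Suc j))"
    by (simp add: diff_divide_distrib)
  moreover have "a ^ n / (s - s0) = m ^ n / (m0 ^ n * (s - s0))" by (simp add: a_def power_divide)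
  ultimately show ?thesis unfolding m_def[symmetric] m0_def[symmetric] by (simp add: algebra_simps)
qed

text \<open>
  Cauchy's formula on \<open>Im s = \<plusminus> \<eta>\<close> represents \<open>exp (- n q t\<^sup>2)\<close> as \<open>(U t + U (- t)) / (2 pi \<i>)\<close>. By
  \<open>moebius_telescope\<close>, \<open>U\<close> is the sum of a rational function \<open>V\<close> with poles at \<open>- \<i>\<close> and a remainder \<open>R\<close> of
  size \<open>B\<^sup>n\<close>.
\<close>

theorem exp_err_upper:
  assumes q: "q > 0" and n: "n \<ge> 1" and \<eta>: "\<eta> > 0"
    and B: "\<And>x. cmod (cw q (Complex x (- \<eta>))) \<le> B"
  shows "exp_err n (n * q) \<le> 1 / (pi * \<eta>) * (B ^ (n - 1) * (exp (q * \<eta>\<^sup>2) * sqrt (pi / q)))"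
proof -
  define f where "f s = exp (- of_real (n * q) * s\<^sup>2)" for s :: complex
  define m where "m s = (s + \<i>) / (s - \<i>)" for s :: complex
  define L where "L x = Complex x (- \<eta>)" for x
  define G where "G = B ^ (n - 1) * (exp (q * \<eta>\<^sup>2) * sqrt (pi / q))"
  have B0: "B \<ge> 0" by (rule order_trans[OF norm_ge_zero B])
  have C: "Complex x y = of_real x + \<i> * of_real y" for x y by (simp add: complex_eq_iff)
  have [measurable]: "L \<in> borel_measurable borel" unfolding L_def[abs_def] C by measurable
  have nf: "cmod (f s) = exp (n * q * ((Im s)\<^sup>2 - (Re s)\<^sup>2))" for s
    by (simp add: f_def Re_power2 algebra_simps)
  have fm: "f s * m s ^ n = cw q s ^ n" for s
  proof -
    have "f s = exp (- of_real q * s\<^sup>2) ^ n"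
      unfolding f_def exp_of_nat_mult[symmetric] by (simp add: mult.assoc)
    then show ?thesis by (simp only: cw_def m_def power_mult_distrib)
  qed
  have holf: "f holomorphic_on UNIV" unfolding f_def[abs_def] by (intro holomorphic_intros)
  have mf[measurable]: "(\<lambda>x. f (Complex x y)) \<in> borel_measurable borel" for y
    unfolding f_def C by (intro borel_measurable_continuous_onI continuous_intros)
  have int_f: "integrable lborel (\<lambda>x. f (Complex x y))" for y
  proof (rule Bochner_Integration.integrable_bound)
    have "n * q > 0" using q n by simp
    from has_bochner_integral_gaussian[OF this]
    have "integrable lborel (\<lambda>x. exp (- (n * q) * x\<^sup>2))" by (rule integrable.intros)
    then show "integrable lborel (\<lambda>x. exp (n * q * y\<^sup>2) * exp (- (n * q) * x\<^sup>2))"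
      by (rule integrable_mult_right)
    show "AE x in lborel. cmod (f (Complex x y)) \<le> norm (exp (n * q * y\<^sup>2) * exp (- (n * q) * x\<^sup>2))"
      by (rule AE_I2) (simp add: nf exp_add[symmetric] algebra_simps)
  qed simp
  have cont_div: "(\<lambda>x. 1 / (Complex x y - v)) \<in> borel_measurable borel" for y v
    unfolding C by measurable
  have int_fv: "integrable lborel (\<lambda>x. f (Complex x y) / (Complex x y - v))" if "y \<noteq> Im v" for y v
  proof -
    have "integrable lborel (\<lambda>x. f (Complex x y) * (1 / (Complex x y - v)))"
    proof (rule integrable_mult_bounded[OF int_f cont_div])
      fix x
      have "cmod (Complex x y - v) \<ge> \<bar>y - Im v\<bar>" "\<bar>y - Im v\<bar> > 0" using norm_Complex_diff_ge(2) that by auto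
      then show "cmod (1 / (Complex x y - v)) \<le> 1 / \<bar>y - Im v\<bar>"
        unfolding norm_divide by (auto intro: frac_le)
    qed
    then show ?thesis by simp
  qed
  define U where "U t = (LBINT x. f (L x) / (L x - of_real t))" for t
  have UU: "U t + U (- t) = 2 * pi * \<i> * f (of_real t)" for t
  proof -
    have "(LBINT x. f (Complex x (- \<eta>)) / (Complex x (- \<eta>) - of_real t)) - (LBINT x. f (Complex x \<eta>) / (Complex x \<eta> - of_real t))
       = (if - \<eta> < Im (of_real t) \<and> Im (of_real t) < \<eta> then 2 * pi * \<i> * f (of_real t) else 0)"
    proof (rule cauchy_strip[OF _ _ holf])
      show "cmod (f s) \<le> exp (n * q * \<eta>\<^sup>2)" if "- \<eta> \<le> Im s" "Im s \<le> \<eta>" for s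
      proof -
        have "(Im s)\<^sup>2 \<le> \<eta>\<^sup>2" using that by (intro abs_le_square_iff[THEN iffD1]) auto
        then have "(Im s)\<^sup>2 - (Re s)\<^sup>2 \<le> \<eta>\<^sup>2" using zero_le_power2[of "Re s"] by linarith
        then show ?thesis unfolding nf using q by (simp add: mult_left_mono)
      qed
    qed (use \<eta> int_fv in auto)
    \<comment> \<open>As \<open>f\<close> is even, s -> - s carries the upper line to the lower
      one.\<close>
    moreover have "(LBINT x. f (Complex x \<eta>) / (Complex x \<eta> - of_real t)) = - U (- t)"
    proof -
      have "(LBINT x. f (Complex x \<eta>) / (Complex x \<eta> - of_real t)) = (LBINT x. f (Complex (- x) \<eta>) / (Complex (- x) \<eta> - of_real t))"
        by (subst lborel_integral_real_affine[where c="-1" and t=0]) auto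
      also have "\<dots> = (LBINT x. - (f (L x) / (L x - of_real (- t))))"
      proof (rule Bochner_Integration.integral_cong[OF refl])
        fix x
        have 1: "Complex (- x) \<eta> = - L x" by (simp add: L_def complex_eq_iff)
        have 2: "- L x - of_real t = - (L x - of_real (- t))" by simp
        have 3: "f (- L x) = f (L x)" by (simp add: f_def)
        show "f (Complex (- x) \<eta>) / (Complex (- x) \<eta> - of_real t) = - (f (L x) / (L x - of_real (- t)))"
          unfolding 1 2 3 by (rule minus_divide_right[symmetric])
      qed
      finally show ?thesis by (simp add: U_def)
    qed
    ultimately show ?thesis using \<eta> by (simp add: U_def L_def)
  qed
  define A where "A j = (LBINT x. f (L x) * (m (L x) ^ j * (2 * \<i> / (L x - \<i>))))" for j
  define V where "V t = (\<Sum>j<n. A j * ((of_real t - \<i>) ^ j / (of_real t + \<i>) ^ Suc j))" for t :: real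
  define R where "R t = (LBINT x. f (L x) * m (L x) ^ n / (m (of_real t) ^ n * (L x - of_real t)))" for t :: real
  have Lne: "L x \<noteq> \<i>" "L x \<noteq> of_real t" for x t using \<eta> by (auto simp: L_def complex_eq_iff)
  have rne: "of_real t \<noteq> \<i>" "of_real t \<noteq> - \<i>" for t :: real by (auto simp: complex_eq_iff)
  have m0: "cmod (m (of_real t)) = 1" for t :: real unfolding m_def by (rule norm_moebius_real)
  have mle: "cmod (m (L x)) \<le> 1" for x unfolding m_def using \<eta> by (intro norm_moebius_le) (simp add: L_def)
  have L1: "cmod (L x - \<i>) \<ge> 1" for x
    using norm_Complex_diff_ge(2)[of "- \<eta>" \<i> x] \<eta> by (simp add: L_def)
  have L2: "cmod (L x - of_real t) \<ge> \<eta>" for x t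
    using norm_Complex_diff_ge(2)[of "- \<eta>" "of_real t" x] \<eta> by (simp add: L_def)
  have [measurable]: "(\<lambda>x. m (L x)) \<in> borel_measurable borel" unfolding m_def by measurable
  have int_fL: "integrable lborel (\<lambda>x. f (L x))" unfolding L_def by (rule int_f)
  have int_A: "integrable lborel (\<lambda>x. f (L x) * (m (L x) ^ j * (2 * \<i> / (L x - \<i>))))" for j
  proof (rule integrable_mult_bounded[OF int_fL])
    show "(\<lambda>x. m (L x) ^ j * (2 * \<i> / (L x - \<i>))) \<in> borel_measurable borel" by measurable
    fix x
    have "cmod (m (L x)) ^ j \<le> 1" using mle by (intro power_le_one) auto
    moreover have "2 / cmod (L x - \<i>) \<le> 2 / 1" using L1[of x] by (intro frac_le) auto
    ultimately have "cmod (m (L x)) ^ j * (2 / cmod (L x - \<i>)) \<le> 1 * 2" by (intro mult_mono) auto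
    then show "cmod (m (L x) ^ j * (2 * \<i> / (L x - \<i>))) \<le> 2" by (simp add: norm_mult norm_power norm_divide)
  qed
  have Reps: "f (L x) * m (L x) ^ n / (m (of_real t) ^ n * (L x - of_real t)) =
      f (L x) * (m (L x) ^ n * (1 / (m (of_real t) ^ n * (L x - of_real t))))" for x t by simp
  have int_R: "integrable lborel (\<lambda>x. f (L x) * m (L x) ^ n / (m (of_real t) ^ n * (L x - of_real t)))" for t
    unfolding Reps
  proof (rule integrable_mult_bounded[OF int_fL])
    show "(\<lambda>x. m (L x) ^ n * (1 / (m (of_real t) ^ n * (L x - of_real t)))) \<in> borel_measurable borel" by measurable
    fix x
    have "cmod (m (L x)) ^ n \<le> 1" using mle by (intro power_le_one) auto
    moreover have "1 / cmod (L x - of_real t) \<le> 1 / \<eta>" using L2 \<eta> by (intro frac_le) auto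
    ultimately have "cmod (m (L x)) ^ n * (1 / cmod (L x - of_real t)) \<le> 1 * (1 / \<eta>)" by (intro mult_mono) auto
    then show "cmod (m (L x) ^ n * (1 / (m (of_real t) ^ n * (L x - of_real t)))) \<le> 1 / \<eta>"
      by (simp add: norm_mult norm_power norm_divide m0)
  qed
  have split: "U t = R t + V t" for t
  proof -
    have "f (L x) / (L x - of_real t) = f (L x) * m (L x) ^ n / (m (of_real t) ^ n * (L x - of_real t)) +
       (\<Sum>j<n. f (L x) * (m (L x) ^ j * (2 * \<i> / (L x - \<i>))) * ((of_real t - \<i>) ^ j / (of_real t + \<i>) ^ Suc j))" for x
    proof -
      have "f (L x) / (L x - of_real t) = f (L x) * (1 / (L x - of_real t))" by simp
      also have "1 / (L x - of_real t) = m (L x) ^ n / (m (of_real t) ^ n * (L x - of_real t)) +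
         (\<Sum>j<n. m (L x) ^ j * (2 * \<i> / (L x - \<i>)) * ((of_real t - \<i>) ^ j / (of_real t + \<i>) ^ Suc j))"
        unfolding m_def by (rule moebius_telescope[OF Lne(1) rne Lne(2)])
      finally show ?thesis by (simp add: distrib_left sum_distrib_left mult.assoc)
    qed
    then have "U t = R t + (LBINT x. \<Sum>j<n. f (L x) * (m (L x) ^ j * (2 * \<i> / (L x - \<i>))) * ((of_real t - \<i>) ^ j / (of_real t + \<i>) ^ Suc j))"
      unfolding U_def R_def by (simp only:) (intro Bochner_Integration.integral_add int_R Bochner_Integration.integrable_sum integrable_mult_left int_A)
    also have "(LBINT x. \<Sum>j<n. f (L x) * (m (L x) ^ j * (2 * \<i> / (L x - \<i>))) * ((of_real t - \<i>) ^ j / (of_real t + \<i>) ^ Suc j)) = V t"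
      unfolding V_def A_def
      by (subst Bochner_Integration.integral_sum, intro integrable_mult_left int_A)
        (intro sum.cong refl integral_mult_left_zero)
    finally show ?thesis .
  qed
  have Rbd: "cmod (R t) \<le> G / \<eta>" for t
  proof -
    have g: "has_bochner_integral lborel (\<lambda>x. (B ^ (n - 1) * exp (q * \<eta>\<^sup>2) / \<eta>) * exp (- q * x\<^sup>2)) ((B ^ (n - 1) * exp (q * \<eta>\<^sup>2) / \<eta>) * sqrt (pi / q))"
      by (intro has_bochner_integral_mult_right has_bochner_integral_gaussian q)
    have gi: "integrable lborel (\<lambda>x. (B ^ (n - 1) * exp (q * \<eta>\<^sup>2) / \<eta>) * exp (- q * x\<^sup>2))"
      using g by (rule integrable.intros)
    have "cmod (R t) \<le> (LBINT x. (B ^ (n - 1) * exp (q * \<eta>\<^sup>2) / \<eta>) * exp (- q * x\<^sup>2))"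
      unfolding R_def
    proof (rule Bochner_Integration.integral_norm_bound_integral[OF int_R gi])
      fix x
      \<comment> \<open>One of the \<open>n\<close> factors is kept as a Gaussian to make the
        integral converge; hence the exponent n - 1 of \<open>B\<close>.\<close>
      have "cmod (cw q (L x)) ^ n = cmod (cw q (L x)) ^ (n - 1) * cmod (cw q (L x))"
        using n by (simp add: power_eq_if)
      also have "\<dots> \<le> B ^ (n - 1) * (exp (q * \<eta>\<^sup>2) * exp (- q * x\<^sup>2))"
      proof (rule mult_mono)
        show "cmod (cw q (L x)) ^ (n - 1) \<le> B ^ (n - 1)" using B by (intro power_mono) (auto simp: L_def)
        show "cmod (cw q (L x)) \<le> exp (q * \<eta>\<^sup>2) * exp (- q * x\<^sup>2)"
          using norm_cw_le[of "L x" q] \<eta> by (simp add: L_def exp_add[symmetric] algebra_simps)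
      qed (use B0 in auto)
      finally have 1: "cmod (cw q (L x)) ^ n \<le> B ^ (n - 1) * (exp (q * \<eta>\<^sup>2) * exp (- q * x\<^sup>2))" .
      have "cmod (f (L x) * m (L x) ^ n / (m (of_real t) ^ n * (L x - of_real t))) = cmod (cw q (L x)) ^ n / cmod (L x - of_real t)"
        unfolding fm by (simp add: norm_mult norm_divide norm_power m0)
      also have "\<dots> \<le> B ^ (n - 1) * (exp (q * \<eta>\<^sup>2) * exp (- q * x\<^sup>2)) / \<eta>"
        using 1 L2 \<eta> B0 by (intro frac_le) auto
      finally show "cmod (f (L x) * m (L x) ^ n / (m (of_real t) ^ n * (L x - of_real t))) \<le> (B ^ (n - 1) * exp (q * \<eta>\<^sup>2) / \<eta>) * exp (- q * x\<^sup>2)"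
        by simp
    qed
    also have "\<dots> = G / \<eta>" using has_bochner_integral_integral_eq[OF g] by (simp add: G_def)
    finally show ?thesis .
  qed
  \<comment> \<open>The numerator of V / (2 pi \<i>) over the common denominator (t - \<i>)^n (t +
    \<i>)^n = (1 + t^2)^n.\<close>
  define Q where "Q = (\<Sum>j<n. smult (A j / (2 * pi * \<i>)) ([:- \<i>, 1:] ^ (n + j) * [:\<i>, 1:] ^ (n - 1 - j)))"
  have Qval: "poly Q (of_real t) / of_real ((1 + t\<^sup>2) ^ n) = V t / (2 * pi * \<i>)" for t
  proof -
    have e: "of_real ((1 + t\<^sup>2) ^ n) = (of_real t - \<i>) ^ n * (of_real t + \<i>) ^ n"
    proof -
      have "(1 + (of_real t)\<^sup>2 :: complex) = (of_real t - \<i>) * (of_real t + \<i>)"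
        by (simp add: algebra_simps power2_eq_square)
      then show ?thesis by (simp add: power_mult_distrib)
    qed
    have nz: "of_real t - \<i> \<noteq> 0" "of_real t + \<i> \<noteq> 0" using rne[of t] by (auto simp: add_eq_0_iff2)
    have "(- \<i> + of_real t) ^ (n + j) * (\<i> + of_real t) ^ (n - 1 - j) / ((of_real t - \<i>) ^ n * (of_real t + \<i>) ^ n) =
      (of_real t - \<i>) ^ j / (of_real t + \<i>) ^ Suc j" if "j < n" for j
    proof -
      define a b where "a = complex_of_real t - \<i>" and "b = complex_of_real t + \<i>"
      have ab: "(- \<i> + of_real t) = a" "(\<i> + of_real t) = b" "a \<noteq> 0" "b \<noteq> 0"
        using nz by (simp_all add: a_def b_def)
      have "b ^ n = b ^ (n - 1 - j) * b ^ Suc j"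
        using that by (simp add: power_add[symmetric] del: power_Suc)
      then have "a ^ (n + j) * b ^ (n - 1 - j) / (a ^ n * b ^ n) = a ^ j / b ^ Suc j"
        using ab by (simp add: power_add)
      then show ?thesis unfolding ab(1,2) by (simp only: a_def b_def)
    qed
    note factor = this
    have "poly (smult (A j / (2 * pi * \<i>)) ([:- \<i>, 1:] ^ (n + j) * [:\<i>, 1:] ^ (n - 1 - j))) (of_real t)
        / ((of_real t - \<i>) ^ n * (of_real t + \<i>) ^ n) =
      A j * ((of_real t - \<i>) ^ j / (of_real t + \<i>) ^ Suc j) / (2 * pi * \<i>)" if "j < n" for j
      unfolding factor[OF that, symmetric] by (simp add: poly_power del: diff_diff_left)
    then show ?thesis
      unfolding Q_def V_def e poly_sum sum_divide_distrib by (intro sum.cong refl) auto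
  qed
  have "degree Q \<le> Suc (2 * n)" unfolding Q_def
  proof (rule degree_sum_le)
    fix j assume j: "j \<in> {..<n}"
    have "degree ([:- \<i>, 1:] ^ (n + j) * [:\<i>, 1:] ^ (n - 1 - j)) \<le> (n + j) + (n - 1 - j)"
      using degree_mult_le[of "[:- \<i>, 1:] ^ (n + j)" "[:\<i>, 1:] ^ (n - 1 - j)"]
        degree_power_le[of "[:- \<i>, 1:]" "n + j"] degree_power_le[of "[:\<i>, 1:]" "n - 1 - j"] by simp
    then show "degree (smult (A j / (2 * pi * \<i>)) ([:- \<i>, 1:] ^ (n + j) * [:\<i>, 1:] ^ (n - 1 - j))) \<le> Suc (2 * n)"
      using j degree_smult_le[of "A j / (2 * pi * \<i>)" "[:- \<i>, 1:] ^ (n + j) * [:\<i>, 1:] ^ (n - 1 - j)"] by simp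
  qed simp
  then obtain p where p: "degree p \<le> n" "\<And>x. Re (poly Q (of_real x) + poly Q (- of_real x)) = poly p (x\<^sup>2)"
    by (rule even_part_poly) blast
  have err: "\<bar>poly p (t\<^sup>2) / (1 + t\<^sup>2) ^ n - exp (- (n * q) * t\<^sup>2)\<bar> \<le> G / (pi * \<eta>)" for t
  proof -
    have "poly p (t\<^sup>2) / (1 + t\<^sup>2) ^ n = Re ((poly Q (of_real t) + poly Q (of_real (- t))) / of_real ((1 + t\<^sup>2) ^ n))"
      using p(2)[of t] by (simp del: of_real_power of_real_add)
    also have "(poly Q (of_real t) + poly Q (of_real (- t))) / of_real ((1 + t\<^sup>2) ^ n) = (V t + V (- t)) / (2 * pi * \<i>)"
      using Qval[of t] Qval[of "- t"] by (simp add: add_divide_distrib)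
    finally have 1: "poly p (t\<^sup>2) / (1 + t\<^sup>2) ^ n = Re ((V t + V (- t)) / (2 * pi * \<i>))" .
    have "f (of_real t) = of_real (exp (- (n * q) * t\<^sup>2))"
    proof -
      have "- of_real (n * q) * (of_real t)\<^sup>2 = (of_real (- (n * q) * t\<^sup>2) :: complex)" by simp
      then show ?thesis by (simp only: f_def exp_of_real)
    qed
    then have 2: "exp (- (n * q) * t\<^sup>2) = Re ((U t + U (- t)) / (2 * pi * \<i>))"
      unfolding UU by simp
    have "poly p (t\<^sup>2) / (1 + t\<^sup>2) ^ n - exp (- (n * q) * t\<^sup>2) = - Re ((R t + R (- t)) / (2 * pi * \<i>))"
      unfolding 1 2 split by (simp add: add_divide_distrib)
    then have "\<bar>poly p (t\<^sup>2) / (1 + t\<^sup>2) ^ n - exp (- (n * q) * t\<^sup>2)\<bar> \<le> cmod ((R t + R (- t)) / (2 * pi * \<i>))"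
      using abs_Re_le_cmod by (metis abs_minus_cancel)
    also have "\<dots> \<le> (G / \<eta> + G / \<eta>) / (2 * pi)"
    proof -
      have "cmod (2 * pi * \<i>) = 2 * pi" by (simp add: norm_mult)
      moreover have "cmod (R t + R (- t)) \<le> G / \<eta> + G / \<eta>"
        using norm_triangle_ineq[of "R t" "R (- t)"] Rbd[of t] Rbd[of "- t"] by linarith
      ultimately show ?thesis unfolding norm_divide by (simp only:) (intro divide_right_mono; simp)
    qed
    also have "\<dots> = G / (pi * \<eta>)" by simp
    finally show ?thesis .
  qed
  show ?thesis
  proof (rule exp_err_le[OF p(1)])
    fix u :: real assume "u \<ge> 0"
    then show "exp_dev n (n * q) p u \<le> 1 / (pi * \<eta>) * (B ^ (n - 1) * (exp (q * \<eta>\<^sup>2) * sqrt (pi / q)))"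
      using err[of "sqrt u"] unfolding exp_dev_def G_def[symmetric] by simp
  qed (use q in simp)
qed

section \<open>Exponential rates along horizontal lines\<close>

lemma norm_cw_line:
  assumes "y = x\<^sup>2 + \<eta>\<^sup>2 + 1"
  shows "cmod (cw q (Complex x (- \<eta>))) = exp (- q * (y - 1 - 2 * \<eta>\<^sup>2)) * sqrt ((y - 2 * \<eta>) / (y + 2 * \<eta>))"
proof -
  have "cmod (Complex x (- \<eta>) + \<i>) = sqrt (y - 2 * \<eta>)" "cmod (Complex x (- \<eta>) - \<i>) = sqrt (y + 2 * \<eta>)"
    unfolding cmod_def by (simp_all add: assms power2_eq_square algebra_simps)
  then show ?thesis
    unfolding cw_def norm_mult norm_divide real_sqrt_divide
    by (simp add: Re_power2 assms algebra_simps)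
qed

text \<open>Compares the modulus at \<open>y\<close> with the expression at a reference value
  \<open>Y\<close>. For the ratio \<open>t\<close> of the squared Moebius factors, t <= exp(t - 1)
  leaves an exponent which is minus the product in the last assumption. It serves Y =
  \<open>saddle_R q \<eta>\<close> as well as the axis value Y = 1 + \<eta>^2.\<close>

lemma norm_cw_line_le:
  assumes "\<eta> > 0" "Y > 2 * \<eta>" "y = x\<^sup>2 + \<eta>\<^sup>2 + 1"
    and "(y - Y) * (q - 2 * \<eta> / ((y + 2 * \<eta>) * (Y - 2 * \<eta>))) \<ge> 0"
  shows "cmod (cw q (Complex x (- \<eta>))) \<le> exp (- q * (Y - 1 - 2 * \<eta>\<^sup>2)) * sqrt ((Y - 2 * \<eta>) / (Y + 2 * \<eta>))"
proof -
  have y: "y \<ge> 2 * \<eta>"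
    using sum_squares_bound[of \<eta> 1] zero_le_power2[of x] assms(3) unfolding power_one mult_1_right by linarith
  define t where "t = ((y - 2 * \<eta>) / (y + 2 * \<eta>)) / ((Y - 2 * \<eta>) / (Y + 2 * \<eta>))"
  have t1: "t - 1 = 2 * (2 * \<eta> * (y - Y) / ((y + 2 * \<eta>) * (Y - 2 * \<eta>)))"
    using assms y by (simp add: t_def divide_simps) (simp add: algebra_simps)
  have "t \<le> exp (t - 1)" using exp_ge_add_one_self[of "t - 1"] by simp
  also have "\<dots> = (exp ((t - 1) / 2))\<^sup>2" by (simp add: power2_eq_square exp_add[symmetric])
  finally have "sqrt t \<le> exp ((t - 1) / 2)" by (metis real_sqrt_le_iff real_sqrt_abs abs_exp_cancel)
  moreover have "(y - 2 * \<eta>) / (y + 2 * \<eta>) = (Y - 2 * \<eta>) / (Y + 2 * \<eta>) * t"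
    using assms by (simp add: t_def)
  ultimately have "sqrt ((y - 2 * \<eta>) / (y + 2 * \<eta>)) \<le> sqrt ((Y - 2 * \<eta>) / (Y + 2 * \<eta>)) * exp ((t - 1) / 2)"
    by (simp only: real_sqrt_mult) (use assms in \<open>auto intro!: mult_left_mono\<close>)
  then have "cmod (cw q (Complex x (- \<eta>))) \<le>
      exp (- q * (y - 1 - 2 * \<eta>\<^sup>2)) * (sqrt ((Y - 2 * \<eta>) / (Y + 2 * \<eta>)) * exp ((t - 1) / 2))"
    unfolding norm_cw_line[OF assms(3)] by (intro mult_left_mono) auto
  also have "\<dots> = exp (- q * (Y - 1 - 2 * \<eta>\<^sup>2)) * sqrt ((Y - 2 * \<eta>) / (Y + 2 * \<eta>)) * exp ((t - 1) / 2 - q * (y - Y))"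
  proof -
    have "- q * (y - 1 - 2 * \<eta>\<^sup>2) + (t - 1) / 2 = - q * (Y - 1 - 2 * \<eta>\<^sup>2) + ((t - 1) / 2 - q * (y - Y))"
      by (simp add: algebra_simps)
    then have e: "exp (- q * (y - 1 - 2 * \<eta>\<^sup>2)) * exp ((t - 1) / 2) = exp (- q * (Y - 1 - 2 * \<eta>\<^sup>2)) * exp ((t - 1) / 2 - q * (y - Y))"
      by (simp only: exp_add[symmetric])
    have "a * (S * b) = c * S * d" if "a * b = c * d" for a b c d S :: real
    proof -
      have "a * (S * b) = S * (a * b)" by simp
      then show ?thesis unfolding that by simp
    qed
    from this[OF e] show ?thesis .
  qed
  also have "\<dots> \<le> exp (- q * (Y - 1 - 2 * \<eta>\<^sup>2)) * sqrt ((Y - 2 * \<eta>) / (Y + 2 * \<eta>)) * 1"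
  proof (rule mult_left_mono)
    have "(t - 1) / 2 - q * (y - Y) = - ((y - Y) * (q - 2 * \<eta> / ((y + 2 * \<eta>) * (Y - 2 * \<eta>))))"
    proof -
      have "2 * (2 * \<eta> * d / W) / 2 - q * d = - (d * (q - 2 * \<eta> / W))" for d W
        by (simp add: algebra_simps)
      then show ?thesis unfolding t1 .
    qed
    then show "exp ((t - 1) / 2 - q * (y - Y)) \<le> 1" using assms(4) by simp
  qed (use assms in auto)
  finally show ?thesis by simp
qed

text \<open>
  \<open>saddle_R q \<eta>\<close> is the value of \<open>x\<^sup>2 + \<eta>\<^sup>2 + 1\<close> at the critical points of \<open>\<bar>cw q\<bar>\<close> on the line
  \<open>Im s = - \<eta>\<close>, and \<open>line_rate q \<eta>\<close> the logarithm of \<open>\<bar>cw q\<bar>\<close> there. These points are real only if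
  \<open>1 + \<eta>\<^sup>2 \<le> saddle_R q \<eta>\<close>; the bound from above holds regardless.
\<close>

definition saddle_R :: "real \<Rightarrow> real \<Rightarrow> real" where
  "saddle_R q \<eta> = sqrt (4 * \<eta>\<^sup>2 + 2 * \<eta> / q)"

definition line_rate :: "real \<Rightarrow> real \<Rightarrow> real" where
  "line_rate q \<eta> = - q * (saddle_R q \<eta> - 1 - 2 * \<eta>\<^sup>2) + ln ((saddle_R q \<eta> - 2 * \<eta>) / (saddle_R q \<eta> + 2 * \<eta>)) / 2"

lemma saddle_R:
  assumes "q > 0" "\<eta> > 0"
  shows "saddle_R q \<eta> > 2 * \<eta>" "(saddle_R q \<eta>)\<^sup>2 = 4 * \<eta>\<^sup>2 + 2 * \<eta> / q"
    "q * ((saddle_R q \<eta> + 2 * \<eta>) * (saddle_R q \<eta> - 2 * \<eta>)) = 2 * \<eta>"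
proof -
  have "(2 * \<eta>)\<^sup>2 < 4 * \<eta>\<^sup>2 + 2 * \<eta> / q" using assms by simp
  then show "saddle_R q \<eta> > 2 * \<eta>" unfolding saddle_R_def by (rule real_less_rsqrt)
  show sq: "(saddle_R q \<eta>)\<^sup>2 = 4 * \<eta>\<^sup>2 + 2 * \<eta> / q" using assms by (simp add: saddle_R_def)
  have "(saddle_R q \<eta> + 2 * \<eta>) * (saddle_R q \<eta> - 2 * \<eta>) = (saddle_R q \<eta>)\<^sup>2 - 4 * \<eta>\<^sup>2"
    by (simp add: power2_eq_square algebra_simps)
  then show "q * ((saddle_R q \<eta> + 2 * \<eta>) * (saddle_R q \<eta> - 2 * \<eta>)) = 2 * \<eta>"
    using assms by (simp add: sq)
qed

lemma exp_line_rate: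
  assumes "q > 0" "\<eta> > 0" "R = saddle_R q \<eta>"
  shows "exp (line_rate q \<eta>) = exp (- q * (R - 1 - 2 * \<eta>\<^sup>2)) * sqrt ((R - 2 * \<eta>) / (R + 2 * \<eta>))"
proof -
  have "(R - 2 * \<eta>) / (R + 2 * \<eta>) > 0" using saddle_R(1)[OF assms(1,2)] assms by simp
  then have "exp (ln ((R - 2 * \<eta>) / (R + 2 * \<eta>)) / 2) = sqrt ((R - 2 * \<eta>) / (R + 2 * \<eta>))"
    by (simp add: ln_sqrt[symmetric])
  then show ?thesis unfolding line_rate_def assms(3) exp_add by simp
qed

text \<open>At the critical value \<open>R\<close> the product required by
  \<open>norm_cw_line_le\<close> becomes q (y - R)^2 / (y + 2 \<eta>).\<close>

lemma norm_cw_le_line_rate: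
  assumes q: "q > 0" and \<eta>: "\<eta> > 0"
  shows "cmod (cw q (Complex x (- \<eta>))) \<le> exp (line_rate q \<eta>)"
proof -
  define R where "R = saddle_R q \<eta>"
  define y where "y = x\<^sup>2 + \<eta>\<^sup>2 + 1"
  note R = saddle_R[OF assms, folded R_def]
  have y: "y \<ge> 0" by (simp add: y_def)
  have "(y - R) * (q - 2 * \<eta> / ((y + 2 * \<eta>) * (R - 2 * \<eta>))) = q * (y - R)\<^sup>2 / (y + 2 * \<eta>)"
  proof -
    have "2 * \<eta> / ((y + 2 * \<eta>) * (R - 2 * \<eta>)) = q * (R + 2 * \<eta>) / (y + 2 * \<eta>)"
    proof -
      have "2 * \<eta> / ((y + 2 * \<eta>) * (R - 2 * \<eta>)) = q * ((R + 2 * \<eta>) * (R - 2 * \<eta>)) / ((y + 2 * \<eta>) * (R - 2 * \<eta>))"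
        by (simp only: R(3))
      also have "\<dots> = q * (R + 2 * \<eta>) / (y + 2 * \<eta>)" using R(1) by simp
      finally show ?thesis .
    qed
    moreover have "q - q * (R + 2 * \<eta>) / (y + 2 * \<eta>) = q * (y - R) / (y + 2 * \<eta>)"
      using y \<eta> by (simp add: divide_simps) (simp add: algebra_simps)
    ultimately show ?thesis by (simp add: power2_eq_square)
  qed
  also have "\<dots> \<ge> 0" using q y \<eta> by simp
  finally show ?thesis
    unfolding exp_line_rate[OF assms R_def] by (intro norm_cw_line_le[OF \<eta> R(1) y_def])
qed

text \<open>The lower bound on \<open>saddle_R\<close> makes the critical point real; the upper one
  yields the bound on |x| that \<open>contour_estimate\<close> demands of \<open>x0\<close>.\<close>

lemma norm_cw_eq_line_rate:
  assumes "q > 0" "\<eta> > 0" "1 + \<eta>\<^sup>2 \<le> saddle_R q \<eta>" "saddle_R q \<eta> \<le> 4 * \<eta>\<^sup>2"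
  obtains x where "\<bar>x\<bar> \<le> 2 * \<eta>" "cmod (cw q (Complex x (- \<eta>))) = exp (line_rate q \<eta>)"
proof
  define x where "x = sqrt (saddle_R q \<eta> - 1 - \<eta>\<^sup>2)"
  have x2: "x\<^sup>2 = saddle_R q \<eta> - 1 - \<eta>\<^sup>2" using assms by (simp add: x_def)
  then have "x\<^sup>2 \<le> (2 * \<eta>)\<^sup>2" using assms zero_le_power2[of \<eta>] by (simp del: zero_le_power2)
  then have "\<bar>x\<bar> \<le> \<bar>2 * \<eta>\<bar>" by (rule abs_le_square_iff[THEN iffD2])
  then show "\<bar>x\<bar> \<le> 2 * \<eta>" using assms by simp
  show "cmod (cw q (Complex x (- \<eta>))) = exp (line_rate q \<eta>)"
    unfolding exp_line_rate[OF assms(1,2) refl] by (rule norm_cw_line) (simp add: x2)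
qed

text \<open>The assumption \<open>le\<close> says that \<open>saddle_R q \<eta>\<close> is at most 1
  + \<eta>^2, the value at x = 0, so the maximum over the line sits on the imaginary axis.\<close>

lemma norm_cw_le_axis:
  assumes q: "q > 0" and \<eta>: "0 < \<eta>" "\<eta> < 1" and le: "2 * \<eta> / q \<le> (1 - \<eta>\<^sup>2)\<^sup>2"
  shows "cmod (cw q (Complex x (- \<eta>))) \<le> exp (q * \<eta>\<^sup>2 + ln ((1 - \<eta>) / (1 + \<eta>)))"
proof -
  define y where "y = x\<^sup>2 + \<eta>\<^sup>2 + 1"
  define Y where "Y = 1 + \<eta>\<^sup>2"
  have Ym: "Y - 2 * \<eta> = (1 - \<eta>)\<^sup>2" "Y + 2 * \<eta> = (1 + \<eta>)\<^sup>2" by (simp_all add: Y_def power2_eq_square algebra_simps)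
  have Y: "Y > 2 * \<eta>"
  proof -
    have "Y - 2 * \<eta> > 0" unfolding Ym using \<eta> by simp
    then show ?thesis by simp
  qed
  have yY: "y \<ge> Y" by (simp add: y_def Y_def)
  have "(1 - \<eta>\<^sup>2)\<^sup>2 = (Y + 2 * \<eta>) * (Y - 2 * \<eta>)"
    unfolding Ym by (simp add: power_mult_distrib[symmetric] power2_eq_square algebra_simps)
  also have "\<dots> \<le> (y + 2 * \<eta>) * (Y - 2 * \<eta>)" using yY Y by (intro mult_right_mono) auto
  finally have "2 * \<eta> / q \<le> (y + 2 * \<eta>) * (Y - 2 * \<eta>)" using le by linarith
  then have "2 * \<eta> / ((y + 2 * \<eta>) * (Y - 2 * \<eta>)) \<le> q"
    using q Y yY \<eta> by (simp add: divide_le_eq mult.commute)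
  then have "cmod (cw q (Complex x (- \<eta>))) \<le> exp (- q * (Y - 1 - 2 * \<eta>\<^sup>2)) * sqrt ((Y - 2 * \<eta>) / (Y + 2 * \<eta>))"
    using yY by (intro norm_cw_line_le[OF \<eta>(1) Y y_def] mult_nonneg_nonneg) auto
  also have "sqrt ((Y - 2 * \<eta>) / (Y + 2 * \<eta>)) = (1 - \<eta>) / (1 + \<eta>)"
    unfolding Ym using \<eta> by (simp add: real_sqrt_divide)
  also have "exp (- q * (Y - 1 - 2 * \<eta>\<^sup>2)) * ((1 - \<eta>) / (1 + \<eta>)) = exp (q * \<eta>\<^sup>2 + ln ((1 - \<eta>) / (1 + \<eta>)))"
    using \<eta> by (simp add: exp_add Y_def)
  finally show ?thesis .
qed

lemma norm_cw_axis:
  assumes "\<eta> \<ge> 0"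
  shows "cmod (cw q (Complex 0 (- \<eta>))) = exp (q * \<eta>\<^sup>2) * (\<bar>1 - \<eta>\<bar> / (1 + \<eta>))"
proof -
  have "sqrt ((\<eta>\<^sup>2 + 1 - 2 * \<eta>) / (\<eta>\<^sup>2 + 1 + 2 * \<eta>)) = \<bar>1 - \<eta>\<bar> / (1 + \<eta>)"
  proof -
    have "\<eta>\<^sup>2 + 1 - 2 * \<eta> = (1 - \<eta>)\<^sup>2" "\<eta>\<^sup>2 + 1 + 2 * \<eta> = (1 + \<eta>)\<^sup>2" by (simp_all add: power2_eq_square algebra_simps)
    then show ?thesis using assms by (simp add: real_sqrt_divide)
  qed
  then show ?thesis using norm_cw_line[of "\<eta>\<^sup>2 + 1" 0 \<eta> q] by simp
qed

text \<open>
  The data from which \<open>contour_estimate\<close> yields a lower bound for the error with exponential rate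
  \<open>\<rho>\<close>. The constants depend on \<open>e\<close> and \<open>k\<close> only, not on \<open>h\<close>.
\<close>

definition rate_witness :: "real \<Rightarrow> real \<Rightarrow> real \<Rightarrow> real \<Rightarrow> bool" where
  "rate_witness e k \<rho> q \<longleftrightarrow> (\<exists>h x0 b b1 b2. h > 0 \<and> \<bar>x0\<bar> \<le> 2 * h * (1 + e) \<and>
     exp b \<le> cmod (cw q (Complex x0 (- (h * (1 + e))))) \<and>
     (\<forall>x. cmod (cw q (Complex x (- h))) \<le> exp b1) \<and>
     (\<forall>x. cmod (cw q (Complex x (- (h * (1 + e)\<^sup>2)))) \<le> exp b2) \<and>
     b1 \<le> b - k \<and> e * \<rho> \<le> (1 + 3 * e) * b - (1 + 2 * e) * b2)"

text \<open>For large \<open>n\<close> the gap \<open>k\<close> lets the term with \<open>b1\<close>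
  be absorbed into the left side of \<open>contour_estimate\<close>. Solving for \<open>E\<close>
  gives exp \<rho> ^ n up to a constant factor \<open>D\<close>, which the smaller base
  \<open>L\<close> swallows. Everything depends on \<open>e\<close>, \<open>k\<close>,
  \<open>L\<close> and \<rho> only, so \<open>N\<close> is uniform in \<open>q\<close>.\<close>

lemma exp_err_lower:
  assumes e: "e > 0" and k: "k > 0" and L: "0 < L" "L < exp \<rho>"
  obtains N where "\<And>n q. n \<ge> N \<Longrightarrow> q > 0 \<Longrightarrow> rate_witness e k \<rho> q \<Longrightarrow> L ^ n \<le> exp_err n (n * q)"
proof -
  define C where "C = (4 + 3 * e) * (1 + 1 / e + 1 / e\<^sup>2)"
  define \<theta> where "\<theta> = (1 + 2 * e) / (1 + 3 * e)"
  have C: "C > 0" using e by (simp add: C_def add_pos_pos)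
  have \<theta>: "1 - \<theta> = e / (1 + 3 * e)" using e by (simp add: \<theta>_def field_simps)
  then have \<theta>1: "1 - \<theta> > 0" using e by simp
  define D where "D = (2 * C) powr (1 / (1 - \<theta>))"
  have D: "D > 0" using C by (simp add: D_def)
  have "(\<lambda>n. C * exp (- k) ^ n) \<longlonglongrightarrow> C * 0" using k by (intro tendsto_intros LIMSEQ_realpow_zero) auto
  then have "\<forall>\<^sub>F n in sequentially. C * exp (- k) ^ n < 1 / 2" by (rule order_tendstoD) simp
  moreover have "(\<lambda>n. D * (L / exp \<rho>) ^ n) \<longlonglongrightarrow> D * 0" using L by (intro tendsto_intros LIMSEQ_realpow_zero) auto
  then have "\<forall>\<^sub>F n in sequentially. D * (L / exp \<rho>) ^ n < 1" by (rule order_tendstoD) simp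
  ultimately have "\<forall>\<^sub>F n in sequentially. C * exp (- k) ^ n < 1 / 2 \<and> D * (L / exp \<rho>) ^ n < 1 \<and> n \<ge> 1"
    using eventually_ge_at_top[of 1] by eventually_elim auto
  then obtain N where N: "\<And>n. n \<ge> N \<Longrightarrow> C * exp (- k) ^ n < 1 / 2 \<and> D * (L / exp \<rho>) ^ n < 1 \<and> n \<ge> 1"
    unfolding eventually_sequentially by blast
  show ?thesis
  proof (rule that[of N])
    fix n :: nat and q assume n: "n \<ge> N" and q: "q > 0" and "rate_witness e k \<rho> q"
    then obtain h x0 b b1 b2 where w: "h > 0" "\<bar>x0\<bar> \<le> 2 * h * (1 + e)"
      "exp b \<le> cmod (cw q (Complex x0 (- (h * (1 + e)))))"
      "\<And>x. cmod (cw q (Complex x (- h))) \<le> exp b1"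
      "\<And>x. cmod (cw q (Complex x (- (h * (1 + e)\<^sup>2)))) \<le> exp b2"
      "b1 \<le> b - k" "e * \<rho> \<le> (1 + 3 * e) * b - (1 + 2 * e) * b2"
      unfolding rate_witness_def by blast
    show "L ^ n \<le> exp_err n (n * q)"
    proof (rule exp_err_ge)
      fix p E assume p: "degree p \<le> n" and E: "E > 0" and dev: "\<And>u. u \<ge> 0 \<Longrightarrow> exp_dev n (n * q) p u \<le> E"
      have "exp b ^ n \<le> cmod (cw q (Complex x0 (- (h * (1 + e))))) ^ n" using w by (intro power_mono) auto
      also have "\<dots> \<le> C * (exp b1 ^ n + E powr (1 - \<theta>) * (exp b2 ^ n) powr \<theta>)"
        unfolding C_def using N[OF n] p E dev
        by (intro contour_estimate[OF q _ _ E _ w(1) e w(4,5,2) \<theta>_def]) (auto simp: exp_dev_def)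
      also have "exp b2 ^ n = exp (n * b2)" by (simp add: exp_of_nat_mult)
      also have "exp b1 ^ n \<le> exp (- k) ^ n * exp b ^ n"
      proof -
        have "exp b1 ^ n \<le> exp (b - k) ^ n" using w by (intro power_mono) auto
        then show ?thesis by (simp add: power_mult_distrib[symmetric] exp_add[symmetric] exp_diff)
      qed
      finally have 1: "exp b ^ n \<le> (C * exp (- k) ^ n) * exp b ^ n + C * (E powr (1 - \<theta>) * exp (n * b2) powr \<theta>)"
        using C by (simp add: algebra_simps)
      have "(C * exp (- k) ^ n) * exp b ^ n \<le> 1 / 2 * exp b ^ n"
        using N[OF n] by (intro mult_right_mono) auto
      then have 2: "exp b ^ n \<le> 2 * C * (E powr (1 - \<theta>) * exp (n * b2) powr \<theta>)" using 1 by linarith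
      \<comment> \<open>The last condition of \<open>rate_witness\<close>, divided by 1 + 3 e, reads
        (1 - \<theta>) \<rho> + \<theta> b2 <= b.\<close>
      have 3: "exp (n * ((1 - \<theta>) * \<rho>)) * exp (n * b2) powr \<theta> \<le> exp b ^ n"
      proof -
        have "(1 + 3 * e) * ((1 - \<theta>) * \<rho> + \<theta> * b2) \<le> (1 + 3 * e) * b"
        proof -
          have "(1 + 3 * e) * ((1 - \<theta>) * \<rho> + \<theta> * b2) = e * \<rho> + (1 + 2 * e) * b2"
            unfolding \<theta> unfolding \<theta>_def using e by (simp add: distrib_left)
          then show ?thesis using w(7) by linarith
        qed
        then have "(1 - \<theta>) * \<rho> + \<theta> * b2 \<le> b" using e by simp
        then have "exp (n * ((1 - \<theta>) * \<rho> + \<theta> * b2)) \<le> exp (n * b)" by (simp add: mult_left_mono)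
        then show ?thesis by (simp add: exp_of_nat_mult[symmetric] powr_def exp_add[symmetric] algebra_simps)
      qed
      have "exp (n * ((1 - \<theta>) * \<rho>)) * exp (n * b2) powr \<theta> \<le> (2 * C * E powr (1 - \<theta>)) * exp (n * b2) powr \<theta>"
        using order_trans[OF 3 2] by (simp only: mult_ac)
      then have "exp (n * ((1 - \<theta>) * \<rho>)) \<le> 2 * C * E powr (1 - \<theta>)" by simp
      then have "exp (n * ((1 - \<theta>) * \<rho>)) powr (1 / (1 - \<theta>)) \<le> (2 * C * E powr (1 - \<theta>)) powr (1 / (1 - \<theta>))"
        using \<theta>1 by (intro powr_mono2) auto
      also have "\<dots> = D * E" unfolding D_def using \<theta>1 C E by (simp add: powr_mult powr_powr)
      also have "exp (n * ((1 - \<theta>) * \<rho>)) powr (1 / (1 - \<theta>)) = exp \<rho> ^ n"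
        using \<theta>1 by (simp add: powr_def exp_of_nat_mult[symmetric])
      finally have 4: "exp \<rho> ^ n \<le> D * E" .
      have "L ^ n = (L / exp \<rho>) ^ n * exp \<rho> ^ n" by (simp add: power_mult_distrib[symmetric])
      also have "\<dots> \<le> (L / exp \<rho>) ^ n * (D * E)" using 4 L by (intro mult_left_mono) auto
      also have "\<dots> = (D * (L / exp \<rho>) ^ n) * E" by simp
      also have "\<dots> \<le> 1 * E" using N[OF n] E by (intro mult_right_mono) auto
      finally show "L ^ n \<le> E" by simp
    qed (use q in simp)
  qed
qed

text \<open>\<open>saddle_R\<close> is critical along the line, so its own derivative
  \<open>D\<close> cancels. The result vanishes when \<open>saddle_R q \<eta>\<close> is 4 \<eta>^2,
  that is, when the critical points on the line are saddle points of \<open>cw q\<close>.\<close>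

lemma DERIV_line_rate:
  assumes "q > 0" "\<eta> > 0"
  shows "(line_rate q has_real_derivative q / \<eta> * (4 * \<eta>\<^sup>2 - saddle_R q \<eta>)) (at \<eta>)"
proof -
  define R where "R = saddle_R q \<eta>"
  note R = saddle_R[OF assms, folded R_def]
  define D where "D = (8 * \<eta> + 2 / q) / (2 * R)"
  have S0: "4 * \<eta>\<^sup>2 + 2 * \<eta> / q > 0" using assms by (simp add: add_pos_pos)
  have dR: "(saddle_R q has_real_derivative D) (at \<eta>)"
    unfolding saddle_R_def[abs_def] D_def R_def using assms S0
    by (auto intro!: derivative_eq_intros simp: saddle_R_def field_simps)
  define P M where "P = R - 2 * \<eta>" and "M = R + 2 * \<eta>"
  have PM: "P > 0" "M > 0" "q * (M * P) = 2 * \<eta>" using R assms by (auto simp: P_def M_def)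
  have "(line_rate q has_real_derivative - q * (D - 4 * \<eta>) + ((D - 2) / P - (D + 2) / M) / 2) (at \<eta>)"
    unfolding line_rate_def[abs_def] using PM
    by (auto intro!: derivative_eq_intros dR simp: R_def[symmetric] P_def[symmetric] M_def[symmetric] divide_simps)
  also have "- q * (D - 4 * \<eta>) + ((D - 2) / P - (D + 2) / M) / 2 = q / \<eta> * (4 * \<eta>\<^sup>2 - R)"
  proof -
    have "(D - 2) / P - (D + 2) / M = ((D - 2) * M - (D + 2) * P) / (M * P)" using PM by (simp add: field_simps)
    also have "(D - 2) * M - (D + 2) * P = 4 * (\<eta> * D - R)" by (simp add: P_def M_def algebra_simps)
    also have "4 * (\<eta> * D - R) / (M * P) = 4 * (\<eta> * D - R) * q / (2 * \<eta>)"
      by (subst PM(3)[symmetric]) (use PM(1,2) assms in simp)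
    finally have "(D - 2) / P - (D + 2) / M = 4 * (\<eta> * D - R) * q / (2 * \<eta>)" .
    then show ?thesis using assms by (simp only:) (simp add: field_simps power2_eq_square)
  qed
  finally show ?thesis by (simp add: R_def)
qed

lemma continuous_line_rate:
  assumes "q > 0" "\<eta> > 0"
  shows "isCont (\<lambda>q. saddle_R q \<eta>) q" "isCont (\<lambda>q. line_rate q \<eta>) q" "isCont (saddle_R q) \<eta>"
proof -
  have 1: "saddle_R q \<eta> + 2 * \<eta> \<noteq> 0" "saddle_R q \<eta> - 2 * \<eta> \<noteq> 0" using saddle_R(1)[OF assms] assms by auto
  show c: "isCont (\<lambda>q. saddle_R q \<eta>) q" "isCont (saddle_R q) \<eta>"
    unfolding saddle_R_def[abs_def] using assms by (auto intro!: continuous_intros)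
  show "isCont (\<lambda>q. line_rate q \<eta>) q"
    unfolding line_rate_def by (intro continuous_intros c) (use 1 in auto)
qed

lemma rate_witness_saddle:
  assumes "q > 0" "h > 0" "e > 0"
    and "1 + (h * (1 + e))\<^sup>2 \<le> saddle_R q (h * (1 + e))" "saddle_R q (h * (1 + e)) \<le> 4 * (h * (1 + e))\<^sup>2"
    and "line_rate q h \<le> line_rate q (h * (1 + e)) - k"
    and "e * \<rho> \<le> (1 + 3 * e) * line_rate q (h * (1 + e)) - (1 + 2 * e) * line_rate q (h * (1 + e)\<^sup>2)"
  shows "rate_witness e k \<rho> q"
proof -
  have p: "h * (1 + e) > 0" "h * (1 + e)\<^sup>2 > 0" using assms by auto
  obtain x where "\<bar>x\<bar> \<le> 2 * (h * (1 + e))" "cmod (cw q (Complex x (- (h * (1 + e))))) = exp (line_rate q (h * (1 + e)))"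
    using norm_cw_eq_line_rate[OF assms(1) p(1) assms(4,5)] by blast
  then show ?thesis
    unfolding rate_witness_def using assms(2,3,6,7) norm_cw_le_line_rate[OF assms(1,2)] norm_cw_le_line_rate[OF assms(1) p(2)]
    by (intro exI[of _ h] exI[of _ x] exI[of _ "line_rate q (h * (1 + e))"] exI[of _ "line_rate q h"]
        exI[of _ "line_rate q (h * (1 + e)\<^sup>2)"] conjI allI) (simp_all only: mult.assoc)
qed

text \<open>
  As \<open>e\<close> tends to \<open>0\<close>, the rate obtained from the lines \<open>Im s = - h (1 + e)\<^sup>j\<close>, \<open>j = 0, 1, 2\<close>, tends to
  \<open>g h - h g' h\<close> where \<open>g = line_rate q\<close> and \<open>h g' h = q (4 h\<^sup>2 - R)\<close>.
\<close>

lemma rate_witness_local: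
  assumes q: "q > 0" and h: "h > 0" and R: "1 + h\<^sup>2 < saddle_R q h" "saddle_R q h < 4 * h\<^sup>2"
    and \<rho>: "\<rho> < line_rate q h - q * (4 * h\<^sup>2 - saddle_R q h)"
  obtains e k where "e > 0" "k > 0" "\<forall>\<^sub>F q' in nhds q. rate_witness e k \<rho> q'"
proof -
  define d where "d = q / h * (4 * h\<^sup>2 - saddle_R q h)"
  let ?g = "line_rate q"
  have d: "d > 0" using q h R by (simp add: d_def)
  have dh: "d * h = q * (4 * h\<^sup>2 - saddle_R q h)" using h by (simp add: d_def)
  have dg: "(?g has_real_derivative d) (at h)" unfolding d_def by (rule DERIV_line_rate[OF q h])
  have d1: "((\<lambda>e. ?g (h * (1 + e))) has_real_derivative d * h) (at 0)"
    by (rule DERIV_chain2[of ?g]) (use dg in \<open>auto intro!: derivative_eq_intros\<close>)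
  have d2: "((\<lambda>e. ?g (h * (1 + e)\<^sup>2)) has_real_derivative d * (2 * h)) (at 0)"
    by (rule DERIV_chain2[of ?g]) (use dg in \<open>auto intro!: derivative_eq_intros\<close>)
  \<comment> \<open>This expression is 0 at e = 0, so its positive derivative makes it positive for
    small e > 0, which is the last condition of \<open>rate_witness\<close>.\<close>
  have "((\<lambda>e. (1 + 3 * e) * ?g (h * (1 + e)) - (1 + 2 * e) * ?g (h * (1 + e)\<^sup>2) - e * \<rho>) has_real_derivative ?g h - d * h - \<rho>) (at 0)"
  proof -
    have gen: "((\<lambda>e. (1 + 3 * e) * f1 e - (1 + 2 * e) * f2 e - e * \<rho>) has_real_derivative 3 * f1 0 + D1 - (2 * f2 0 + D2) - \<rho>) (at 0)"
      if "(f1 has_real_derivative D1) (at 0)" "(f2 has_real_derivative D2) (at 0)" for f1 f2 D1 D2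
      by (rule derivative_eq_intros that refl | simp)+
    show ?thesis by (rule DERIV_cong[OF gen[OF d1 d2]]) (simp add: algebra_simps)
  qed
  moreover have "0 < ?g h - d * h - \<rho>" using \<rho> dh by simp
  ultimately obtain \<delta>2 where \<delta>2: "\<delta>2 > 0" "\<And>e. 0 < e \<Longrightarrow> e < \<delta>2 \<Longrightarrow>
      0 < (1 + 3 * e) * ?g (h * (1 + e)) - (1 + 2 * e) * ?g (h * (1 + e)\<^sup>2) - e * \<rho>"
    using DERIV_pos_inc_right[of "\<lambda>e. (1 + 3 * e) * ?g (h * (1 + e)) - (1 + 2 * e) * ?g (h * (1 + e)\<^sup>2) - e * \<rho>" "?g h - d * h - \<rho>" 0]
    by auto
  obtain \<delta>1 where \<delta>1: "\<delta>1 > 0" "\<And>e. 0 < e \<Longrightarrow> e < \<delta>1 \<Longrightarrow> ?g h < ?g (h * (1 + e))"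
    using DERIV_pos_inc_right[OF d1] d h by auto
  have cR: "((\<lambda>e. saddle_R q (h * (1 + e))) \<longlongrightarrow> saddle_R q h) (at_right 0)"
    by (rule isCont_tendsto_compose[OF continuous_line_rate(3)[OF q h]]) (auto intro!: tendsto_eq_intros)
  have c1: "((\<lambda>e. saddle_R q (h * (1 + e)) - (1 + (h * (1 + e))\<^sup>2)) \<longlongrightarrow> saddle_R q h - (1 + (h * (1 + 0))\<^sup>2)) (at_right 0)"
    by (intro tendsto_intros cR)
  have c2: "((\<lambda>e. 4 * (h * (1 + e))\<^sup>2 - saddle_R q (h * (1 + e))) \<longlongrightarrow> 4 * (h * (1 + 0))\<^sup>2 - saddle_R q h) (at_right 0)"
    by (intro tendsto_intros cR)
  have "\<forall>\<^sub>F e in at_right 0. 0 < saddle_R q (h * (1 + e)) - (1 + (h * (1 + e))\<^sup>2)"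
    by (rule order_tendstoD(1)[OF c1]) (use R in simp)
  moreover have "\<forall>\<^sub>F e in at_right 0. 0 < 4 * (h * (1 + e))\<^sup>2 - saddle_R q (h * (1 + e))"
    by (rule order_tendstoD(1)[OF c2]) (use R in simp)
  moreover have "\<forall>\<^sub>F e in at_right 0. 0 < e \<and> e < \<delta>1 \<and> e < \<delta>2"
    using eventually_at_right_less[of 0] eventually_at_right_real[OF \<delta>1(1)] eventually_at_right_real[OF \<delta>2(1)]
    by eventually_elim auto
  ultimately have "\<forall>\<^sub>F e in at_right 0. 0 < saddle_R q (h * (1 + e)) - (1 + (h * (1 + e))\<^sup>2) \<and>
     0 < 4 * (h * (1 + e))\<^sup>2 - saddle_R q (h * (1 + e)) \<and> 0 < e \<and> e < \<delta>1 \<and> e < \<delta>2"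
    by eventually_elim auto
  from eventually_happens[OF this] obtain e where e: "0 < saddle_R q (h * (1 + e)) - (1 + (h * (1 + e))\<^sup>2)"
    "0 < 4 * (h * (1 + e))\<^sup>2 - saddle_R q (h * (1 + e))" "0 < e" "e < \<delta>1" "e < \<delta>2" by auto
  define k where "k = (?g (h * (1 + e)) - ?g h) / 2"
  have k: "k > 0" "?g h < ?g (h * (1 + e)) - k" using \<delta>1(2)[OF e(3,4)] by (auto simp: k_def field_simps)
  have p: "h * (1 + e) > 0" "h * (1 + e)\<^sup>2 > 0" using h e by auto
  \<comment> \<open>With \<open>e\<close> and \<open>k\<close> fixed, all conditions are strict
    inequalities between functions continuous in the pole parameter, so they persist near
    \<open>q\<close>.\<close>
  have tq: "((\<lambda>q'. saddle_R q' \<eta>) \<longlongrightarrow> saddle_R q \<eta>) (nhds q)" "((\<lambda>q'. line_rate q' \<eta>) \<longlongrightarrow> line_rate q \<eta>) (nhds q)"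
    if "\<eta> > 0" for \<eta>
    using continuous_line_rate(1,2)[OF q that] tendsto_at_iff_tendsto_nhds[of "\<lambda>q'. saddle_R q' \<eta>" q]
      tendsto_at_iff_tendsto_nhds[of "\<lambda>q'. line_rate q' \<eta>" q] by (simp_all add: isCont_def)
  have "\<forall>\<^sub>F q' in nhds q. 0 < saddle_R q' (h * (1 + e)) - (1 + (h * (1 + e))\<^sup>2)"
    by (rule order_tendstoD(1)[OF tendsto_diff[OF tq(1)[OF p(1)] tendsto_const] e(1)])
  moreover have "\<forall>\<^sub>F q' in nhds q. 0 < 4 * (h * (1 + e))\<^sup>2 - saddle_R q' (h * (1 + e))"
    by (rule order_tendstoD(1)[OF tendsto_diff[OF tendsto_const tq(1)[OF p(1)]] e(2)])
  moreover have "\<forall>\<^sub>F q' in nhds q. 0 < line_rate q' (h * (1 + e)) - k - line_rate q' h"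
    by (rule order_tendstoD(1)[OF tendsto_diff[OF tendsto_diff[OF tq(2)[OF p(1)] tendsto_const] tq(2)[OF h]]]) (use k in simp)
  moreover have "\<forall>\<^sub>F q' in nhds q. 0 < (1 + 3 * e) * line_rate q' (h * (1 + e)) - (1 + 2 * e) * line_rate q' (h * (1 + e)\<^sup>2) - e * \<rho>"
    by (rule order_tendstoD(1)[of _ "(1 + 3 * e) * line_rate q (h * (1 + e)) - (1 + 2 * e) * line_rate q (h * (1 + e)\<^sup>2) - e * \<rho>"])
      (intro tendsto_intros tq p, rule \<delta>2(2)[OF e(3,5)])
  moreover have "\<forall>\<^sub>F q' in nhds q. 0 < q'" using eventually_nhds_in_open[of "{0<..}" q] q by simp
  ultimately have "\<forall>\<^sub>F q' in nhds q. rate_witness e k \<rho> q'"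
  proof eventually_elim
    case (elim q')
    then show ?case by (intro rate_witness_saddle[of q' h e]) (use h e in auto)
  qed
  then show ?thesis using that e(3) k(1) by blast
qed

section \<open>Lower bounds away from the optimal pole\<close>

text \<open>sqrt 2 - 1 is the rate at the optimal pole. \<open>L\<close> and \<open>N\<close> are
  common to all of \<open>S\<close>, so the property survives finite unions.\<close>

definition exp_err_above :: "real set \<Rightarrow> bool" where
  "exp_err_above S \<longleftrightarrow> (\<exists>L>sqrt 2 - 1. \<exists>N. \<forall>n\<ge>N. \<forall>q\<in>S. q > 0 \<longrightarrow> L ^ n \<le> exp_err n (n * q))"

lemma sqrt2_bounds: "141421/100000 < sqrt (2::real)" "sqrt (2::real) < 141422/100000"
  by (rule real_less_rsqrt, simp add: power2_eq_square) (rule real_less_lsqrt, simp_all add: power2_eq_square)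

lemma exp_err_above_witness:
  assumes "e > 0" "k > 0" "sqrt 2 - 1 < exp \<rho>" "\<And>q. q \<in> S \<Longrightarrow> q > 0 \<Longrightarrow> rate_witness e k \<rho> q"
  shows "exp_err_above S"
proof -
  define L where "L = (sqrt 2 - 1 + exp \<rho>) / 2"
  have L: "sqrt 2 - 1 < L" "L < exp \<rho>" using assms by (auto simp: L_def)
  obtain N where "\<And>n q. n \<ge> N \<Longrightarrow> q > 0 \<Longrightarrow> rate_witness e k \<rho> q \<Longrightarrow> L ^ n \<le> exp_err n (n * q)"
    using exp_err_lower[OF assms(1,2) _ L(2)] L sqrt2_bounds by auto
  then show ?thesis unfolding exp_err_above_def using L assms(4) by blast
qed

lemma exp_err_above_subset: "exp_err_above T \<Longrightarrow> S \<subseteq> T \<Longrightarrow> exp_err_above S"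
  unfolding exp_err_above_def by (meson subsetD)

lemma exp_err_above_Un:
  assumes "exp_err_above S" "exp_err_above T"
  shows "exp_err_above (S \<union> T)"
proof -
  obtain L1 N1 where 1: "L1 > sqrt 2 - 1" "\<And>n q. n \<ge> N1 \<Longrightarrow> q \<in> S \<Longrightarrow> q > 0 \<Longrightarrow> L1 ^ n \<le> exp_err n (n * q)"
    using assms unfolding exp_err_above_def by blast
  obtain L2 N2 where 2: "L2 > sqrt 2 - 1" "\<And>n q. n \<ge> N2 \<Longrightarrow> q \<in> T \<Longrightarrow> q > 0 \<Longrightarrow> L2 ^ n \<le> exp_err n (n * q)"
    using assms unfolding exp_err_above_def by blast
  have "min L1 L2 ^ n \<le> exp_err n (n * q)" if "n \<ge> max N1 N2" "q \<in> S \<union> T" "q > 0" for n q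
  proof -
    have m: "min L1 L2 ^ n \<le> L1 ^ n" "min L1 L2 ^ n \<le> L2 ^ n"
      using 1 2 sqrt2_bounds by (auto intro!: power_mono)
    show ?thesis
    proof (cases "q \<in> S")
      case True
      have "L1 ^ n \<le> exp_err n (n * q)" by (rule 1(2)) (use True that in auto)
      then show ?thesis using m by linarith
    next
      case False
      have "L2 ^ n \<le> exp_err n (n * q)" by (rule 2(2)) (use False that in auto)
      then show ?thesis using m by linarith
    qed
  qed
  moreover have "min L1 L2 > sqrt 2 - 1" using 1 2 by simp
  ultimately show ?thesis unfolding exp_err_above_def by blast
qed

text \<open>A witness valid near a point gives the property on a neighbourhood; finitely many
  neighbourhoods cover \<open>K\<close>.\<close>

lemma exp_err_above_compact:
  assumes "compact K" "\<And>q. q \<in> K \<Longrightarrow> \<exists>e k \<rho>. e > 0 \<and> k > 0 \<and> sqrt 2 - 1 < exp \<rho> \<and> (\<forall>\<^sub>F q' in nhds q. rate_witness e k \<rho> q')"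
  shows "exp_err_above K"
proof -
  have "\<exists>U. open U \<and> q \<in> U \<and> exp_err_above U" if qK: "q \<in> K" for q
  proof -
    obtain e k \<rho> where w: "e > 0" "k > 0" "sqrt 2 - 1 < exp \<rho>" "\<forall>\<^sub>F q' in nhds q. rate_witness e k \<rho> q'"
      using assms(2)[OF qK] by blast
    then obtain U where "open U" "q \<in> U" "\<forall>q'\<in>U. rate_witness e k \<rho> q'"
      unfolding eventually_nhds by blast
    then show ?thesis using exp_err_above_witness[OF w(1-3), of U] by blast
  qed
  then obtain U where U: "\<And>q. q \<in> K \<Longrightarrow> open (U q) \<and> q \<in> U q \<and> exp_err_above (U q)" by metis
  have "\<And>q. q \<in> K \<Longrightarrow> open (U q)" "K \<subseteq> (\<Union>q\<in>K. U q)" using U by auto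
  from compactE_image[OF assms(1) this]
  obtain C where C: "C \<subseteq> K" "finite C" "K \<subseteq> (\<Union>q\<in>C. U q)" by metis
  have empty: "exp_err_above {}" unfolding exp_err_above_def
    by (intro exI[of _ "sqrt 2"] exI[of _ 0] conjI) auto
  have "exp_err_above (\<Union>q\<in>C'. U q)" if "finite C'" "C' \<subseteq> K" for C'
    using that
  proof (induction rule: finite_induct)
    case (insert q F)
    then have "exp_err_above (U q \<union> (\<Union>q\<in>F. U q))" using U by (intro exp_err_above_Un) auto
    then show ?case by simp
  qed (simp add: empty)
  from this[OF C(2,1)] show ?thesis using exp_err_above_subset[OF _ C(3)] by blast
qed

text \<open>
  For \<open>h = sqrt (1 / (50 q))\<close>, \<open>q \<rightarrow> 0\<close>, the Moebius factor of \<open>cw q\<close> at \<open>- \<i> h\<close> tends to \<open>1\<close>, so that only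
  the values of \<open>exp (q \<eta>\<^sup>2)\<close> matter.
\<close>

lemma exp_err_above_small: "exp_err_above {0<..<1 / 50 / 201\<^sup>2}"
proof (rule exp_err_above_witness[of 1 "(1/20)" "-(17/25)"])
  \<comment> \<open>Since q h^2 = 1/50, the heights h, 2 h, 4 h give b1 = 1/50, b = 4/50 - 1/100 and
    b2 = 16/50. Then b - b1 = 1/20 and 4 b - 3 b2 = - 17/25, which are the chosen \<open>k\<close>
    and \<rho>.\<close>
  have "(83/100::real) ^ 4 \<le> exp (- (17/100)) ^ 4"
    using exp_ge_add_one_self[of "- (17/100)"] by (intro power_mono) auto
  also have "\<dots> = exp (- (17/25) :: real)" by (simp add: exp_of_nat_mult[symmetric])
  finally have "exp (- (17/25) :: real) \<ge> (83/100) ^ 4" .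
  moreover have "(83/100::real) ^ 4 > 47/100" by (simp add: power_numeral_reduce)
  ultimately show "sqrt 2 - 1 < exp (- (17/25) :: real)" using sqrt2_bounds by linarith
  fix q :: real assume q: "q > 0" "q \<in> {0<..<1 / 50 / 201\<^sup>2}"
  define h where "h = sqrt ((1/50) / q)"
  have h2: "h\<^sup>2 = (1/50) / q" using q by (simp add: h_def)
  have "201\<^sup>2 \<le> (1/50) / q" using q by (simp add: field_simps)
  then have h: "h \<ge> 201" unfolding h_def by (rule real_le_rsqrt)
  have qh: "q * h\<^sup>2 = (1/50)" using q by (simp add: h2)
  have le: "cmod (cw q (Complex x (- \<eta>))) \<le> exp (q * \<eta>\<^sup>2)" if "\<eta> \<ge> 0" for x \<eta>
  proof -
    have "cmod (cw q (Complex x (- \<eta>))) \<le> exp (- q * (x\<^sup>2 - \<eta>\<^sup>2))"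
      using norm_cw_le[of "Complex x (- \<eta>)" q] that by simp
    also have "\<dots> \<le> exp (q * \<eta>\<^sup>2)" using q by (simp add: algebra_simps)
    finally show ?thesis .
  qed
  \<comment> \<open>As h >= 201, the Moebius factor is at least 100/101 >= exp(- 1/100); this
    accounts for the 1/100 lost from 8/100.\<close>
  have lb: "exp (7/100) \<le> cmod (cw q (Complex 0 (- (h * (1 + 1)))))"
  proof -
    have "(101/100::real) \<le> exp (1/100)" using exp_ge_add_one_self[of "1/100"] by simp
    then have "exp (- (1/100) :: real) \<le> 1 / (101/100)" unfolding exp_minus by (simp add: inverse_eq_divide divide_simps)
    also have "\<dots> \<le> (2 * h - 1) / (1 + 2 * h)" using h by (simp add: divide_simps)
    also have "\<dots> = \<bar>1 - 2 * h\<bar> / (1 + 2 * h)" using h by simp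
    finally have "exp (q * (2 * h)\<^sup>2) * exp (- (1/100)) \<le> exp (q * (2 * h)\<^sup>2) * (\<bar>1 - 2 * h\<bar> / (1 + 2 * h))"
      by (intro mult_left_mono) auto
    also have "exp (q * (2 * h)\<^sup>2) * exp (- (1/100)) = exp (7/100)"
      using qh by (simp add: exp_add[symmetric] power_mult_distrib)
    finally show ?thesis using norm_cw_axis[of "2 * h" q] h by (simp add: mult.commute)
  qed
  have b1: "cmod (cw q (Complex x (- h))) \<le> exp (1/50)" for x
    using le[of h x] h by (simp add: qh)
  have b2: "cmod (cw q (Complex x (- (h * (1 + 1)\<^sup>2)))) \<le> exp (8/25)" for x
  proof -
    have "q * (h * (1 + 1)\<^sup>2)\<^sup>2 = 16 * (q * h\<^sup>2)" by (simp add: power_mult_distrib)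
    then have "q * (h * (1 + 1)\<^sup>2)\<^sup>2 = 8/25" by (simp add: qh)
    moreover have "0 \<le> h * (1 + 1)\<^sup>2" using h by simp
    ultimately show ?thesis using le by metis
  qed
  show "rate_witness 1 (1/20) (- (17/25)) q"
    unfolding rate_witness_def
  proof (intro exI conjI allI)
    show "exp (7/100) \<le> cmod (cw q (Complex 0 (- (h * (1 + 1)))))" by (rule lb)
    show "cmod (cw q (Complex x (- h))) \<le> exp (1/50)" for x by (rule b1)
    show "cmod (cw q (Complex x (- (h * (1 + 1)\<^sup>2)))) \<le> exp (8/25)" for x by (rule b2)
  qed (use h in auto)
qed auto

text \<open>
  Parametrization by \<open>u\<close> of the pole location for which the critical points lie on \<open>Im s = - u\<close>; for
  \<open>u \<ge> 1 / sqrt 3\<close> the critical points have nonnegative \<open>x\<^sup>2\<close>.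
\<close>

definition saddle_q :: "real \<Rightarrow> real" where
  "saddle_q u = 1 / (2 * u * (4 * u\<^sup>2 - 1))"

definition saddle_rate :: "real \<Rightarrow> real" where
  "saddle_rate u = (1 - 2 * u\<^sup>2) * saddle_q u + ln ((2 * u - 1) / (2 * u + 1)) / 2"

section \<open>The rate at the saddle points\<close>

lemma four_u2_gt_1: "u > 1 / 2 \<Longrightarrow> 4 * u\<^sup>2 - 1 > (0::real)"
  using power_strict_mono[of "1 / 2" u 2] by (simp add: power2_eq_square)

lemma saddle_q_pos: "u > 1 / 2 \<Longrightarrow> saddle_q u > 0"
  using four_u2_gt_1[of u] by (simp add: saddle_q_def)

lemma inverse_saddle_q: "u > 1 / 2 \<Longrightarrow> 1 / saddle_q u = 2 * u * (4 * u\<^sup>2 - 1)"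
  by (simp add: saddle_q_def)

lemma saddle_R_saddle:
  assumes "u > 1 / 2"
  shows "saddle_R (saddle_q u) u = 4 * u\<^sup>2"
proof -
  have "4 * u\<^sup>2 + 2 * u / saddle_q u = 4 * u\<^sup>2 + 2 * u * (1 / saddle_q u)" by simp
  also have "\<dots> = (4 * u\<^sup>2)\<^sup>2"
    unfolding inverse_saddle_q[OF assms] by (simp add: power2_eq_square algebra_simps)
  finally show ?thesis unfolding saddle_R_def by (simp only: real_sqrt_abs) simp
qed

lemma line_rate_saddle:
  assumes "u > 1 / 2"
  shows "line_rate (saddle_q u) u = saddle_rate u"
proof -
  have "(4 * u\<^sup>2 - 2 * u) / (4 * u\<^sup>2 + 2 * u) = (2 * u - 1) * (2 * u) / ((2 * u + 1) * (2 * u))"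
    by (simp add: power2_eq_square algebra_simps)
  also have "\<dots> = (2 * u - 1) / (2 * u + 1)" using assms by simp
  finally have "(4 * u\<^sup>2 - 2 * u) / (4 * u\<^sup>2 + 2 * u) = (2 * u - 1) / (2 * u + 1)" .
  then show ?thesis
    unfolding line_rate_def saddle_R_saddle[OF assms] saddle_rate_def by (simp add: algebra_simps)
qed

lemma DERIV_saddle_q:
  assumes "u > 1 / 2"
  shows "(saddle_q has_real_derivative - (24 * u\<^sup>2 - 2) * (saddle_q u)\<^sup>2) (at u)"
proof -
  have nz: "2 * u * (4 * u\<^sup>2 - 1) \<noteq> 0" using assms four_u2_gt_1[OF assms] by simp
  show ?thesis
    unfolding saddle_q_def[abs_def] using nz
    by (auto intro!: derivative_eq_intros simp: power2_eq_square divide_simps)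
qed

text \<open>The logarithm of |cw q| is stationary at a saddle point \<open>s\<close>, so only the
  explicit dependence on \<open>q\<close> contributes: its derivative is - Re (s^2) = 1 - 2 u^2,
  because (Re s)^2 = 3 u^2 - 1 there.\<close>

lemma DERIV_saddle_rate:
  assumes u: "u > 1 / 2"
  shows "(saddle_rate has_real_derivative (1 - 2 * u\<^sup>2) * (- (24 * u\<^sup>2 - 2) * (saddle_q u)\<^sup>2)) (at u)"
proof -
  have p: "2 * u - 1 > 0" "2 * u + 1 > 0" using u by auto
  have "(saddle_rate has_real_derivative (1 - 2 * u\<^sup>2) * (- (24 * u\<^sup>2 - 2) * (saddle_q u)\<^sup>2)
     + (- 4 * u * saddle_q u + (2 / (2 * u - 1) - 2 / (2 * u + 1)) / 2)) (at u)"
  proof -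
    have dl: "((\<lambda>u. ln ((2 * u - 1) / (2 * u + 1))) has_real_derivative 2 / (2 * u - 1) - 2 / (2 * u + 1)) (at u)"
      using p by (auto intro!: derivative_eq_intros simp: divide_simps)
    have dp: "((\<lambda>u. 1 - 2 * u\<^sup>2) has_real_derivative - 4 * u) (at u)"
      by (auto intro!: derivative_eq_intros)
    show ?thesis unfolding saddle_rate_def[abs_def]
      by (rule DERIV_cong[OF DERIV_add[OF DERIV_mult[OF dp DERIV_saddle_q[OF u]] DERIV_cdivide[OF dl]]])
        (simp add: algebra_simps)
  qed
  also have "- 4 * u * saddle_q u + (2 / (2 * u - 1) - 2 / (2 * u + 1)) / 2 = 0"
  proof -
    have "4 * u * saddle_q u = 2 / (4 * u\<^sup>2 - 1)"
      using u four_u2_gt_1[OF u] unfolding saddle_q_def by (simp add: divide_simps)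
    also have "4 * u\<^sup>2 - 1 = (2 * u - 1) * (2 * u + 1)" by (simp add: power2_eq_square algebra_simps)
    finally show ?thesis using p by (simp add: divide_simps)
  qed
  finally show ?thesis by simp
qed

lemma saddle_rate_sqrt_half: "saddle_rate (1 / sqrt 2) = ln (sqrt 2 - 1)" "saddle_q (1 / sqrt 2) = 1 / sqrt 2"
proof -
  define s where "s = sqrt (2::real)"
  have s: "s * s = 2" "s > 1" using sqrt2_bounds by (auto simp: s_def)
  have u: "2 * (1 / s) = s" "(1 / s)\<^sup>2 = 1 / 2" using s by (auto simp: power2_eq_square field_simps)
  have "(s - 1) / (s + 1) = (s - 1)\<^sup>2" using s by (simp add: power2_eq_square field_simps)
  then have "saddle_rate (1 / s) = ln ((s - 1)\<^sup>2) / 2" unfolding saddle_rate_def u by simp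
  also have "\<dots> = ln (s - 1)" using s by (simp add: ln_realpow)
  finally show "saddle_rate (1 / sqrt 2) = ln (sqrt 2 - 1)" by (simp add: s_def)
  show "saddle_q (1 / sqrt 2) = 1 / sqrt 2" unfolding saddle_q_def s_def[symmetric] u by (simp add: s_def)
qed

lemma saddle_rate_min:
  assumes "u > 1 / 2" "u \<noteq> 1 / sqrt 2"
  shows "ln (sqrt 2 - 1) < saddle_rate u"
proof -
  define s where "s = 1 / sqrt (2::real)"
  have s: "s\<^sup>2 = 1 / 2" "s > 0" by (auto simp: s_def power_divide)
  have s1: "s > 1 / 2" unfolding s_def using sqrt2_bounds by (simp add: divide_simps)
  have cont: "continuous_on {a..b} saddle_rate" if "a > 1 / 2" for a b
    using that by (intro DERIV_continuous_on[OF DERIV_subset[OF DERIV_saddle_rate]]) auto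
  have neg: "- (24 * x\<^sup>2 - 2) * (saddle_q x)\<^sup>2 < 0" if "x > 1 / 2" for x
  proof -
    have "24 * x\<^sup>2 - 2 > 0" using four_u2_gt_1[OF that] by linarith
    then show ?thesis using saddle_q_pos[OF that] by (intro mult_neg_pos) auto
  qed
  show ?thesis
  proof (cases "u < s")
    case True
    have "saddle_rate s < saddle_rate u"
    proof (rule DERIV_neg_imp_decreasing_open[OF True])
      fix x assume x: "u < x" "x < s"
      then have "x\<^sup>2 < s\<^sup>2" using assms by (intro power_strict_mono) auto
      then have "1 - 2 * x\<^sup>2 > 0" using s by simp
      then show "\<exists>y. (saddle_rate has_real_derivative y) (at x) \<and> y < 0"
        using DERIV_saddle_rate[of x] neg[of x] x assms by (meson less_trans mult_pos_neg)
    qed (use cont assms in auto)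
    then show ?thesis using saddle_rate_sqrt_half by (simp add: s_def)
  next
    case False
    then have "s < u" using assms by (simp add: s_def)
    then have "saddle_rate s < saddle_rate u"
    proof (rule DERIV_pos_imp_increasing_open)
      fix x assume x: "s < x" "x < u"
      then have "s\<^sup>2 < x\<^sup>2" using s by (intro power_strict_mono) auto
      then have "1 - 2 * x\<^sup>2 < 0" using s by simp
      then show "\<exists>y. (saddle_rate has_real_derivative y) (at x) \<and> y > 0"
        using DERIV_saddle_rate[of x] neg[of x] x s1 by (meson less_trans mult_neg_neg)
    qed (use cont s1 in auto)
    then show ?thesis using saddle_rate_sqrt_half by (simp add: s_def)
  qed
qed

text \<open>3/5 exceeds 1 / sqrt 3, so the saddle points stay strictly off the imaginary axis, and
  \<open>saddle_q (3/5)\<close> = 1 / 0.528 exceeds 1.85.\<close>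

lemma saddle_q_surj:
  assumes "0 < q" "q \<le> 185/100"
  obtains u where "u \<ge> 3/5" "saddle_q u = q"
proof -
  define X where "X = 3/5 + 2 / q"
  have X: "X \<ge> 3/5" "X \<ge> 2 / q" using assms by (auto simp: X_def)
  then have "X\<^sup>2 \<ge> (3/5)\<^sup>2" by (intro power_mono) auto
  then have "4 * X\<^sup>2 - 1 \<ge> 1/4" by (simp add: power2_eq_square)
  then have "2 * X * (4 * X\<^sup>2 - 1) \<ge> 2 * X * (1/4)" using X by (intro mult_left_mono) auto
  moreover have "1 / q \<le> 2 * X * (1/4)" using X(2) by simp
  ultimately have "1 / q \<le> 2 * X * (4 * X\<^sup>2 - 1)" by linarith
  moreover have "2 * (3/5) * (4 * (3/5)\<^sup>2 - 1) \<le> 1 / q" using assms by (simp add: power2_eq_square divide_simps)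
  moreover have "continuous_on {3/5..X} (\<lambda>u. 2 * u * (4 * u\<^sup>2 - 1))" by (intro continuous_intros)
  ultimately have "\<exists>u. 3/5 \<le> u \<and> u \<le> X \<and> 2 * u * (4 * u\<^sup>2 - 1) = 1 / q"
    using X(1) by (intro IVT')
  then obtain u where u: "3/5 \<le> u" "2 * u * (4 * u\<^sup>2 - 1) = 1 / q" by blast
  show ?thesis by (rule that[OF u(1)]) (simp add: saddle_q_def u(2))
qed

text \<open>On the saddle line h = u the derivative of \<open>line_rate q\<close> vanishes and
  leaves no gap between neighbouring lines. A slightly larger \<open>h\<close> makes it positive,
  and the attainable rate tends to \<open>saddle_rate u\<close> as \<open>h\<close> tends to
  \<open>u\<close>.\<close>

lemma local_witness_saddle:
  assumes q: "0 < q" "q \<le> 185/100" "q \<noteq> 1 / sqrt 2"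
  obtains e k \<rho> where "e > 0" "k > 0" "sqrt 2 - 1 < exp \<rho>" "\<forall>\<^sub>F q' in nhds q. rate_witness e k \<rho> q'"
proof -
  obtain u where u: "u \<ge> 3/5" "saddle_q u = q" using saddle_q_surj[OF q(1,2)] .
  have u12: "u > 1/2" using u by linarith
  have "u \<noteq> 1 / sqrt 2" using saddle_rate_sqrt_half(2) u(2) q(3) by auto
  then have rate: "ln (sqrt 2 - 1) < saddle_rate u" using saddle_rate_min[OF u12] by blast
  define \<rho> where "\<rho> = (ln (sqrt 2 - 1) + saddle_rate u) / 2"
  have \<rho>: "ln (sqrt 2 - 1) < \<rho>" "\<rho> < saddle_rate u" using rate by (auto simp: \<rho>_def)
  have e\<rho>: "sqrt 2 - 1 < exp \<rho>"
  proof -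
    have "exp (ln (sqrt 2 - 1)) < exp \<rho>" using \<rho> by (simp only: exp_less_cancel_iff)
    moreover have "exp (ln (sqrt 2 - 1)) = sqrt (2::real) - 1" by (rule exp_ln) (use sqrt2_bounds in simp)
    ultimately show ?thesis by simp
  qed
  have Ru: "saddle_R q u = 4 * u\<^sup>2" and Lu: "line_rate q u = saddle_rate u"
    using saddle_R_saddle[OF u12] line_rate_saddle[OF u12] u(2) by auto
  have cR: "(saddle_R q \<longlongrightarrow> saddle_R q u) (at_right u)" and cL: "(line_rate q \<longlongrightarrow> line_rate q u) (at_right u)"
    using continuous_line_rate(3)[of q u] DERIV_isCont[OF DERIV_line_rate[of q u]] q u12
    by (auto simp: isCont_def intro: tendsto_within_subset)
  have "((\<lambda>h. line_rate q h - q * (4 * h\<^sup>2 - saddle_R q h)) \<longlongrightarrow> line_rate q u - q * (4 * u\<^sup>2 - saddle_R q u)) (at_right u)"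
    by (intro tendsto_intros cR cL)
  then have "\<forall>\<^sub>F h in at_right u. \<rho> < line_rate q h - q * (4 * h\<^sup>2 - saddle_R q h)"
    by (rule order_tendstoD) (simp add: Ru Lu \<rho>)
  moreover have "((\<lambda>h. saddle_R q h - (1 + h\<^sup>2)) \<longlongrightarrow> saddle_R q u - (1 + u\<^sup>2)) (at_right u)"
    by (intro tendsto_intros cR)
  then have "\<forall>\<^sub>F h in at_right u. 0 < saddle_R q h - (1 + h\<^sup>2)"
  proof (rule order_tendstoD)
    have "u\<^sup>2 \<ge> (3/5)\<^sup>2" using u by (intro power_mono) auto
    then show "0 < saddle_R q u - (1 + u\<^sup>2)" by (simp add: Ru power2_eq_square)
  qed
  moreover have "\<forall>\<^sub>F h in at_right u. u < h" by (rule eventually_at_right_less)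
  ultimately have "\<forall>\<^sub>F h in at_right u. \<rho> < line_rate q h - q * (4 * h\<^sup>2 - saddle_R q h) \<and> 0 < saddle_R q h - (1 + h\<^sup>2) \<and> u < h"
    by eventually_elim auto
  from eventually_happens[OF this] obtain h where h: "\<rho> < line_rate q h - q * (4 * h\<^sup>2 - saddle_R q h)"
    "0 < saddle_R q h - (1 + h\<^sup>2)" "u < h" by auto
  have "saddle_R q h < 4 * h\<^sup>2"
  proof -
    have uh: "4 * u\<^sup>2 - 1 < 4 * h\<^sup>2 - 1" using h u12 by (simp add: power_strict_mono)
    have "2 * u * (4 * u\<^sup>2 - 1) < 2 * h * (4 * h\<^sup>2 - 1)"
      by (rule mult_strict_mono) (use uh h(3) u12 four_u2_gt_1[OF u12] in linarith)+
    then have "1 / q < 2 * h * (4 * h\<^sup>2 - 1)" using inverse_saddle_q[OF u12] u by simp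
    then have "2 * h * (1 / q) < 2 * h * (2 * h * (4 * h\<^sup>2 - 1))" using h u12 by (intro mult_strict_left_mono) auto
    then have "4 * h\<^sup>2 + 2 * h / q < (4 * h\<^sup>2)\<^sup>2" by (simp add: power2_eq_square algebra_simps)
    then show ?thesis unfolding saddle_R_def by (intro real_less_lsqrt) auto
  qed
  with h q u12 obtain e k where "e > 0" "k > 0" "\<forall>\<^sub>F q' in nhds q. rate_witness e k \<rho> q'"
    by (elim rate_witness_local[of q h \<rho>, rotated 4]) auto
  then show ?thesis using that e\<rho> by blast
qed

text \<open>Beyond q = 3 sqrt 3 / 2 the saddle points lie on the imaginary axis. The line h = 63/100
  has real critical points and an increasing rate throughout this range, and its rate, though not
  optimal, still exceeds that of sqrt 2 - 1.\<close>

lemma local_witness_middle: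
  assumes q: "18/10 \<le> q" "q \<le> 33/10"
  obtains e k \<rho> where "e > 0" "k > 0" "sqrt 2 - 1 < exp \<rho>" "\<forall>\<^sub>F q' in nhds q. rate_witness e k \<rho> q'"
proof -
  define h :: real where "h = 63/100"
  define R where "R = saddle_R q h"
  have q0: "q > 0" and h0: "h > 0" using q by (auto simp: h_def)
  note R = saddle_R[OF q0 h0, folded R_def]
  have R2: "R\<^sup>2 = 15876/10000 + 126/100 / q" unfolding R(2) by (simp add: h_def power2_eq_square)
  have iq: "10/33 \<le> 1 / q" "1 / q \<le> 10/18" using q by (auto simp: divide_simps)
  have R1: "1 + h\<^sup>2 < R"
  proof (rule power2_less_imp_less)
    show "(1 + h\<^sup>2)\<^sup>2 < R\<^sup>2" unfolding R2 using iq by (simp add: h_def power2_eq_square)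
  qed (use R h0 in auto)
  have Rup: "R < 15125/10000"
  proof (rule power2_less_imp_less)
    show "R\<^sup>2 < (15125/10000)\<^sup>2" unfolding R2 using iq by (simp add: power2_eq_square)
  qed auto
  have R4: "R < 4 * h\<^sup>2" using Rup by (simp add: h_def power2_eq_square)
  define w where "w = line_rate q h - q * (4 * h\<^sup>2 - R)"
  have "sqrt 2 - 1 < exp w"
  proof (rule power2_less_imp_less)
    have P: "R - 2 * h > 0" "R + 2 * h > 0" using R h0 by auto
    have "w = q * (1 - 2 * h\<^sup>2) + ln ((R - 2 * h) / (R + 2 * h)) / 2"
      unfolding w_def line_rate_def R_def[symmetric] by (simp add: algebra_simps)
    then have "2 * w = 2 * (q * (1 - 2 * h\<^sup>2)) + ln ((R - 2 * h) / (R + 2 * h))" by simp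
    moreover have "(exp w)\<^sup>2 = exp (2 * w)" by (simp add: power2_eq_square exp_add[symmetric])
    ultimately have "(exp w)\<^sup>2 = exp (2 * (q * (1 - 2 * h\<^sup>2))) * ((R - 2 * h) / (R + 2 * h))"
      using P by (simp only: exp_add) simp
    also have "(R - 2 * h) / (R + 2 * h) = q * ((R + 2 * h) * (R - 2 * h)) / (q * (R + 2 * h)\<^sup>2)"
      using P q0 by (simp add: power2_eq_square)
    also have "\<dots> = 2 * h / (q * (R + 2 * h)\<^sup>2)" by (simp only: R(3))
    finally have 1: "(exp w)\<^sup>2 = exp (2 * (q * (1 - 2 * h\<^sup>2))) * (2 * h / (q * (R + 2 * h)\<^sup>2))" .
    have "(17/16::real) ^ 16 \<le> exp (1/16) ^ 16"
      using exp_ge_add_one_self[of "1/16"] by (intro power_mono) auto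
    also have "\<dots> = exp (1::real)" by (simp add: exp_of_nat_mult[symmetric])
    finally have e: "exp (1::real) \<ge> 26/10" by (simp add: power_numeral_reduce)
    \<comment> \<open>\<open>x\<close> is proportional to \<open>q\<close>, so exp x >= 2.6 x
      cancels the \<open>q\<close> in the denominator, and \<open>q\<close> remains only inside
      \<open>R\<close>.\<close>
    define x where "x = 2 * (q * (1 - 2 * h\<^sup>2))"
    have x: "x = 4124/10000 * q" by (simp add: x_def h_def power2_eq_square)
    have "exp x = exp 1 * exp (x - 1)" by (simp add: exp_add[symmetric])
    moreover have "exp (x - 1) \<ge> x" using exp_ge_add_one_self[of "x - 1"] by simp
    ultimately have ex: "exp x \<ge> 26/10 * x" using e x q0 by (simp only:) (intro mult_mono; simp)
    have R2h: "(R + 2 * h)\<^sup>2 \<le> (27725/10000)\<^sup>2" using Rup P by (intro power_mono) (auto simp: h_def)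
    have "(sqrt 2 - 1)\<^sup>2 = 3 - 2 * sqrt 2" by (simp add: power2_eq_square algebra_simps)
    also have "\<dots> < 17158/100000" using sqrt2_bounds by simp
    also have "\<dots> \<le> 26/10 * (4124/10000) * (126/100) / (27725/10000)\<^sup>2" by (simp add: power2_eq_square)
    also have "\<dots> \<le> 26/10 * (4124/10000) * (126/100) / (R + 2 * h)\<^sup>2"
      using R2h P by (intro divide_left_mono) auto
    also have "\<dots> = 26/10 * x * (2 * h / (q * (R + 2 * h)\<^sup>2))" using q0 by (simp add: x h_def)
    also have "\<dots> \<le> (exp w)\<^sup>2" unfolding 1 x_def[symmetric] using ex q0 h0 by (intro mult_right_mono) auto
    finally show "(sqrt 2 - 1)\<^sup>2 < (exp w)\<^sup>2" .
  qed simp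
  moreover define m where "m = (sqrt 2 - 1 + exp w) / 2"
  moreover have "2 * m = sqrt 2 - 1 + exp w" by (simp add: m_def)
  ultimately have w: "0 < m" "sqrt 2 - 1 < m" "m < exp w" using sqrt2_bounds(1) by linarith+
  define \<rho> where "\<rho> = ln m"
  have e\<rho>: "exp \<rho> = m" unfolding \<rho>_def using w(1) by (rule exp_ln)
  then have "exp \<rho> < exp w" using w by linarith
  then have "\<rho> < line_rate q h - q * (4 * h\<^sup>2 - saddle_R q h)" by (simp add: w_def R_def)
  from rate_witness_local[OF q0 h0 R1[unfolded R_def] R4[unfolded R_def] this]
  obtain e k where "e > 0" "k > 0" "\<forall>\<^sub>F q' in nhds q. rate_witness e k \<rho> q'" .
  then show ?thesis using that[of e k \<rho>] e\<rho> w(2) by simp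
qed

text \<open>
  On the axis, \<open>\<bar>cw q\<bar>\<close> has logarithm \<open>q \<eta>\<^sup>2 + axis_log \<eta>\<close>, and the first summand equals \<open>3 / 5\<close> at
  \<open>\<eta> = h\<close> for the choice of \<open>h\<close> below.
\<close>

definition axis_log :: "real \<Rightarrow> real" where
  "axis_log x = ln ((1 - x) / (1 + x))"

text \<open>\<open>axis_log\<close> is concave on [0, 1) and vanishes at 0.\<close>

lemma axis_log_scale:
  assumes "0 < x" "1 \<le> c" "c * x < 1"
  shows "axis_log (c * x) \<le> c * axis_log x"
proof -
  have "(\<lambda>t. c * axis_log t - axis_log (c * t)) 0 \<le> (\<lambda>t. c * axis_log t - axis_log (c * t)) x"
  proof (rule DERIV_nonneg_imp_nondecreasing[where f="\<lambda>t. c * axis_log t - axis_log (c * t)" and a=0 and b=x])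
    fix t assume t: "0 \<le> t" "t \<le> x"
    have ct: "c * t \<le> c * x" "t \<le> c * t" using t assms mult_right_mono[of 1 c t] by (auto intro: mult_left_mono)
    then have p: "1 - t > 0" "1 + t > 0" "1 - c * t > 0" "1 + c * t > 0" using t assms by linarith+
    have d: "(axis_log has_real_derivative - 2 / ((1 - t) * (1 + t))) (at t)" if "1 - t > 0" "1 + t > 0" for t
      unfolding axis_log_def[abs_def] using that
      by (auto intro!: derivative_eq_intros simp: divide_simps)
    have dc: "((\<lambda>t. axis_log (c * t)) has_real_derivative - 2 / ((1 - c * t) * (1 + c * t)) * c) (at t)"
      by (rule DERIV_chain2[where f=axis_log and g="\<lambda>t. c * t", OF d[OF p(3,4)]]) (auto intro!: derivative_eq_intros)
    have D: "((\<lambda>t. c * axis_log t - axis_log (c * t)) has_real_derivative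
        c * (- 2 / ((1 - t) * (1 + t))) - - 2 / ((1 - c * t) * (1 + c * t)) * c) (at t)"
      by (intro DERIV_diff DERIV_cmult d p dc)
    have "2 / ((1 - t) * (1 + t)) \<le> 2 / ((1 - c * t) * (1 + c * t))"
    proof (rule divide_left_mono)
      have "t * t \<le> (c * t) * (c * t)" using ct t by (intro mult_mono) auto
      then show "(1 - c * t) * (1 + c * t) \<le> (1 - t) * (1 + t)" by (simp add: algebra_simps)
    qed (use p in auto)
    then have "c * (2 / ((1 - t) * (1 + t))) \<le> c * (2 / ((1 - c * t) * (1 + c * t)))" using assms by (intro mult_left_mono) auto
    then show "\<exists>y. ((\<lambda>t. c * axis_log t - axis_log (c * t)) has_real_derivative y) (at t) \<and> 0 \<le> y"
      using D by (intro exI[of _ "c * (- 2 / ((1 - t) * (1 + t))) - - 2 / ((1 - c * t) * (1 + c * t)) * c"]) (simp add: mult.commute)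
  qed (use assms in auto)
  then show ?thesis by (simp add: axis_log_def)
qed

lemma exp_err_above_large: "exp_err_above {33/10..}"
proof (rule exp_err_above_witness[of "1/20" "1/200" "- (21/25)"])
  \<comment> \<open>For e = 1/20 and q h^2 = 3/5 the part of 1.15 b - 1.1 b2 without logarithms is
    about - 0.0415, above e \<rho> = - 0.042. The logarithms contribute at least - 0.005 l1 >= 0, by
    \<open>axis_log_scale\<close> with factor 21/20.\<close>
  have "(379/400::real) ^ 16 \<le> exp (- (21/400)) ^ 16"
    using exp_ge_add_one_self[of "- (21/400)"] by (intro power_mono) auto
  also have "\<dots> = exp (- (21/25) :: real)" by (simp add: exp_of_nat_mult[symmetric])
  finally have "exp (- (21/25) :: real) \<ge> (379/400) ^ 16" .
  moreover have "(379/400::real) ^ 16 > 42/100" by (simp add: power_numeral_reduce)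
  ultimately show "sqrt 2 - 1 < exp (- (21/25) :: real)" using sqrt2_bounds by linarith
  fix q :: real assume "q > 0" "q \<in> {33/10..}"
  then have q: "q \<ge> 33/10" by simp
  define h where "h = sqrt ((3/5) / q)"
  have h2: "h\<^sup>2 = (3/5) / q" using q by (simp add: h_def)
  have qh: "q * h\<^sup>2 = 3/5" using q by (simp add: h2)
  have h0: "h > 0" using q by (simp add: h_def)
  have "h\<^sup>2 < (427/1000)\<^sup>2" unfolding h2 using q by (simp add: power2_eq_square divide_simps)
  then have h1: "h < 427/1000" by (rule power2_less_imp_less) simp
  have iq: "1 / q = h\<^sup>2 * (5/3)" by (simp add: h2)
  have up: "cmod (cw q (Complex x (- (c * h)))) \<le> exp (c\<^sup>2 * (3/5) + axis_log (c * h))" if "1 \<le> c" "c \<le> 441/400" for x c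
  proof -
    have ch: "0 < c * h" "c * h < 48/100"
      using that h0 h1 mult_mono[of c "441/400" h "427/1000"] by auto
    have "2 * (c * h) / q \<le> (1 - (c * h)\<^sup>2)\<^sup>2"
    proof -
      have "(c * h)\<^sup>2 \<le> (48/100)\<^sup>2" using ch by (intro power_mono) auto
      then have "(1 - (48/100)\<^sup>2)\<^sup>2 \<le> (1 - (c * h)\<^sup>2)\<^sup>2" by (intro power_mono) (auto simp: power2_eq_square)
      moreover have "2 * (c * h) * (1 / q) \<le> 2 * (48/100) * (10/33)"
        using ch q by (intro mult_mono) (auto simp: divide_simps)
      ultimately show ?thesis by (simp add: power2_eq_square)
    qed
    then have "cmod (cw q (Complex x (- (c * h)))) \<le> exp (q * (c * h)\<^sup>2 + axis_log (c * h))"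
      unfolding axis_log_def using ch q by (intro norm_cw_le_axis) auto
    also have "q * (c * h)\<^sup>2 = c\<^sup>2 * (q * h\<^sup>2)" by (simp add: power_mult_distrib)
    finally show ?thesis by (simp add: qh)
  qed
  define l0 l1 l2 where "l0 = axis_log h" and "l1 = axis_log (21/20 * h)" and "l2 = axis_log (441/400 * h)"
  define b where "b = (21/20)\<^sup>2 * (3/5) + l1"
  have "l2 \<le> 21/20 * l1"
    using axis_log_scale[of "21/20 * h" "21/20"] h0 h1 by (simp add: l1_def l2_def)
  moreover have l1: "l1 \<le> 0" unfolding l1_def axis_log_def using h0 h1 by (simp add: divide_le_eq)
  ultimately have rate: "1/20 * (- (21/25)) \<le> (1 + 3 * (1/20)) * b - (1 + 2 * (1/20)) * ((441/400)\<^sup>2 * (3/5) + l2)"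
    unfolding b_def by (simp add: power2_eq_square add_divide_distrib distrib_left)
  \<comment> \<open>The quadratic part gains 3/5 (1.1025 - 1) = 0.0615 and the logarithm loses at
    most 0.0565; the difference is 1/200.\<close>
  have gap: "1\<^sup>2 * (3/5) + l0 \<le> b - 1/200"
  proof -
    define g where "g = 21/20 * h"
    have g: "0 < g" "g < 1" "0 < 1 - h" using h0 h1 by (auto simp: g_def)
    have "l0 - l1 = ln (((1 - h) / (1 + h)) / ((1 - g) / (1 + g)))"
      unfolding l0_def l1_def axis_log_def g_def[symmetric] using g h0 by (intro ln_divide_pos[symmetric]) auto
    also have "\<dots> \<le> ((1 - h) / (1 + h)) / ((1 - g) / (1 + g)) - 1"
      using g h0 by (intro ln_le_minus_one) auto
    also have "\<dots> = 2 * (g - h) / ((1 + h) * (1 - g))" using g h0 by (simp add: divide_simps) (simp add: algebra_simps)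
    also have "\<dots> \<le> 565/10000"
    proof -
      have "0 \<le> (427/1000 - h) * (h + 2)" using h0 h1 by (intro mult_nonneg_nonneg) auto
      then have "2 * (g - h) \<le> 565/10000 * ((1 + h) * (1 - g))"
        using h1 by (simp add: g_def algebra_simps add_divide_distrib)
      then show ?thesis using g h0 by (simp add: divide_le_eq)
    qed
    finally show ?thesis unfolding b_def by (simp add: power2_eq_square)
  qed
  show "rate_witness (1/20) (1/200) (- (21/25)) q"
    unfolding rate_witness_def
  proof (intro exI conjI allI)
    show "\<bar>0\<bar> \<le> 2 * h * (1 + 1/20)" using h0 by simp
    show "exp b \<le> cmod (cw q (Complex 0 (- (h * (1 + 1/20)))))"
    proof -
      define g where "g = 21/20 * h"
      have g: "0 < g" "g < 1" using h0 h1 by (auto simp: g_def)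
      have "exp b = exp (q * g\<^sup>2) * ((1 - g) / (1 + g))"
      proof -
        have "q * g\<^sup>2 = (21/20)\<^sup>2 * (q * h\<^sup>2)" by (simp only: g_def power_mult_distrib mult_ac)
        then have "b = q * g\<^sup>2 + axis_log g" unfolding qh b_def l1_def g_def by simp
        then show ?thesis using g by (simp add: exp_add axis_log_def)
      qed
      also have "\<dots> = cmod (cw q (Complex 0 (- g)))" using norm_cw_axis[of g q] g by simp
      finally show ?thesis by (simp add: g_def mult.commute)
    qed
    show "cmod (cw q (Complex x (- h))) \<le> exp (1\<^sup>2 * (3/5) + l0)" for x using up[of 1 x] by (simp add: l0_def)
    have "h * (1 + 1/20)\<^sup>2 = 441/400 * h" by (simp add: power2_eq_square)
    then show "cmod (cw q (Complex x (- (h * (1 + 1/20)\<^sup>2)))) \<le> exp ((441/400)\<^sup>2 * (3/5) + l2)" for x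
      using up[of "441/400" x] unfolding l2_def by (simp only:)
  qed (use h0 gap rate in auto)
qed auto

text \<open>The two unbounded ends of the logarithmic scale of \<open>q\<close> have uniform
  witnesses; the rest, without a neighbourhood of the optimum, is compact and is treated by saddle
  lines up to 1.85 and the fixed line beyond.\<close>

theorem exp_err_above_away:
  assumes "\<delta> > 0"
  shows "exp_err_above {q. q > 0 \<and> \<bar>q - 1 / sqrt 2\<bar> \<ge> \<delta>}"
proof -
  define K where "K = {1 / 50 / 201\<^sup>2 .. 33/10} \<inter> {q. \<delta> \<le> \<bar>q - 1 / sqrt 2\<bar>}"
  have "closed {q. \<delta> \<le> \<bar>q - 1 / sqrt 2\<bar>}" by (intro closed_Collect_le continuous_intros)
  then have "compact K" unfolding K_def by (intro compact_Int_closed) auto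
  then have "exp_err_above K"
  proof (rule exp_err_above_compact)
    fix q assume "q \<in> K"
    then have q: "0 < q" "q \<le> 33/10" "q \<noteq> 1 / sqrt 2" using assms by (auto simp: K_def intro: less_le_trans[rotated])
    show "\<exists>e k \<rho>. e > 0 \<and> k > 0 \<and> sqrt 2 - 1 < exp \<rho> \<and> (\<forall>\<^sub>F q' in nhds q. rate_witness e k \<rho> q')"
    proof (cases "q \<le> 185/100")
      case True
      show ?thesis by (rule local_witness_saddle[OF q(1) True q(3)]) blast
    next
      case False
      then have q18: "18/10 \<le> q" by simp
      show ?thesis by (rule local_witness_middle[OF q18 q(2)]) blast
    qed
  qed
  then have "exp_err_above (({0<..<1 / 50 / 201\<^sup>2} \<union> K) \<union> {33/10..})"
    by (intro exp_err_above_Un exp_err_above_small exp_err_above_large)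
  then show ?thesis by (rule exp_err_above_subset) (auto simp: K_def)
qed

section \<open>The weighted rate\<close>

text \<open>Origin of the constant: the maximum of (2 u^2 - 1) \<open>saddle_q u\<close> is about
  0.16837.\<close>

lemma saddle_weight_le:
  assumes u: "u > 1/2" and \<gamma>: "\<gamma> \<ge> 0.1684"
  shows "(2 * u\<^sup>2 - 1) * saddle_q u \<le> \<gamma>"
proof -
  define w where "w = 2 * u * (4 * u\<^sup>2 - 1)"
  have w: "w > 0" using u four_u2_gt_1[OF u] by (simp add: w_def)
  txt \<open>The cubic is nonnegative because it almost has a double zero at \<open>1.0678\<close>.\<close>
  have "0 \<le> (u - 10678/10000)\<^sup>2 * (13472/10000 * u + 87708032/100000000)" using u by simp
  then have "2 * u\<^sup>2 - 1 \<le> 1684/10000 * w"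
    using u by (simp add: w_def power2_eq_square algebra_simps add_divide_distrib)
  also have "\<dots> \<le> \<gamma> * w" using \<gamma> w by (intro mult_right_mono) auto
  finally show ?thesis using w unfolding saddle_q_def w_def[symmetric] by (simp add: divide_le_eq)
qed

text \<open>\<open>saddle_q\<close> decreases in \<open>u\<close>, so this says that q^\<gamma>
  times the exponential of the rate increases with \<open>q\<close>. The derivative is a negative
  multiple of the quantity \<gamma> - (2 t^2 - 1) \<open>saddle_q t\<close>.\<close>

lemma weighted_rate_mono:
  assumes u: "u > 1/2" "u \<le> v" and \<gamma>: "\<gamma> \<ge> 0.1684"
  shows "\<gamma> * ln (saddle_q v) + saddle_rate v \<le> \<gamma> * ln (saddle_q u) + saddle_rate u"
proof -
  show ?thesis
  proof (rule DERIV_nonpos_imp_nonincreasing[where f="\<lambda>u. \<gamma> * ln (saddle_q u) + saddle_rate u"])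
    fix t assume "u \<le> t" "t \<le> v"
    then have t: "t > 1/2" using u by linarith
    define c where "c = 24 * t\<^sup>2 - 2"
    have c: "c > 0" using four_u2_gt_1[OF t] by (simp add: c_def)
    have q: "saddle_q t > 0" by (rule saddle_q_pos[OF t])
    have "((\<lambda>u. \<gamma> * ln (saddle_q u) + saddle_rate u) has_real_derivative
        \<gamma> * (1 / saddle_q t * (- c * (saddle_q t)\<^sup>2)) + (1 - 2 * t\<^sup>2) * (- c * (saddle_q t)\<^sup>2)) (at t)"
      unfolding c_def
      by (intro DERIV_add DERIV_cmult DERIV_saddle_rate t DERIV_chain2[OF DERIV_ln_divide DERIV_saddle_q] q)
    also have "\<gamma> * (1 / saddle_q t * (- c * (saddle_q t)\<^sup>2)) + (1 - 2 * t\<^sup>2) * (- c * (saddle_q t)\<^sup>2)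
      = - (c * saddle_q t) * (\<gamma> - (2 * t\<^sup>2 - 1) * saddle_q t)"
      using q by (simp add: power2_eq_square algebra_simps)
    finally have D: "((\<lambda>u. \<gamma> * ln (saddle_q u) + saddle_rate u) has_real_derivative
       - (c * saddle_q t) * (\<gamma> - (2 * t\<^sup>2 - 1) * saddle_q t)) (at t)" .
    have "- (c * saddle_q t) * (\<gamma> - (2 * t\<^sup>2 - 1) * saddle_q t) \<le> 0"
      using c q saddle_weight_le[OF t \<gamma>] by (intro mult_nonpos_nonneg) auto
    then show "\<exists>y. ((\<lambda>u. \<gamma> * ln (saddle_q u) + saddle_rate u) has_real_derivative y) (at t) \<and> y \<le> 0"
      using D by blast
  qed (rule u)
qed

lemma saddle_q_antimono:
  assumes "1/2 < u" "u < v"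
  shows "saddle_q v < saddle_q u"
proof -
  have uv: "4 * u\<^sup>2 - 1 < 4 * v\<^sup>2 - 1" using assms by (simp add: power_strict_mono)
  have "2 * u * (4 * u\<^sup>2 - 1) < 2 * v * (4 * v\<^sup>2 - 1)"
    by (rule mult_strict_mono) (use uv assms four_u2_gt_1[of u] in linarith)+
  then have "1 / saddle_q u < 1 / saddle_q v" using assms by (simp add: inverse_saddle_q)
  then show ?thesis using saddle_q_pos[of u] saddle_q_pos[of v] assms by (simp add: divide_simps split: if_splits)
qed

lemma saddle_q_onto:
  assumes "1/2 < c" "c \<le> 1" "0 < z" "z \<le> saddle_q c"
  obtains u where "u \<ge> c" "saddle_q u = z"
proof -
  define X where "X = 1 + 1 / z"
  have X: "X \<ge> 1" "X \<ge> 1 / z" using assms by (auto simp: X_def)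
  have "X\<^sup>2 \<ge> 1" using X by (intro one_le_power) auto
  then have "4 * X\<^sup>2 - 1 \<ge> 1" by linarith
  then have "2 * X * (4 * X\<^sup>2 - 1) \<ge> 2 * X * 1" by (rule mult_left_mono) (use X in linarith)
  then have "1 / z \<le> 2 * X * (4 * X\<^sup>2 - 1)" using X by linarith
  moreover have "2 * c * (4 * c\<^sup>2 - 1) \<le> 1 / z"
    unfolding inverse_saddle_q[OF assms(1), symmetric] using assms by (intro divide_left_mono) auto
  moreover have "continuous_on {c..X} (\<lambda>u. 2 * u * (4 * u\<^sup>2 - 1))" by (intro continuous_intros)
  moreover have "c \<le> X" using X assms by linarith
  ultimately have "\<exists>u. c \<le> u \<and> u \<le> X \<and> 2 * u * (4 * u\<^sup>2 - 1) = 1 / z" by (intro IVT')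
  then obtain u where u: "c \<le> u" "2 * u * (4 * u\<^sup>2 - 1) = 1 / z" by blast
  show ?thesis by (rule that[OF u(1)]) (simp add: saddle_q_def u(2))
qed

lemma sqrt_half_gt: "1/2 < 1 / sqrt (2::real)" "1 / sqrt (2::real) \<le> 1" "7/10 < 1 / sqrt (2::real)"
  using sqrt2_bounds by (simp_all add: divide_simps)

text \<open>\<open>C\<close> must not depend on \<open>x\<close>, but the prefactor in
  \<open>exp_err_upper\<close> degenerates as \<open>x\<close> tends to 0. Below a threshold
  \<open>a\<close> the weight alone is small enough and \<open>exp_err_le_half\<close> suffices;
  above it the saddle line is used and its height is bounded.\<close>

lemma weighted_exp_err_upper:
  assumes \<gamma>: "\<gamma> \<ge> 0.1684"
  obtains C where "\<And>n x. n \<ge> 1 \<Longrightarrow> 0 < x \<Longrightarrow> x \<le> 1 / sqrt 2 \<Longrightarrow>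
     ((sqrt 2 * x) powr \<gamma>) ^ n * exp_err n (n * x) \<le> C * (sqrt 2 - 1) ^ n"
proof -
  define \<tau> where "\<tau> = sqrt (2::real) - 1"
  \<comment> \<open>Chosen such that the weight (sqrt 2 x)^\<gamma> equals \<tau> at x = a.\<close>
  define a where "a = \<tau> powr (1 / \<gamma>) / sqrt 2"
  have \<tau>: "\<tau> > 0" using sqrt2_bounds by (simp add: \<tau>_def)
  have a: "a > 0" using \<tau> by (simp add: a_def)
  have g0: "\<gamma> > 0" using \<gamma> by simp
  define C where "C = 1 + exp (1 / (4 * a\<^sup>2)) * sqrt (pi / a) / \<tau>"
  have C1: "C \<ge> 1" "C \<ge> exp (1 / (4 * a\<^sup>2)) * sqrt (pi / a) / \<tau>" using \<tau> a by (auto simp: C_def)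
  show ?thesis
  proof (rule that[of C])
    fix n :: nat and x :: real
    assume n: "n \<ge> 1" and x: "0 < x" "x \<le> 1 / sqrt 2"
    show "((sqrt 2 * x) powr \<gamma>) ^ n * exp_err n (n * x) \<le> C * (sqrt 2 - 1) ^ n"
    proof (cases "x \<le> a")
      case True
      then have "sqrt 2 * x \<le> \<tau> powr (1 / \<gamma>)" by (simp add: a_def field_simps)
      then have "(sqrt 2 * x) powr \<gamma> \<le> (\<tau> powr (1 / \<gamma>)) powr \<gamma>" using x g0 by (intro powr_mono2) auto
      also have "\<dots> = \<tau>" using g0 \<tau> by (simp add: powr_powr)
      finally have "((sqrt 2 * x) powr \<gamma>) ^ n * exp_err n (n * x) \<le> \<tau> ^ n * 1"
        using exp_err_le_half[of "n * x" n] exp_err_nonneg[of "n * x" n] x \<tau>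
        by (intro mult_mono power_mono) auto
      also have "\<dots> \<le> C * \<tau> ^ n" using C1 \<tau> by simp
      finally show ?thesis by (simp add: \<tau>_def)
    next
      case False
      obtain u where u: "u \<ge> 1 / sqrt 2" "saddle_q u = x"
        using saddle_q_onto[OF sqrt_half_gt(1,2) x(1)] x(2) saddle_rate_sqrt_half(2) by auto
      have u12: "u > 1/2" "u > 7/10" using u sqrt_half_gt by linarith+
      have ule: "u \<le> 1 / (2 * a)"
      proof -
        have "u\<^sup>2 \<ge> (7/10)\<^sup>2" using u12 by (intro power_mono) auto
        then have "4 * u\<^sup>2 - 1 \<ge> (1/2::real)" by (simp add: power2_eq_square)
        moreover have "(1 / sqrt 2)\<^sup>2 \<le> u\<^sup>2" using u by (intro power_mono) auto
        ultimately have "4 * u\<^sup>2 - 1 \<ge> 1" by (simp add: power_divide)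
        then have "2 * u * 1 \<le> 2 * u * (4 * u\<^sup>2 - 1)" using u12 by (intro mult_left_mono) auto
        also have "\<dots> = 1 / x" using inverse_saddle_q[OF u12(1)] u by simp
        also have "\<dots> \<le> 1 / a" using False a by (intro divide_left_mono) auto
        finally show ?thesis using a by (simp add: field_simps)
      qed
      define B where "B = exp (saddle_rate u)"
      have B\<tau>: "B \<ge> \<tau>"
      proof -
        have "exp (ln \<tau>) \<le> B" unfolding B_def exp_le_cancel_iff \<tau>_def
          using saddle_rate_min[OF u12(1)] saddle_rate_sqrt_half(1) by (cases "u = 1 / sqrt 2") auto
        then show ?thesis using \<tau> by simp
      qed
      have key: "(sqrt 2 * x) powr \<gamma> * B \<le> \<tau>"
      proof -
        have "\<gamma> * ln x + saddle_rate u \<le> \<gamma> * ln (1 / sqrt 2) + ln \<tau>"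
          using weighted_rate_mono[OF sqrt_half_gt(1) u(1) \<gamma>] unfolding u(2) saddle_rate_sqrt_half \<tau>_def .
        then have "\<gamma> * (ln (sqrt 2) + ln x) + saddle_rate u \<le> ln \<tau>"
          by (simp add: ln_div algebra_simps)
        then have "exp (\<gamma> * (ln (sqrt 2) + ln x) + saddle_rate u) \<le> exp (ln \<tau>)" by simp
        then show ?thesis using x \<tau> by (simp add: powr_def B_def exp_add ln_mult mult.commute add.commute)
      qed
      have "cmod (cw x (Complex t (- u))) \<le> B" for t
        using norm_cw_le_line_rate[OF x(1), of u] line_rate_saddle[OF u12(1)] u12 unfolding u(2) B_def by simp
      then have "exp_err n (n * x) \<le> 1 / (pi * u) * (B ^ (n - 1) * (exp (x * u\<^sup>2) * sqrt (pi / x)))"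
        using u12 by (intro exp_err_upper[OF x(1) n]) auto
      also have "\<dots> \<le> 1 * (B ^ n / \<tau> * (exp (1 / (4 * a\<^sup>2)) * sqrt (pi / a)))"
      proof (intro mult_mono)
        have "1 \<le> 2 * (7/10::real)" by simp
        also have "\<dots> \<le> pi * u" using u12 pi_gt3 by (intro mult_mono) auto
        finally show "1 / (pi * u) \<le> 1" by simp
        have "B ^ n = B ^ (n - 1) * B" using n by (simp add: power_eq_if)
        moreover have "B ^ (n - 1) * \<tau> \<le> B ^ (n - 1) * B" using B\<tau> by (intro mult_left_mono) (auto simp: B_def)
        ultimately show "B ^ (n - 1) \<le> B ^ n / \<tau>" using \<tau> by (simp add: field_simps)
        have "x * u\<^sup>2 \<le> 1 * (1 / (2 * a))\<^sup>2" using order_trans[OF x(2) sqrt_half_gt(2)] x(1) ule u12 by (intro mult_mono power_mono) auto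
        then show "exp (x * u\<^sup>2) \<le> exp (1 / (4 * a\<^sup>2))" by (simp add: power_divide power_mult_distrib)
        show "sqrt (pi / x) \<le> sqrt (pi / a)" using False a x by (auto intro!: divide_left_mono)
      qed (use u12 \<tau> x in \<open>auto simp: B_def\<close>)
      also have "\<dots> = B ^ n * (exp (1 / (4 * a\<^sup>2)) * sqrt (pi / a) / \<tau>)" by simp
      also have "\<dots> \<le> B ^ n * C" using C1 by (intro mult_left_mono) (auto simp: B_def)
      finally have "((sqrt 2 * x) powr \<gamma>) ^ n * exp_err n (n * x) \<le> ((sqrt 2 * x) powr \<gamma>) ^ n * (B ^ n * C)"
        by (intro mult_left_mono) auto
      also have "\<dots> = ((sqrt 2 * x) powr \<gamma> * B) ^ n * C" by (simp add: power_mult_distrib)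
      also have "\<dots> \<le> \<tau> ^ n * C" using key C1 by (intro mult_right_mono power_mono) (auto simp: B_def)
      finally show ?thesis by (simp add: \<tau>_def mult.commute)
    qed
  qed
qed

section \<open>Monotonicity of the weighted \<open>H_tilde\<close>\<close>

lemma crit_root_eqI:
  assumes "of_real z * (\<zeta> ^ 3 - \<zeta>) + 1 = 0" "Im \<zeta> \<ge> 0" "Re \<zeta> > 0"
    and "\<And>\<xi>. of_real z * (\<xi> ^ 3 - \<xi>) + 1 = 0 \<Longrightarrow> Im \<xi> \<ge> 0 \<Longrightarrow> Re \<xi> > 0 \<Longrightarrow> \<xi> = \<zeta> \<or> Re \<zeta> < Re \<xi>"
  shows "crit_root z = \<zeta>"
  unfolding crit_root_def is_arg_min_def
proof (rule the_equality, goal_cases)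
  case 1
  then show ?case using assms(1-3) assms(4) by force
next
  case (2 \<xi>)
  then show ?case using assms(1-3) assms(4)[of \<xi>] by blast
qed

lemma sqrt_third: "(1 / sqrt (3::real))\<^sup>2 = 1 / 3" "1/2 < 1 / sqrt (3::real)" "1 / sqrt (3::real) \<le> 1" "1 / sqrt (3::real) > 0"
proof -
  have "1 \<le> sqrt (3::real)" by simp
  moreover have "sqrt (3::real) < 2" by (rule real_less_lsqrt) auto
  ultimately show "(1 / sqrt (3::real))\<^sup>2 = 1 / 3" "1/2 < 1 / sqrt (3::real)" "1 / sqrt (3::real) \<le> 1" "1 / sqrt (3::real) > 0"
    by (auto simp: power_divide divide_simps)
qed

text \<open>With \<zeta> = \<i> s, the cubic is the saddle point equation of \<open>cw z\<close>,
  and \<open>H_tilde z\<close> is the modulus of \<open>cw z\<close> at the saddle point. The roots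
  are - 2 u and u \<plusminus> \<i> v with v^2 = 3 u^2 - 1, nonnegative exactly when u >= 1 / sqrt 3
  among positive \<open>u\<close>.\<close>

lemma H_tilde_saddle:
  assumes u: "u \<ge> 1 / sqrt 3"
  shows "H_tilde (saddle_q u) = exp (saddle_rate u)"
proof -
  define v where "v = sqrt (3 * u\<^sup>2 - 1)"
  define z where "z = saddle_q u"
  have u12: "u > 1/2" using u sqrt_third by linarith
  have "(1 / sqrt 3)\<^sup>2 \<le> u\<^sup>2" using u sqrt_third by (intro power_mono) auto
  then have v2: "v\<^sup>2 = 3 * u\<^sup>2 - 1" "v \<ge> 0" using sqrt_third by (auto simp: v_def)
  have z: "z > 0" "1 / z = 2 * u * (4 * u\<^sup>2 - 1)" using saddle_q_pos[OF u12] inverse_saddle_q[OF u12] by (auto simp: z_def)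
  have zu: "z * (2 * u * (4 * u\<^sup>2 - 1)) = 1" using z(1) unfolding z(2)[symmetric] by simp
  have v2c: "(of_real v)\<^sup>2 = (3 * (of_real u)\<^sup>2 - 1 :: complex)"
    unfolding of_real_power[symmetric] v2 by simp
  have fac: "of_real z * (\<xi> ^ 3 - \<xi>) + 1 = of_real z * ((\<xi> + 2 * of_real u) * ((\<xi> - of_real u - \<i> * of_real v) * (\<xi> - of_real u + \<i> * of_real v)))" for \<xi> :: complex
  proof -
    have "(\<xi> - of_real u - \<i> * of_real v) * (\<xi> - of_real u + \<i> * of_real v) = (\<xi> - of_real u)\<^sup>2 + (of_real v)\<^sup>2"
      by (simp add: power2_eq_square algebra_simps)
    also have "\<dots> = \<xi>\<^sup>2 - 2 * of_real u * \<xi> + 4 * (of_real u)\<^sup>2 - 1"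
      unfolding v2c by (simp add: power2_eq_square algebra_simps)
    finally have 1: "(\<xi> + 2 * of_real u) * ((\<xi> - of_real u - \<i> * of_real v) * (\<xi> - of_real u + \<i> * of_real v))
      = \<xi> ^ 3 - \<xi> + 2 * of_real u * (4 * (of_real u)\<^sup>2 - 1)"
      by (simp only:) (simp add: power2_eq_square power3_eq_cube algebra_simps)
    have "of_real z * (2 * of_real u * (4 * (of_real u)\<^sup>2 - 1)) = (of_real (z * (2 * u * (4 * u\<^sup>2 - 1))) :: complex)" by simp
    then show ?thesis unfolding 1 zu by (simp add: distrib_left)
  qed
  have root: "crit_root z = Complex u v"
  proof (rule crit_root_eqI)
    show "of_real z * (Complex u v ^ 3 - Complex u v) + 1 = 0"
      unfolding fac by (simp add: complex_eq_iff)
    fix \<xi> assume r: "of_real z * (\<xi> ^ 3 - \<xi>) + 1 = 0" and \<xi>: "Im \<xi> \<ge> 0" "Re \<xi> > 0"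
    then consider "\<xi> + 2 * of_real u = 0" | "\<xi> - of_real u - \<i> * of_real v = 0" | "\<xi> - of_real u + \<i> * of_real v = 0"
      using z(1) unfolding fac by auto
    then show "\<xi> = Complex u v \<or> Re (Complex u v) < Re \<xi>"
      using \<xi> u12 v2(2) by cases (auto simp: complex_eq_iff)
  qed (use u12 v2 in auto)
  have "(cmod (Complex u v - 1))\<^sup>2 = 2 * u * (2 * u - 1)" "(cmod (Complex u v + 1))\<^sup>2 = 2 * u * (2 * u + 1)"
    unfolding cmod_power2 using v2 by (simp_all add: power2_eq_square algebra_simps)
  then have "(cmod ((Complex u v - 1) / (Complex u v + 1)))\<^sup>2 = (2 * u - 1) / (2 * u + 1)"
    using u12 by (simp add: norm_divide power_divide)
  then have "cmod ((Complex u v - 1) / (Complex u v + 1)) = sqrt ((2 * u - 1) / (2 * u + 1))"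
    by (metis norm_ge_zero real_sqrt_unique)
  then have "ln (cmod ((Complex u v - 1) / (Complex u v + 1))) = ln ((2 * u - 1) / (2 * u + 1)) / 2"
    using u12 by (simp add: ln_sqrt)
  moreover have "Re ((Complex u v)\<^sup>2) = 1 - 2 * u\<^sup>2" using v2 by (simp add: Re_power2)
  ultimately show ?thesis
    unfolding H_tilde_def z_def[symmetric] root saddle_rate_def by (simp add: mult.commute z_def add.commute)
qed

definition real_rate :: "real \<Rightarrow> real" where
  "real_rate x = ln ((1 - x) / (1 + x)) + x / (1 - x\<^sup>2)"

text \<open>The range with real roots \<open>x\<close> and - x/2 \<plusminus> s. For x <= 1 / sqrt 3
  one has s >= 3 x / 2, so \<open>x\<close> is the smaller positive root, or the double one.\<close>

lemma H_tilde_real: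
  assumes x: "0 < x" "x \<le> 1 / sqrt 3"
  shows "H_tilde (1 / (x - x ^ 3)) = exp (real_rate x)"
proof -
  define z where "z = 1 / (x - x ^ 3)"
  have x2: "x\<^sup>2 \<le> 1 / 3" unfolding sqrt_third(1)[symmetric] using x by (intro power_mono) auto
  have x1: "x < 1" by (rule power2_less_imp_less) (use x2 in auto)
  have xx: "x - x ^ 3 = x * (1 - x\<^sup>2)" by (simp add: power2_eq_square power3_eq_cube algebra_simps)
  have pos: "1 - x\<^sup>2 > 0" using x2 by simp
  then have xp: "x - x ^ 3 > 0" using x unfolding xx by simp
  then have z: "z > 0" "z * (x - x ^ 3) = 1" by (auto simp: z_def)
  define s where "s = sqrt (1 - 3 / 4 * x\<^sup>2)"
  have s2: "s\<^sup>2 = 1 - 3 / 4 * x\<^sup>2" "s \<ge> 0" using x2 by (auto simp: s_def)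
  have s: "s \<ge> 3 / 2 * x"
  proof (rule power2_le_imp_le)
    show "(3 / 2 * x)\<^sup>2 \<le> s\<^sup>2" unfolding s2 using x2 by (simp add: power_mult_distrib power2_eq_square)
  qed (rule s2)
  have s2c: "(of_real s)\<^sup>2 = (1 - 3 / 4 * (of_real x)\<^sup>2 :: complex)"
    unfolding of_real_power[symmetric] s2 by simp
  have fac: "of_real z * (\<xi> ^ 3 - \<xi>) + 1 = of_real z * ((\<xi> - of_real x) * ((\<xi> + of_real x / 2 - of_real s) * (\<xi> + of_real x / 2 + of_real s)))" for \<xi> :: complex
  proof -
    have "(\<xi> + of_real x / 2 - of_real s) * (\<xi> + of_real x / 2 + of_real s) = (\<xi> + of_real x / 2)\<^sup>2 - (of_real s)\<^sup>2"
      by (simp add: power2_eq_square algebra_simps)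
    also have "\<dots> = \<xi>\<^sup>2 + of_real x * \<xi> + (of_real x)\<^sup>2 - 1"
      unfolding s2c by (simp add: power2_eq_square algebra_simps)
    finally have 1: "(\<xi> - of_real x) * ((\<xi> + of_real x / 2 - of_real s) * (\<xi> + of_real x / 2 + of_real s))
      = \<xi> ^ 3 - \<xi> + (of_real x - of_real x ^ 3)"
      by (simp only:) (simp add: power2_eq_square power3_eq_cube algebra_simps)
    have "of_real z * (of_real x - of_real x ^ 3) = (of_real (z * (x - x ^ 3)) :: complex)" by simp
    then show ?thesis unfolding 1 z(2) by (simp add: distrib_left)
  qed
  have root: "crit_root z = of_real x"
  proof (rule crit_root_eqI)
    show "of_real z * (of_real x ^ 3 - of_real x) + 1 = (0 :: complex)" unfolding fac by simp
    fix \<xi> assume r: "of_real z * (\<xi> ^ 3 - \<xi>) + 1 = 0" and \<xi>: "Im \<xi> \<ge> 0" "Re \<xi> > 0"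
    then consider "\<xi> - of_real x = 0" | "\<xi> + of_real x / 2 - of_real s = 0" | "\<xi> + of_real x / 2 + of_real s = 0"
      using z(1) unfolding fac by auto
    then show "\<xi> = of_real x \<or> Re (of_real x) < Re \<xi>"
      using \<xi> x s s2(2) by cases (auto simp: complex_eq_iff)
  qed (use x in auto)
  have "cmod ((of_real x - 1) / (of_real x + 1)) = (1 - x) / (1 + x)"
  proof -
    have "(of_real x - 1) / (of_real x + 1) = (of_real ((x - 1) / (x + 1)) :: complex)" by simp
    then have "cmod ((of_real x - 1) / (of_real x + 1)) = \<bar>(x - 1) / (x + 1)\<bar>" by (simp only: norm_of_real)
    moreover have "\<bar>x - 1\<bar> = 1 - x" "\<bar>x + 1\<bar> = 1 + x" using x x1 by auto
    ultimately show ?thesis by (simp only: abs_divide)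
  qed
  moreover have "z * Re ((of_real x)\<^sup>2) = x / (1 - x\<^sup>2)"
    unfolding z_def xx using x pos by (simp add: Re_power2 power2_eq_square)
  ultimately show ?thesis
    unfolding H_tilde_def z_def[symmetric] root real_rate_def by simp
qed

lemma real_rate_antimono:
  assumes x: "0 < x" "x \<le> y" "y \<le> 1 / sqrt 3"
  shows "real_rate y \<le> real_rate x"
proof (rule DERIV_nonpos_imp_nonincreasing[where f=real_rate])
  fix t assume "x \<le> t" "t \<le> y"
  then have t: "0 < t" "t \<le> 1 / sqrt 3" using x by auto
  then have t2: "t\<^sup>2 \<le> 1 / 3" unfolding sqrt_third(1)[symmetric] by (intro power_mono) auto
  have p: "1 - t\<^sup>2 > 0" using t2 by simp
  have "t < 1" by (rule power2_less_imp_less) (use t2 in auto)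
  then have t1: "1 - t > 0" "1 + t > 0" using t by auto
  have dl: "((\<lambda>t. ln ((1 - t) / (1 + t))) has_real_derivative - 2 / ((1 - t) * (1 + t))) (at t)"
    using t1 by (auto intro!: derivative_eq_intros simp: divide_simps)
  have df: "((\<lambda>t. t / (1 - t\<^sup>2)) has_real_derivative (1 + t\<^sup>2) / (1 - t\<^sup>2)\<^sup>2) (at t)"
    using p by (auto intro!: derivative_eq_intros simp: divide_simps power2_eq_square)
  have e: "(1 - t) * (1 + t) = 1 - t\<^sup>2" by (simp add: power2_eq_square algebra_simps)
  have "- 2 / (1 - t\<^sup>2) + (1 + t\<^sup>2) / (1 - t\<^sup>2)\<^sup>2 = (3 * t\<^sup>2 - 1) / (1 - t\<^sup>2)\<^sup>2"
    using p by (simp add: power2_eq_square divide_simps)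
  also have "\<dots> \<le> 0" using t2 by (intro divide_nonpos_nonneg) auto
  finally show "\<exists>d. (real_rate has_real_derivative d) (at t) \<and> d \<le> 0"
    unfolding real_rate_def[abs_def] using DERIV_add[OF dl df] unfolding e by blast
qed (rule x)

text \<open>The two parametrizations meet at the double root 1 / sqrt 3. Below that value of
  \<open>z\<close> the weight is needed and \<open>weighted_rate_mono\<close> applies; above it
  \<open>H_tilde\<close> is itself increasing.\<close>

theorem mono_weighted_H_tilde:
  assumes \<gamma>: "\<gamma> \<ge> 0.1684"
  shows "mono_on {0<..} (\<lambda>z. z powr \<gamma> * H_tilde z)"
proof -
  define c where "c = 1 / sqrt (3::real)"
  note c = sqrt_third[folded c_def]
  let ?F = "\<lambda>z. z powr \<gamma> * H_tilde z"
  have c3: "c ^ 3 = c / 3" using c(1) by (simp add: power3_eq_cube power2_eq_square)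
  have qc: "saddle_q c = 1 / (c - c ^ 3)" unfolding saddle_q_def c3 c(1) by simp
  have A: "?F y \<le> ?F z" if "0 < y" "y \<le> z" "z \<le> saddle_q c" for y z
  proof -
    obtain u where u: "u \<ge> c" "saddle_q u = y" using saddle_q_onto[OF c(2,3), of y] \<open>0 < y\<close> \<open>y \<le> z\<close> \<open>z \<le> saddle_q c\<close> by auto
    obtain v where v: "v \<ge> c" "saddle_q v = z" using saddle_q_onto[OF c(2,3), of z] \<open>0 < y\<close> \<open>y \<le> z\<close> \<open>z \<le> saddle_q c\<close> by auto
    have F: "?F (saddle_q w) = exp (\<gamma> * ln (saddle_q w) + saddle_rate w)" if "w \<ge> c" for w
      using that H_tilde_saddle[of w] saddle_q_pos[of w] c by (simp add: c_def[symmetric] powr_def exp_add)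
    have vu: "v \<le> u"
    proof (rule ccontr)
      assume "\<not> v \<le> u"
      then have "saddle_q v < saddle_q u" using u c by (intro saddle_q_antimono) auto
      then show False using u v \<open>y \<le> z\<close> by simp
    qed
    have "exp (\<gamma> * ln (saddle_q u) + saddle_rate u) \<le> exp (\<gamma> * ln (saddle_q v) + saddle_rate v)"
      unfolding exp_le_cancel_iff by (rule weighted_rate_mono[OF _ vu \<gamma>]) (use v c in auto)
    then show ?thesis using F[OF u(1)] F[OF v(1)] u v by simp
  qed
  have B: "?F y \<le> ?F z" if yz: "saddle_q c \<le> y" "y \<le> z" for y z
  proof -
    have y0: "y > 0" using yz saddle_q_pos[OF c(2)] by linarith
    have ex: "\<exists>x. 0 < x \<and> x \<le> c \<and> w = 1 / (x - x ^ 3)" if w: "saddle_q c \<le> w" for w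
    proof -
      have w0: "w > 0" using w saddle_q_pos[OF c(2)] by linarith
      have "c - c ^ 3 > 0" using c by (simp add: c3)
      then have "1 / w \<le> c - c ^ 3" using w w0 unfolding qc by (simp add: divide_simps mult.commute)
      then have "\<exists>x. 0 \<le> x \<and> x \<le> c \<and> x - x ^ 3 = 1 / w"
        using w0 c by (intro IVT') (auto intro!: continuous_intros)
      then obtain x where x: "0 \<le> x" "x \<le> c" "x - x ^ 3 = 1 / w" by blast
      then have "x \<noteq> 0" using w0 by auto
      then show ?thesis using x by (intro exI[of _ x]) auto
    qed
    obtain x1 where x1: "0 < x1" "x1 \<le> c" "y = 1 / (x1 - x1 ^ 3)" using ex yz by blast
    obtain x2 where x2: "0 < x2" "x2 \<le> c" "z = 1 / (x2 - x2 ^ 3)" using ex yz by (meson order_trans)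
    have "x2 \<le> x1"
    proof (rule ccontr)
      assume "\<not> x2 \<le> x1"
      then have lt: "x1 < x2" by simp
      have "x1\<^sup>2 < c\<^sup>2" "x2\<^sup>2 \<le> c\<^sup>2" "x1 * x2 < c * c"
        using lt x1 x2 by (auto intro!: power_strict_mono power_mono mult_less_le_imp_less)
      then have "x1\<^sup>2 + x1 * x2 + x2\<^sup>2 < 1" using c(1) by (simp add: power2_eq_square)
      then have "0 < (x2 - x1) * (1 - (x1\<^sup>2 + x1 * x2 + x2\<^sup>2))" using lt by simp
      also have "\<dots> = (x2 - x2 ^ 3) - (x1 - x1 ^ 3)"
        by (simp add: power2_eq_square power3_eq_cube algebra_simps)
      finally have "1 / y < 1 / z" using x1 x2 by simp
      then show False using y0 yz by (simp add: divide_simps split: if_splits)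
    qed
    then have "real_rate x1 \<le> real_rate x2" using x1 x2 by (intro real_rate_antimono) (auto simp: c_def)
    then have "H_tilde y \<le> H_tilde z" using H_tilde_real[of x1] H_tilde_real[of x2] x1 x2 by (simp add: c_def)
    moreover have "y powr \<gamma> \<le> z powr \<gamma>" using y0 yz \<gamma> by (intro powr_mono2) auto
    ultimately show ?thesis by (intro mult_mono) (auto simp: H_tilde_def)
  qed
  show ?thesis
  proof (rule mono_onI)
    fix y z :: real assume yz: "y \<in> {0<..}" "z \<in> {0<..}" "y \<le> z"
    then consider "z \<le> saddle_q c" | "saddle_q c \<le> y" | "y \<le> saddle_q c" "saddle_q c \<le> z" by linarith
    then show "?F y \<le> ?F z"
    proof cases
      case 3
      have "?F y \<le> ?F (saddle_q c)" by (rule A) (use yz 3 in auto)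
      also have "\<dots> \<le> ?F z" by (rule B) (use yz 3 in auto)
      finally show ?thesis .
    qed (use A B yz in auto)
  qed
qed

section \<open>Minimizers of the weighted error\<close>

context
  fixes \<gamma> a b :: real and n :: nat
  assumes \<gamma>: "\<gamma> > 0" and ab: "0 \<le> a" "a \<le> b" "0 < b" and n: "n \<ge> 1"
begin

definition point_err :: "real \<Rightarrow> real \<Rightarrow> real" where
  "point_err t q = (t powr \<gamma>) ^ n * exp_err n (real n * t * q)"

abbreviation (input) "W \<equiv> weighted_err (\<lambda>t. t powr \<gamma>) {a..b} n"

lemma point_err_0 [simp]: "point_err 0 q = 0"
  using n by (simp add: point_err_def)

text \<open>At t = 0, where \<open>continuous_on_exp_err\<close> gives no information, the weight
  tends to 0 while the error stays bounded.\<close>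

lemma continuous_on_point_err:
  assumes q: "q > 0"
  shows "continuous_on {a..b} (\<lambda>t. point_err t q)"
  unfolding continuous_on_def
proof
  fix t assume "t \<in> {a..b}"
  then have t: "t \<ge> 0" using ab by simp
  have c0: "continuous_on {0..} (\<lambda>t. (t powr \<gamma>) ^ n)"
    using \<gamma> by (intro continuous_on_power continuous_on_powr') (auto intro: continuous_intros)
  have pw: "((\<lambda>t. (t powr \<gamma>) ^ n) \<longlongrightarrow> (t powr \<gamma>) ^ n) (at t within {a..b})"
    using c0 t ab(1) unfolding continuous_on_def by (auto intro: tendsto_within_subset)
  show "((\<lambda>t. point_err t q) \<longlongrightarrow> point_err t q) (at t within {a..b})"
  proof (cases "t = 0")
    case True
    have "((\<lambda>t. point_err t q) \<longlongrightarrow> 0) (at t within {a..b})"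
    proof (rule Lim_null_comparison)
      show "((\<lambda>t. (t powr \<gamma>) ^ n) \<longlongrightarrow> 0) (at t within {a..b})" using pw True n by (simp add: power_0_left)
      show "\<forall>\<^sub>F t in at t within {a..b}. norm (point_err t q) \<le> (t powr \<gamma>) ^ n"
        unfolding eventually_at_filter
      proof (rule always_eventually, intro allI impI)
        fix s assume "s \<in> {a..b}"
        then have "n * s * q \<ge> 0" using ab q by simp
        then have "exp_err n (n * s * q) \<le> 1" "exp_err n (n * s * q) \<ge> 0"
          using exp_err_le_half[of "n * s * q" n] exp_err_nonneg by auto
        then show "norm (point_err s q) \<le> (s powr \<gamma>) ^ n"
          by (simp add: point_err_def abs_mult mult_left_le)
      qed
    qed
    then show ?thesis using True by simp
  next
    case False
    then have "n * t * q > 0" using t q n by simp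
    then have "isCont (exp_err n) (n * t * q)"
      using continuous_on_exp_err[of n] by (simp add: continuous_on_eq_continuous_at)
    then have "((\<lambda>t. exp_err n (n * t * q)) \<longlongrightarrow> exp_err n (n * t * q)) (at t within {a..b})"
      by (rule isCont_tendsto_compose) (intro tendsto_intros)
    then show ?thesis unfolding point_err_def by (intro tendsto_mult pw)
  qed
qed

text \<open>Compactness of the time interval is what makes \<open>GREATEST\<close> denote the
  intended maximum.\<close>

lemma weighted_err_attained:
  assumes q: "q > 0"
  obtains t where "t \<in> {a..b}" "W q = point_err t q" "\<And>s. s \<in> {a..b} \<Longrightarrow> point_err s q \<le> W q"
proof -
  obtain t where t: "t \<in> {a..b}" "\<And>s. s \<in> {a..b} \<Longrightarrow> point_err s q \<le> point_err t q"
    using continuous_attains_sup[OF _ _ continuous_on_point_err[OF q]] ab by auto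
  have eq: "(t powr \<gamma>) ^ n * best_err t n q = point_err t q" for t
    unfolding point_err_def best_err_eq_exp_err[OF n q] ..
  have "W q = point_err t q"
    unfolding weighted_err_def eq using t by (intro Greatest_equality) auto
  then show ?thesis using that t by simp
qed

lemma weighted_err_ge:
  assumes "q > 0"
  shows "(b powr \<gamma>) ^ n * exp_err n (n * (b * q)) \<le> W q"
proof -
  obtain t where "\<And>s. s \<in> {a..b} \<Longrightarrow> point_err s q \<le> W q" using weighted_err_attained[OF assms] by metis
  from this[of b] show ?thesis using ab by (simp add: point_err_def mult.assoc)
qed

lemma powr_power_le: "t \<in> {a..b} \<Longrightarrow> (t powr \<gamma>) ^ n \<le> (b powr \<gamma>) ^ n"
  using ab \<gamma> by (intro power_mono powr_mono2) auto

text \<open>The modulus in \<open>exp_err_change\<close> is invariant under scaling by n t, hence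
  common to all positive times.\<close>

lemma weighted_err_change:
  assumes "0 < q" "0 < q'"
  shows "W q' \<le> W q + (b powr \<gamma>) ^ n * (\<bar>q' - q\<bar> / min q q')"
proof -
  obtain t where t: "t \<in> {a..b}" "W q' = point_err t q'" using weighted_err_attained[OF assms(2)] by metis
  have q: "point_err t q \<le> W q" using weighted_err_attained[OF assms(1)] t by metis
  have "point_err t q' \<le> point_err t q + (b powr \<gamma>) ^ n * (\<bar>q' - q\<bar> / min q q')"
  proof (cases "t = 0")
    case True
    then show ?thesis using assms by simp
  next
    case False
    then have t0: "n * t > 0" using t ab n by simp
    have "\<bar>n * t * q' - n * t * q\<bar> / min (n * t * q) (n * t * q') = \<bar>q' - q\<bar> / min q q'"
    proof -
      have 1: "n * t * q' - n * t * q = n * t * (q' - q)" by (simp add: algebra_simps)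
      have 2: "min (n * t * q) (n * t * q') = n * t * min q q'"
        using t0 by (simp add: min_mult_distrib_left)
      have 3: "\<bar>n * t * (q' - q)\<bar> = n * t * \<bar>q' - q\<bar>" using t0 by (subst abs_mult) simp
      show ?thesis unfolding 1 2 3 using t0 by (intro mult_divide_mult_cancel_left) linarith
    qed
    then have "exp_err n (n * t * q') \<le> exp_err n (n * t * q) + \<bar>q' - q\<bar> / min q q'"
      using exp_err_change[of "n * t * q" "n * t * q'" n] t0 assms by simp
    then have "point_err t q' \<le> (t powr \<gamma>) ^ n * (exp_err n (n * t * q) + \<bar>q' - q\<bar> / min q q')"
      unfolding point_err_def by (intro mult_left_mono) auto
    also have "\<dots> = point_err t q + (t powr \<gamma>) ^ n * (\<bar>q' - q\<bar> / min q q')"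
      by (simp add: point_err_def distrib_left)
    also have "\<dots> \<le> point_err t q + (b powr \<gamma>) ^ n * (\<bar>q' - q\<bar> / min q q')"
      using powr_power_le[OF t(1)] assms by (intro add_left_mono mult_right_mono) auto
    finally show ?thesis .
  qed
  then show ?thesis using q t by linarith
qed

lemma weighted_err_less_half:
  assumes q: "q > 0"
  shows "W q < (b powr \<gamma>) ^ n / 2"
proof -
  have K: "(b powr \<gamma>) ^ n > 0" using ab by simp
  obtain t where t: "t \<in> {a..b}" "W q = point_err t q" using weighted_err_attained[OF q] by metis
  show ?thesis
  proof (cases "t = 0")
    case True
    then show ?thesis using t K by simp
  next
    case False
    then have t0: "n * t * q > 0" using t ab n q by simp
    have "point_err t q \<le> (b powr \<gamma>) ^ n * exp_err n (n * t * q)"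
      unfolding point_err_def using powr_power_le[OF t(1)] exp_err_nonneg t0 by (intro mult_right_mono) auto
    also have "\<dots> < (b powr \<gamma>) ^ n * (1 / 2)"
      using exp_err_less_half[OF t0 n] K by (intro mult_strict_left_mono) auto
    finally show ?thesis using t by simp
  qed
qed

text \<open>At q = 1 the error is below half the largest weight \<open>K\<close>. For very small or
  very large \<open>q\<close> the time \<open>b\<close> alone pushes it above that value, so a
  minimum over a compact interval containing 1 is global.\<close>

lemma weighted_err_minimizer: "\<exists>q. is_arg_min W (\<lambda>q. q > 0) q"
proof -
  define K where "K = (b powr \<gamma>) ^ n"
  define m where "m = W 1 / K"
  have K: "K > 0" using ab by (simp add: K_def)
  have m: "m < 1 / 2" using weighted_err_less_half[of 1] K by (simp add: m_def K_def[symmetric] divide_less_eq)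
  have nb: "n * b > 0" using n ab by simp
  obtain c1 where c1: "\<And>c. c \<ge> c1 \<Longrightarrow> m < exp_err n c"
    using exp_err_extreme(1)[OF m, of n] unfolding eventually_at_top_linorder by blast
  obtain c0 where c0: "c0 > 0" "\<And>c. 0 < c \<Longrightarrow> c < c0 \<Longrightarrow> m < exp_err n c"
    using exp_err_extreme(2)[OF m, of n] unfolding eventually_at_right_field by blast
  have big: "W 1 < W q" if "q > 0" "m < exp_err n (n * (b * q))" for q
  proof -
    have "K * m < K * exp_err n (n * (b * q))" using that K by simp
    also have "\<dots> \<le> W q" using weighted_err_ge[OF that(1)] by (simp add: K_def)
    finally show ?thesis using K by (simp add: m_def)
  qed
  define l r where "l = min 1 (c0 / (n * b))" and "r = max 1 (c1 / (n * b))"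
  have l: "l > 0" "l \<le> 1" "1 \<le> r" using c0 nb by (auto simp: l_def r_def)
  have "continuous_on {0<..} W"
    by (rule continuous_on_log_Lipschitz) (rule weighted_err_change)
  then have "continuous_on {l..r} W" by (rule continuous_on_subset) (use l in auto)
  then obtain q where q: "q \<in> {l..r}" "\<And>q'. q' \<in> {l..r} \<Longrightarrow> W q \<le> W q'"
    using continuous_attains_inf[of "{l..r}" W] l by auto
  have "W q \<le> W q'" if "q' > 0" for q'
  proof (cases "q' \<in> {l..r}")
    case False
    have "m < exp_err n (n * (b * q'))"
    proof (cases "q' < l")
      case True
      then have "q' < c0 / (n * b)" by (simp add: l_def)
      then have "n * (b * q') < c0" using nb by (simp add: field_simps)
      moreover have "0 < n * (b * q')" using that n ab by simp
      ultimately show ?thesis by (intro c0(2))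
    next
      case f: False
      then have "c1 / (n * b) \<le> q'" using False by (auto simp: r_def)
      then show ?thesis using nb by (intro c1) (auto simp: field_simps)
    qed
    then have "W 1 < W q'" by (rule big[OF that])
    moreover have "W q \<le> W 1" using q(2)[of 1] l by simp
    ultimately show ?thesis by linarith
  qed (rule q(2))
  moreover have "q > 0" using q(1) l by simp
  ultimately have "is_arg_min W (\<lambda>q. q > 0) q" unfolding is_arg_min_def using not_less by blast
  then show ?thesis by blast
qed

text \<open>For this pole x = t q runs through (0, 1 / sqrt 2] as \<open>t\<close> runs through (0,
  b], and t = b (sqrt 2 x).\<close>

lemma weighted_err_le:
  assumes C: "\<And>x::real. 0 < x \<Longrightarrow> x \<le> 1 / sqrt 2 \<Longrightarrow> ((sqrt 2 * x) powr \<gamma>) ^ n * exp_err n (n * x) \<le> D"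
  shows "W (1 / (sqrt 2 * b)) \<le> (b powr \<gamma>) ^ n * D"
proof -
  define q where "q = 1 / (sqrt 2 * b)"
  have q: "q > 0" using ab by (simp add: q_def)
  obtain t where t: "t \<in> {a..b}" "W q = point_err t q" using weighted_err_attained[OF q] by metis
  show ?thesis
  proof (cases "t = 0")
    case True
    have "0 \<le> ((sqrt 2 * (1 / sqrt 2)) powr \<gamma>) ^ n * exp_err n (n * (1 / sqrt 2))"
      by (intro mult_nonneg_nonneg exp_err_nonneg) auto
    also have "\<dots> \<le> D" using C[of "1 / sqrt 2"] by simp
    finally show ?thesis using t True by (simp add: q_def)
  next
    case False
    define x where "x = t * q"
    have x: "0 < x" "x \<le> 1 / sqrt 2" using t ab False q by (auto simp: x_def q_def field_simps)
    have tb: "t = b * (sqrt 2 * x)" using ab by (simp add: x_def q_def)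
    have "point_err t q = ((b * (sqrt 2 * x)) powr \<gamma>) ^ n * exp_err n (n * x)"
      unfolding point_err_def tb[symmetric] by (simp add: x_def mult.assoc)
    also have "\<dots> = (b powr \<gamma>) ^ n * (((sqrt 2 * x) powr \<gamma>) ^ n * exp_err n (n * x))"
      using ab x by (simp add: powr_mult power_mult_distrib)
    also have "\<dots> \<le> (b powr \<gamma>) ^ n * D" using C[OF x] by (intro mult_left_mono) auto
    finally show ?thesis using t by (simp add: q_def)
  qed
qed

end

text \<open>If \<open>Q n\<close> stays at distance \<open>r\<close> from the limit, then b
  \<open>Q n\<close> stays at distance r b from 1 / sqrt 2, and the time \<open>b\<close> alone
  forces an error of K L^n with L > sqrt 2 - 1. The pole at the limit achieves K C (sqrt 2 - 1)^n, a
  contradiction for large \<open>n\<close>.\<close>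

theorem weighted_err_minimizers_tendsto:
  assumes \<gamma>: "\<gamma> \<ge> 0.1684" and ab: "0 \<le> a" "a \<le> b" "0 < b"
    and Q: "\<And>n. n \<ge> 1 \<Longrightarrow> is_arg_min (weighted_err (\<lambda>t. t powr \<gamma>) {a..b} n) (\<lambda>q. q > 0) (Q n)"
  shows "Q \<longlonglongrightarrow> 1 / (sqrt 2 * b)"
proof (rule LIMSEQ_I)
  fix r :: real assume r: "r > 0"
  have g0: "\<gamma> > 0" using \<gamma> by simp
  have "r * b > 0" using r ab by simp
  from exp_err_above_away[OF this] obtain L N where L: "L > sqrt 2 - 1"
    "\<And>n q. n \<ge> N \<Longrightarrow> q > 0 \<Longrightarrow> \<bar>q - 1 / sqrt 2\<bar> \<ge> r * b \<Longrightarrow> L ^ n \<le> exp_err n (n * q)"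
    unfolding exp_err_above_def by blast
  obtain C where C: "\<And>n x. n \<ge> 1 \<Longrightarrow> 0 < x \<Longrightarrow> x \<le> 1 / sqrt 2 \<Longrightarrow>
     ((sqrt 2 * x) powr \<gamma>) ^ n * exp_err n (n * x) \<le> C * (sqrt 2 - 1) ^ n"
    using weighted_exp_err_upper[OF \<gamma>] by blast
  have L0: "L > 0" using L(1) sqrt2_bounds by linarith
  have "(\<lambda>n. C * ((sqrt 2 - 1) / L) ^ n) \<longlonglongrightarrow> C * 0"
    using L(1) L0 by (intro tendsto_intros LIMSEQ_realpow_zero) auto
  then have "\<forall>\<^sub>F n in sequentially. C * ((sqrt 2 - 1) / L) ^ n < 1" by (rule order_tendstoD) simp
  then obtain N' where N': "\<And>n. n \<ge> N' \<Longrightarrow> C * ((sqrt 2 - 1) / L) ^ n < 1"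
    unfolding eventually_sequentially by blast
  have "norm (Q n - 1 / (sqrt 2 * b)) < r" if n: "n \<ge> max 1 (max N N')" for n
  proof (rule ccontr)
    let ?W = "weighted_err (\<lambda>t. t powr \<gamma>) {a..b} n"
    define K where "K = (b powr \<gamma>) ^ n"
    have K: "K > 0" using ab by (simp add: K_def)
    have n1: "n \<ge> 1" using n by simp
    have Qn: "Q n > 0" "\<And>q. q > 0 \<Longrightarrow> ?W (Q n) \<le> ?W q"
      using Q[OF n1] not_less unfolding is_arg_min_def by blast+
    assume "\<not> norm (Q n - 1 / (sqrt 2 * b)) < r"
    then have "r * b \<le> \<bar>Q n - 1 / (sqrt 2 * b)\<bar> * b" using ab by (intro mult_right_mono) auto
    also have "\<dots> = \<bar>b * Q n - 1 / sqrt 2\<bar>"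
    proof -
      have "b * Q n - 1 / sqrt 2 = (Q n - 1 / (sqrt 2 * b)) * b" using ab by (simp add: field_simps)
      then show ?thesis using ab by (simp add: abs_mult)
    qed
    finally have "L ^ n \<le> exp_err n (n * (b * Q n))" using n Qn ab by (intro L(2)) auto
    then have "K * L ^ n \<le> K * exp_err n (n * (b * Q n))" using K by simp
    also have "\<dots> \<le> ?W (Q n)" unfolding K_def using g0 ab n1 Qn by (intro weighted_err_ge) auto
    also have "\<dots> \<le> ?W (1 / (sqrt 2 * b))" using ab by (intro Qn) auto
    also have "\<dots> \<le> K * (C * (sqrt 2 - 1) ^ n)"
      unfolding K_def using g0 ab n1 C by (intro weighted_err_le) auto
    finally have "L ^ n \<le> C * (sqrt 2 - 1) ^ n" using K by simp
    moreover have "C * (sqrt 2 - 1) ^ n = (C * ((sqrt 2 - 1) / L) ^ n) * L ^ n"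
      using L0 by (simp add: power_divide)
    moreover have "\<dots> < 1 * L ^ n" using N'[of n] n L0 by (intro mult_strict_right_mono) auto
    ultimately show False by simp
  qed
  then show "\<exists>no. \<forall>n\<ge>no. norm (Q n - 1 / (sqrt 2 * b)) < r" by blast
qed

text \<open>The limit of the minimizers is expressed as existence of a minimizer for each
  \<open>n\<close> together with convergence of every sequence of minimizers, which covers any
  choice of the minimizing value.\<close>

theorem theorem2p2:
  fixes \<gamma> :: real
  assumes "\<gamma> \<ge> 0.1684"
  shows "mono_on {0<..} (\<lambda>z. z powr \<gamma> * H_tilde z) \<and>
    (\<forall>tmin tmax :: real. 0 \<le> tmin \<longrightarrow> tmin \<le> tmax \<longrightarrow> 0 < tmax \<longrightarrow>
      (\<forall>n\<ge>1. \<exists>q. is_arg_min (weighted_err (\<lambda>t. t powr \<gamma>) {tmin..tmax} n) (\<lambda>q. q > 0) q) \<and>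
      (\<forall>Q :: nat \<Rightarrow> real.
        (\<forall>n\<ge>1. is_arg_min (weighted_err (\<lambda>t. t powr \<gamma>) {tmin..tmax} n) (\<lambda>q. q > 0) (Q n)) \<longrightarrow>
        Q \<longlonglongrightarrow> 1 / (sqrt 2 * tmax)))"
proof (intro conjI allI impI)
  show "mono_on {0<..} (\<lambda>z. z powr \<gamma> * H_tilde z)"
    by (rule mono_weighted_H_tilde[OF assms])
next
  fix tmin tmax :: real and n :: nat
  assume "0 \<le> tmin" "tmin \<le> tmax" "0 < tmax" "1 \<le> n"
  then show "\<exists>q. is_arg_min (weighted_err (\<lambda>t. t powr \<gamma>) {tmin..tmax} n) (\<lambda>q. 0 < q) q"
    using assms by (intro weighted_err_minimizer) auto
next
  fix tmin tmax :: real and Q :: "nat \<Rightarrow> real"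
  assume "0 \<le> tmin" "tmin \<le> tmax" "0 < tmax"
    and "\<forall>n\<ge>1. is_arg_min (weighted_err (\<lambda>t. t powr \<gamma>) {tmin..tmax} n) (\<lambda>q. 0 < q) (Q n)"
  then show "Q \<longlonglongrightarrow> 1 / (sqrt 2 * tmax)"
    by (intro weighted_err_minimizers_tendsto[OF assms]) auto
qed

end
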